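(* Let $0<q\le (1/51)^{1/50}$. Let $f\in L_q^{\infty}[-1,1]$ and suppose that there is a real number $c>0$ such that, as $k\to\infty$, $$\int_{-1}^1 f(t)\,C_q\big(q^{1/2}\omega_kt\big)\,d_qt=\mathcal O\big(q^{(k+c)^2}\big)\quad\text{and}\quad \int_{-1}^1 f(t)\,S_q\big(q\omega_kt\big)\,d_qt=\mathcal O\big(q^{(k+c-\frac12)^2}\big).$$ If $f$ is analytic in the disc $C_\delta=\{z\in\mathbb C:|z|<\delta\}$, where $0<\delta\le q^{-\sigma}$ for some $\sigma$ with $0<\sigma<c$, then $$f(z)=S_q[f](z)\quad\text{for all } z\in C_\delta .$$
   Context: Fix $0<q<1$. Write $(a;q)_n=\prod_{j=0}^{n-1}(1-aq^j)$. The $q$-linear cosine and sine are the entire functions $$C_q(z)=\sum_{n=0}^{\infty}\frac{(-1)^n q^{n(n-1/2)}z^{2n}}{(q;q)_{2n}},\qquad S_q(z)=\sum_{n=0}^{\infty}\frac{(-1)^n q^{n(n+1/2)}z^{2n+1}}{(q;q)_{2n+1}}.$$ All zeros of $S_q$ are real and simple, and they form a countably infinite set symmetric about $0$; its positive zeros are denoted $\omega_1<\omega_2<\omega_3<\cdots$. The $q$-integral is $\int_0^a f(x)\,d_qx=a(1-q)\sum_{n=0}^\infty f(aq^n)q^n$ and $\int_a^b f(x)\,d_qx=\int_0^b f(x)\,d_qx-\int_0^a f(x)\,d_qx$; in particular $\int_{-1}^1 f(x)\,d_qx=(1-q)\sum_{n=0}^\infty\big(f(q^n)+f(-q^n)\big)q^n$.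 The $q$-Fourier series of $f$ is $$S_q[f](z)=\frac{a_0}{2}+\sum_{k=1}^{\infty}\Big[a_kC_q\big(q^{1/2}\omega_kz\big)+b_kS_q\big(q\omega_kz\big)\Big],$$ with $a_0=\int_{-1}^1f(t)\,d_qt$ and, for $k\ge1$, $$a_k=\frac1{\mu_k}\int_{-1}^1f(t)C_q\big(q^{1/2}\omega_kt\big)d_qt,\qquad b_k=\frac{q^{1/2}}{\mu_k}\int_{-1}^1f(t)S_q\big(q\omega_kt\big)d_qt,$$ $$\mu_k=(1-q)\,C_q(q^{1/2}\omega_k)\,S_q'(\omega_k).$$ Here $f$ is a complex-valued function whose domain contains the disc $C_\delta$ and the set $V_q=\{\pm q^{n-1}: n=1,2,3,\ldots\}$, and $L_q^\infty[-1,1]$ is the set of functions $f$ with $\sup\{|f(\pm q^{n-1})|: n=1,2,3,\ldots\}<\infty$ (both signs included). The identity $f(z)=S_q[f](z)$ includes the convergence of the series at $z$. *)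

theory Defs
  imports "HOL-Complex_Analysis.Complex_Analysis" "HOL-Library.Landau_Symbols"
begin

definition qpoch :: "real \<Rightarrow> real \<Rightarrow> nat \<Rightarrow> real" where
  "qpoch a q n = (\<Prod>j<n. 1 - a * q ^ j)"

definition qcos :: "real \<Rightarrow> complex \<Rightarrow> complex" where
  "qcos q z = (\<Sum>n. (-1) ^ n * of_real (q powr (real n * (real n - 1/2))) * z ^ (2 * n)
                      / of_real (qpoch q q (2 * n)))"

definition qsin :: "real \<Rightarrow> complex \<Rightarrow> complex" where
  "qsin q z = (\<Sum>n. (-1) ^ n * of_real (q powr (real n * (real n + 1/2))) * z ^ (2 * n + 1)
                      / of_real (qpoch q q (2 * n + 1)))"

text \<open>For \<open>k \<ge> 1\<close>, \<open>qomega q k\<close> is the \<open>k\<close>-th positive zero of \<open>qsin q\<close>: the zero \<open>x > 0\<close>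
  for which exactly \<open>k\<close> zeros lie in \<open>(0, x]\<close>. The value at \<open>k = 0\<close> is meaningless.\<close>

definition qomega :: "real \<Rightarrow> nat \<Rightarrow> real" where
  "qomega q k = (THE x. x > 0 \<and> qsin q (of_real x) = 0 \<and>
                        card {y::real. 0 < y \<and> y \<le> x \<and> qsin q (of_real y) = 0} = k)"

definition qint0 :: "real \<Rightarrow> (complex \<Rightarrow> complex) \<Rightarrow> complex \<Rightarrow> complex" where
  "qint0 q f a = a * of_real (1 - q) * (\<Sum>n. f (a * of_real (q ^ n)) * of_real (q ^ n))"

definition qint :: "real \<Rightarrow> complex \<Rightarrow> complex \<Rightarrow> (complex \<Rightarrow> complex) \<Rightarrow> complex" where
  "qint q a b f = qint0 q f b - qint0 q f a"

definition Vq :: "real \<Rightarrow> complex set" where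
  "Vq q = range (\<lambda>n::nat. of_real (q ^ n)) \<union> range (\<lambda>n::nat. - of_real (q ^ n))"

definition Lq_infty :: "real \<Rightarrow> (complex \<Rightarrow> complex) set" where
  "Lq_infty q = {f. bdd_above ((\<lambda>x. norm (f x)) ` Vq q)}"

definition qcos_integral :: "real \<Rightarrow> (complex \<Rightarrow> complex) \<Rightarrow> nat \<Rightarrow> complex" where
  "qcos_integral q f k =
     qint q (-1) 1 (\<lambda>t. f t * qcos q (of_real (sqrt q * qomega q k) * t))"

definition qsin_integral :: "real \<Rightarrow> (complex \<Rightarrow> complex) \<Rightarrow> nat \<Rightarrow> complex" where
  "qsin_integral q f k =
     qint q (-1) 1 (\<lambda>t. f t * qsin q (of_real (q * qomega q k) * t))"

definition qmu :: "real \<Rightarrow> nat \<Rightarrow> complex" where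
  "qmu q k = of_real (1 - q) * qcos q (of_real (sqrt q * qomega q k))
               * deriv (qsin q) (of_real (qomega q k))"

definition qfourier_a0 :: "real \<Rightarrow> (complex \<Rightarrow> complex) \<Rightarrow> complex" where
  "qfourier_a0 q f = qint q (-1) 1 f"

definition qfourier_a :: "real \<Rightarrow> (complex \<Rightarrow> complex) \<Rightarrow> nat \<Rightarrow> complex" where
  "qfourier_a q f k = 1 / qmu q k * qcos_integral q f k"

definition qfourier_b :: "real \<Rightarrow> (complex \<Rightarrow> complex) \<Rightarrow> nat \<Rightarrow> complex" where
  "qfourier_b q f k = of_real (sqrt q) / qmu q k * qsin_integral q f k"

definition qfourier_term :: "real \<Rightarrow> (complex \<Rightarrow> complex) \<Rightarrow> complex \<Rightarrow> nat \<Rightarrow> complex" where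
  "qfourier_term q f z k =
     qfourier_a q f k * qcos q (of_real (sqrt q * qomega q k) * z)
     + qfourier_b q f k * qsin q (of_real (q * qomega q k) * z)"

definition qfourier :: "real \<Rightarrow> (complex \<Rightarrow> complex) \<Rightarrow> complex \<Rightarrow> complex" where
  "qfourier q f z = qfourier_a0 q f / 2 + (\<Sum>k. qfourier_term q f z (Suc k))"

end

theory Submission
  imports Defs
begin

text \<open>
  The functions \<open>t \<mapsto> C\<^sub>q(q\<^sup>1\<^sup>/\<^sup>2 l t)\<close> and \<open>t \<mapsto> S\<^sub>q(q l t)\<close>, restricted to the grid \<open>\<plusminus> q ^ n\<close>, solve a
  first-order \<open>q\<close>-difference system, a discrete Sturm-Liouville problem whose boundary condition at
  \<open>t = 1\<close> reads \<open>S\<^sub>q(l) = 0\<close>. Its Lagrange identities (\<open>lagrange_cos\<close>, \<open>lagrange_sin\<close>) yield the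
  orthogonality of the basis functions. Applied to a zero and its conjugate they show that the zeros of
  \<open>S\<^sub>q\<close> are real (\<open>qsin_zero_real\<close>); differentiated at a zero they identify the factor \<open>\<mu>\<^sub>k\<close> as a sum of
  squares (\<open>qsin_zero_norm\<close>), so that the zeros are simple.

  The asymptotic information comes from one transformation (\<open>phi1_expansion\<close>): up to a constant factor and
  in the variable \<open>y = q\<^sup>3\<^sup>/\<^sup>2 z\<^sup>2\<close>, the function \<open>S\<^sub>q(z) / z\<close> is a series in the Euler products
  \<open>(y q\<^sup>2\<^sup>l; q\<^sup>2)\<^sub>\<infinity>\<close>. On circles
  that stay away from the zeros of \<open>(y; q\<^sup>2)\<^sub>\<infinity>\<close> its first term dominates. This has two consequences.
  Rouche's theorem counts the zeros in these circles, which bounds \<open>\<omega>\<^sub>k\<close> above by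
  \<open>q powr (- k + 1/4 - \<epsilon>)\<close> for every \<open>\<epsilon> > 0\<close> and all large \<open>k\<close> (\<open>qomega_le\<close>). And \<open>S\<^sub>q\<close> is as large on the circles
  as the growth of its coefficients allows.

  Completeness (\<open>cos_complete\<close>, \<open>sin_complete\<close>) follows from Liouville's theorem. If all coefficients of a
  bounded sequence vanish, then its transform, as a function of the frequency, vanishes at the zeros of \<open>S\<^sub>q\<close>;
  the quotient by \<open>S\<^sub>q\<close> is entire and bounded on the circles, hence constant, and the constant is \<open>0\<close>. A
  transform that vanishes identically has only vanishing moments, which forces the sequence to be \<open>0\<close>.

  For the theorem, the bound on \<open>\<omega>\<^sub>k\<close> gives a lower bound of order \<open>q ^ k\<close> for \<open>\<mu>\<^sub>k\<close> (\<open>cnorm_lower\<close>) and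
  a Gaussian upper bound for the basis functions on the disc of radius \<open>q powr (- \<sigma>)\<close>. Against the assumed
  decay of the integrals this leaves a geometric majorant, because \<open>\<sigma> < c\<close> (\<open>cos_majorant\<close>, \<open>sin_majorant\<close>). The
  sum of the series has the same coefficients as \<open>f\<close>, hence agrees with \<open>f\<close> on the grid by completeness,
  and on the disc by the identity theorem, since the grid accumulates at \<open>0\<close>.
\<close>

section \<open>Power series with Gaussian coefficients\<close>

text \<open>After a substitution proportional to \<open>z\<^sup>2\<close>, the \<open>q\<close>-cosine, the \<open>q\<close>-sine and the Euler product
  \<open>(y; q\<^sup>2)\<^sub>\<infinity>\<close> all take this form; they differ only in the denominators \<open>D\<close>.\<close>

definition gser :: "real \<Rightarrow> (nat \<Rightarrow> real) \<Rightarrow> complex \<Rightarrow> complex" where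
  "gser q D y = (\<Sum>n. of_real ((-1) ^ n * q ^ (n * (n - 1)) / D n) * y ^ n)"

text \<open>The point is that the bound does not depend on the centre \<open>a\<close>: to the left and to the right
  of \<open>a\<close> the terms are dominated by a geometric series starting with \<open>1\<close>.\<close>

lemma gaussian_sum:
  fixes q a :: real
  assumes q: "0 < q" "q < 1"
  shows "summable (\<lambda>n. q powr ((real n - a)\<^sup>2))" (is ?A)
    and "(\<Sum>n. q powr ((real n - a)\<^sup>2)) \<le> 2 / (1 - q)" (is ?B)
proof -
  define N where "N = nat \<lceil>a\<rceil>"
  define t where "t n = (if n < N then q ^ (N - Suc n) else q ^ (n - N))" for n
  have le_t: "q powr ((real n - a)\<^sup>2) \<le> t n" for n
  proof (cases "n < N")
    case True
    hence "a > real N - 1" unfolding N_def by linarith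
    hence "a - real n \<ge> real (N - Suc n)" using True by simp
    hence "(a - real n)\<^sup>2 \<ge> (real (N - Suc n))\<^sup>2" by (intro power_mono) auto
    moreover have "(real (N - Suc n))\<^sup>2 \<ge> real (N - Suc n)"
      by (metis le_square of_nat_le_iff of_nat_mult power2_eq_square)
    ultimately have "real (N - Suc n) \<le> (real n - a)\<^sup>2"
      using power2_commute[of "real n" a] by linarith
    hence "q powr ((real n - a)\<^sup>2) \<le> q powr real (N - Suc n)"
      using q by (intro powr_mono') auto
    thus ?thesis using True q powr_realpow[of q "N - Suc n"] by (simp add: t_def)
  next
    case False
    have "a \<le> real N" unfolding N_def by linarith
    hence "real n - a \<ge> real (n - N)" using False by simp
    hence "(real n - a)\<^sup>2 \<ge> (real (n - N))\<^sup>2" by (intro power_mono) auto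
    moreover have "(real (n - N))\<^sup>2 \<ge> real (n - N)"
      by (metis le_square of_nat_le_iff of_nat_mult power2_eq_square)
    ultimately have "real (n - N) \<le> (real n - a)\<^sup>2" by linarith
    hence "q powr ((real n - a)\<^sup>2) \<le> q powr real (n - N)"
      using q by (intro powr_mono') auto
    thus ?thesis using False q powr_realpow[of q "n - N"] by (simp add: t_def)
  qed
  have geo: "(\<lambda>n. q ^ n) sums (1 / (1 - q))" using q by (intro geometric_sums) auto
  have geo_le: "(\<Sum>n<N. q ^ n) \<le> 1 / (1 - q)"
    using q by (subst sums_unique[OF geo], intro sum_le_suminf sums_summable[OF geo]) auto
  have tail: "(\<lambda>n. t (n + N)) sums (1 / (1 - q))"
    using geo by (simp add: t_def)
  hence t: "summable t" by (metis sums_summable summable_iff_shift)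
  have "suminf t = (\<Sum>n. t (n + N)) + (\<Sum>n<N. t n)"
    by (rule suminf_split_initial_segment[OF t])
  also have "(\<Sum>n<N. t n) = (\<Sum>n<N. q ^ n)"
    using sum.nat_diff_reindex[of "\<lambda>n. q ^ n" N] by (simp add: t_def)
  also have "(\<Sum>n. t (n + N)) = 1 / (1 - q)"
    using tail by (simp add: sums_iff)
  finally have sum_t: "suminf t \<le> 2 / (1 - q)" using geo_le by simp
  show ?A
    by (rule summable_comparison_test'[OF t, of 0]) (use le_t in auto)
  thus ?B
    using suminf_le[OF le_t _ t] sum_t by linarith
qed

text \<open>Completing the square turns \<open>q ^ (n * (n - 1)) * r ^ n\<close> into a Gaussian centred at \<open>(R + 1) / 2\<close>.
  For \<open>R \<ge> 0\<close> this loses only a constant factor, so that the bound matches the lower bounds that the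
  comparison with the Euler product gives.\<close>

lemma gaussian_power_sum:
  fixes q r R :: real
  assumes q: "0 < q" "q < 1" and r: "0 \<le> r" "r \<le> q powr (- R)"
  shows "summable (\<lambda>n. q ^ (n * (n - 1)) * r ^ n)" (is ?A)
    and "(\<Sum>n. q ^ (n * (n - 1)) * r ^ n) \<le> 2 / (1 - q) * q powr (- ((R + 1)\<^sup>2 / 4))" (is ?B)
proof -
  define a where "a = (R + 1) / 2"
  have le: "q ^ (n * (n - 1)) * r ^ n \<le> q powr ((real n - a)\<^sup>2) * q powr (- ((R + 1)\<^sup>2 / 4))" for n
  proof -
    have e1: "q ^ (n * (n - 1)) = q powr (real n * (real n - 1))"
      using q by (cases n) (simp_all add: powr_realpow [symmetric] algebra_simps)
    have "r ^ n \<le> (q powr (- R)) ^ n" using r by (intro power_mono) auto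
    also have "\<dots> = q powr (- R * real n)"
      using q by (simp add: powr_powr powr_realpow [symmetric])
    finally have "q ^ (n * (n - 1)) * r ^ n \<le> q powr (real n * (real n - 1)) * q powr (- R * real n)"
      unfolding e1 by (intro mult_left_mono) auto
    also have "\<dots> = q powr ((real n - a)\<^sup>2) * q powr (- ((R + 1)\<^sup>2 / 4))"
      unfolding powr_add [symmetric] a_def
      by (rule arg_cong[where f = "\<lambda>x. q powr x"]) (simp add: field_simps power2_eq_square)
    finally show ?thesis .
  qed
  note s = summable_mult2[OF gaussian_sum(1)[OF q, of a], of "q powr (- ((R + 1)\<^sup>2 / 4))"]
  show ?A
    by (rule summable_comparison_test[OF _ s]) (use le q r in \<open>auto simp: abs_mult\<close>)
  have "(\<Sum>n. q ^ (n * (n - 1)) * r ^ n) \<le> (\<Sum>n. q powr ((real n - a)\<^sup>2) * q powr (- ((R + 1)\<^sup>2 / 4)))"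
    using le \<open>?A\<close> s by (intro suminf_le) auto
  also have "\<dots> = (\<Sum>n. q powr ((real n - a)\<^sup>2)) * q powr (- ((R + 1)\<^sup>2 / 4))"
    by (rule suminf_mult2[symmetric, OF gaussian_sum(1)[OF q]])
  also have "\<dots> \<le> 2 / (1 - q) * q powr (- ((R + 1)\<^sup>2 / 4))"
    by (intro mult_right_mono gaussian_sum(2)[OF q]) auto
  finally show ?B .
qed

locale gauss_series =
  fixes q d :: real and D :: "nat \<Rightarrow> real"
  assumes q_pos: "0 < q" and q_less_1: "q < 1"
    and d_pos: "0 < d" and D_ge: "\<And>n. d \<le> D n"
begin

lemma D_pos: "0 < D n"
  using d_pos D_ge[of n] by linarith

lemma norm_term_le:
  "norm (of_real ((-1) ^ n * q ^ (n * (n - 1)) / D n) * y ^ n)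
     \<le> 1 / d * (q ^ (n * (n - 1)) * norm (y::complex) ^ n)"
proof -
  have "norm (of_real ((-1) ^ n * q ^ (n * (n - 1)) / D n) * y ^ n)
      = q ^ (n * (n - 1)) * norm y ^ n / D n"
    using q_pos D_pos[of n] by (simp add: norm_mult norm_power norm_divide abs_mult power_abs)
  also have "\<dots> \<le> q ^ (n * (n - 1)) * norm y ^ n / d"
    using q_pos D_ge[of n] d_pos by (intro divide_left_mono) auto
  finally show ?thesis by simp
qed

lemma power_le_q_powr:
  assumes "0 \<le> (r::real)"
  shows "\<exists>R. r \<le> q powr (- R)"
proof -
  have "max r 1 = q powr (- (- log q (max r 1)))" using q_pos q_less_1 by simp
  thus ?thesis by (metis max.cobounded1)
qed

lemma summable_norm_gser:
  "summable (\<lambda>n. norm (of_real ((-1) ^ n * q ^ (n * (n - 1)) / D n) * (y::complex) ^ n))"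
proof -
  obtain R where "norm y \<le> q powr (- R)" using power_le_q_powr[of "norm y"] by auto
  from gaussian_power_sum(1)[OF q_pos q_less_1 _ this]
  have "summable (\<lambda>n. 1 / d * (q ^ (n * (n - 1)) * norm y ^ n))" by (intro summable_mult) auto
  thus ?thesis
    by (rule summable_comparison_test'[where N = 0]) (use norm_term_le in simp)
qed

lemma gser_sums:
  "(\<lambda>n. of_real ((-1) ^ n * q ^ (n * (n - 1)) / D n) * y ^ n) sums gser q D y"
  unfolding gser_def by (intro summable_sums summable_norm_cancel[OF summable_norm_gser])

lemma norm_gser_le:
  assumes "norm y \<le> q powr (- R)"
  shows "norm (gser q D y) \<le> 2 / (d * (1 - q)) * q powr (- ((R + 1)\<^sup>2 / 4))"
proof -
  note g = gaussian_power_sum[OF q_pos q_less_1 norm_ge_zero assms]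
  have "norm (gser q D y) \<le> (\<Sum>n. norm (of_real ((-1) ^ n * q ^ (n * (n - 1)) / D n) * y ^ n))"
    unfolding gser_def by (rule summable_norm[OF summable_norm_gser])
  also have "\<dots> \<le> (\<Sum>n. 1 / d * (q ^ (n * (n - 1)) * norm y ^ n))"
    by (intro suminf_le summable_norm_gser norm_term_le summable_mult g(1))
  also have "\<dots> = 1 / d * (\<Sum>n. q ^ (n * (n - 1)) * norm y ^ n)"
    by (rule suminf_mult[OF g(1)])
  also have "\<dots> \<le> 1 / d * (2 / (1 - q) * q powr (- ((R + 1)\<^sup>2 / 4)))"
    using d_pos by (intro mult_left_mono g(2)) auto
  finally show ?thesis by simp
qed

lemma gser_0: "gser q D 0 = of_real (1 / D 0)"
  using sums_unique[OF gser_sums[of 0]] powser_sums_zero[of "\<lambda>n. of_real ((-1) ^ n * q ^ (n * (n - 1)) / D n) :: complex"]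
  by (simp add: sums_iff)

lemma holomorphic_gser [holomorphic_intros]: "gser q D holomorphic_on A"
proof -
  have "(gser q D has_field_derivative (\<Sum>n. diffs (\<lambda>n. of_real ((-1) ^ n * q ^ (n * (n - 1)) / D n)) n * y ^ n)) (at y)" for y
    unfolding gser_def
    by (rule termdiffs_strong_converges_everywhere) (rule summable_norm_cancel[OF summable_norm_gser])
  thus ?thesis
    by (meson holomorphic_on_def field_differentiable_def has_field_derivative_at_within)
qed

lemma continuous_gser: "isCont (gser q D) y"
  using holomorphic_gser[of UNIV] holomorphic_on_imp_continuous_on continuous_on_eq_continuous_at
  by blast

end

section \<open>Finite q-shifted factorials\<close>

lemma qpoch_Suc: "qpoch a q (Suc n) = qpoch a q n * (1 - a * q ^ n)"
  by (simp add: qpoch_def)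

lemma qpoch_0 [simp]: "qpoch a q 0 = 1"
  by (simp add: qpoch_def)

text \<open>Once the remaining terms \<open>a * r ^ j\<close> sum to at most \<open>1/2\<close>, the Weierstrass product inequality shows
  that later factors cost at most a factor \<open>1/2\<close>.\<close>

lemma qpoch_bounded_below:
  assumes "0 \<le> a" "a < 1" "0 < r" "r < (1::real)"
  shows "\<exists>d>0. \<forall>n. d \<le> qpoch a r n"
proof -
  have ar: "a * r ^ n \<in> {0..1}" "a * r ^ n < 1" for n
  proof -
    have "a * r ^ n \<le> a * 1" using assms by (intro mult_left_mono power_le_one) auto
    thus "a * r ^ n \<in> {0..1}" "a * r ^ n < 1" using assms by auto
  qed
  have "(\<lambda>n. r ^ n / (1 - r)) \<longlonglongrightarrow> 0 / (1 - r)"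
    using assms by (intro tendsto_intros LIMSEQ_realpow_zero) auto
  hence "eventually (\<lambda>n. r ^ n / (1 - r) < 1 / 2) sequentially"
    by (rule order_tendstoD(2)) simp
  then obtain N where N: "r ^ N / (1 - r) < 1 / 2" by (auto simp: eventually_sequentially)
  define d where "d = qpoch a r N / 2"
  have pos: "qpoch a r n > 0" for n
    unfolding qpoch_def using ar by (intro prod_pos) auto
  have dec: "qpoch a r (n + m) \<le> qpoch a r n" for n m
  proof (induction m)
    case (Suc m)
    have "qpoch a r (n + m) * (1 - a * r ^ (n + m)) \<le> qpoch a r (n + m) * 1"
      using ar[of "n + m"] pos[of "n + m"] by (intro mult_left_mono) auto
    thus ?case using Suc by (simp add: qpoch_Suc)
  qed simp
  have tail: "1 / 2 \<le> (\<Prod>j<m. 1 - a * r ^ (N + j))" for m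
  proof -
    have "(\<Sum>j<m. a * r ^ (N + j)) \<le> (\<Sum>j<m. r ^ N * r ^ j)"
      using assms by (intro sum_mono) (auto simp: power_add intro!: mult_left_le_one_le)
    also have "\<dots> = r ^ N * (\<Sum>j<m. r ^ j)" by (simp add: sum_distrib_left)
    also have "\<dots> \<le> r ^ N * (\<Sum>j. r ^ j)"
      using assms by (intro mult_left_mono sum_le_suminf summable_geometric) auto
    also have "\<dots> = r ^ N / (1 - r)" using assms by (simp add: suminf_geometric)
    finally have "1 / 2 \<le> 1 - (\<Sum>j<m. a * r ^ (N + j))" using N by linarith
    also have "\<dots> \<le> (\<Prod>j<m. 1 - a * r ^ (N + j))"
      by (rule Weierstrass_prod_ineq) (use ar in blast)
    finally show ?thesis .
  qed
  have split: "qpoch a r (N + m) = qpoch a r N * (\<Prod>j<m. 1 - a * r ^ (N + j))" for m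
    by (induction m) (simp_all add: qpoch_Suc algebra_simps)
  have "d \<le> qpoch a r n" for n
  proof -
    have "d \<le> qpoch a r (N + n)"
      unfolding split d_def using mult_left_mono[OF tail[of n], of "qpoch a r N"] pos[of N] by simp
    also have "\<dots> \<le> qpoch a r n" using dec[of n N] by (simp add: add.commute)
    finally show ?thesis .
  qed
  moreover have "d > 0" using pos by (simp add: d_def)
  ultimately show ?thesis by blast
qed

section \<open>The q-cosine, the q-sine and the Euler product\<close>

lemma suminf_swap_dominated:
  fixes f :: "nat \<Rightarrow> nat \<Rightarrow> complex"
  assumes u: "summable u" and v: "summable v"
    and u0: "\<And>i. 0 \<le> u i" and v0: "\<And>j. 0 \<le> (v j :: real)"
    and le: "\<And>i j. norm (f i j) \<le> u i * v j"
  shows "(\<lambda>j. \<Sum>i. f i j) sums (\<Sum>i. \<Sum>j. f i j)"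
proof -
  have "(\<lambda>(i, j). u i * v j) summable_on (UNIV \<times> UNIV)"
  proof (rule summable_on_SigmaI)
    show "((\<lambda>j. case (i, j) of (i, j) \<Rightarrow> u i * v j) has_sum u i * suminf v) UNIV" for i
      using has_sum_cmult_right[OF sums_nonneg_imp_has_sum[OF summable_sums[OF v] v0], of "u i"]
      by simp
    show "(\<lambda>i. u i * suminf v) summable_on UNIV"
      using u u0 by (intro summable_on_cmult_left summable_nonneg_imp_summable_on)
  qed (use u0 v0 in auto)
  hence abs: "(\<lambda>x. norm ((\<lambda>(i, j). f i j) x)) summable_on (UNIV \<times> UNIV)"
    by (rule Infinite_Sum.abs_summable_on_comparison_test') (use le in auto)
  hence s: "(\<lambda>(i, j). f i j) summable_on (UNIV \<times> UNIV)"
    by (rule abs_summable_summable)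
  have s': "(\<lambda>(j, i). f i j) summable_on (UNIV \<times> UNIV)"
    using s summable_on_reindex[of prod.swap "UNIV \<times> UNIV" "\<lambda>(j, i). f i j"]
    by (simp add: o_def case_prod_unfold product_swap)
  have row: "infsum (\<lambda>j. f i j) UNIV = (\<Sum>j. f i j)" "f i summable_on UNIV" for i
    using summable_on_SigmaD1[OF s, of i] by (auto intro!: sums_unique has_sum_imp_sums has_sum_infsum)
  have col: "infsum (\<lambda>i. f i j) UNIV = (\<Sum>i. f i j)" "(\<lambda>i. f i j) summable_on UNIV" for j
    using summable_on_SigmaD1[OF s', of j] by (auto intro!: sums_unique has_sum_imp_sums has_sum_infsum)
  have "(\<lambda>i. infsum (\<lambda>j. f i j) UNIV) summable_on UNIV"
    using summable_on_Sigma_banach[OF s] by simp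
  hence 1: "(\<Sum>i. \<Sum>j. f i j) = infsum (\<lambda>i. infsum (\<lambda>j. f i j) UNIV) UNIV"
    unfolding row by (auto intro!: sums_unique[symmetric] has_sum_imp_sums has_sum_infsum)
  have "(\<lambda>j. infsum (\<lambda>i. f i j) UNIV) summable_on UNIV"
    using summable_on_Sigma_banach[OF s'] by simp
  hence "(\<lambda>j. infsum (\<lambda>i. f i j) UNIV) sums infsum (\<lambda>j. infsum (\<lambda>i. f i j) UNIV) UNIV"
    by (intro has_sum_imp_sums has_sum_infsum)
  thus ?thesis using infsum_swap_banach[OF s] unfolding 1 col by simp
qed

locale q_base =
  fixes q :: real
  assumes q_pos: "0 < q" and q_less_1: "q < 1"
begin

abbreviation p :: real where "p \<equiv> q\<^sup>2"

lemma p_pos: "0 < p" and p_less_1: "p < 1"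
  using q_pos q_less_1 by (auto simp: power_less_one_iff)

lemma p_power_le_1: "p ^ n \<le> 1"
  by (intro power_le_one less_imp_le p_pos p_less_1)

lemma p_power_eq: "p ^ n = q ^ (2 * n)"
  by (simp only: power_mult)

lemma p_power_tendsto: "(\<lambda>n. p ^ n) \<longlonglongrightarrow> 0"
  by (intro LIMSEQ_realpow_zero less_imp_le p_pos p_less_1)

text \<open>Positive lower bounds for the denominators, chosen once so that the constants below can refer to them.\<close>

definition dq :: real where "dq = (SOME d. d > 0 \<and> (\<forall>n. d \<le> qpoch q q n))"
definition dp :: real where "dp = (SOME d. d > 0 \<and> (\<forall>n. d \<le> qpoch p p n))"

lemma dq: "dq > 0" "dq \<le> qpoch q q n"
  using someI_ex[OF qpoch_bounded_below[of q q, unfolded Bex_def]] q_pos q_less_1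
  unfolding dq_def [symmetric] by auto

lemma dp: "dp > 0" "dp \<le> qpoch p p n"
  using someI_ex[OF qpoch_bounded_below[of p p, unfolded Bex_def]] p_pos p_less_1
  unfolding dp_def [symmetric] by auto

text \<open>\<open>phi0\<close> is the \<open>q\<close>-cosine and \<open>phi1\<close> the \<open>q\<close>-sine divided by its argument, both as functions of a
  multiple of the squared argument; \<open>Eul\<close> is the infinite product \<open>(y; q\<^sup>2)\<^sub>\<infinity>\<close>, in the form given
  by Euler's identity.\<close>

definition phi0 :: "complex \<Rightarrow> complex" where "phi0 = gser q (\<lambda>n. qpoch q q (2 * n))"
definition phi1 :: "complex \<Rightarrow> complex" where "phi1 = gser q (\<lambda>n. qpoch q q (2 * n + 1))"
definition Eul :: "complex \<Rightarrow> complex" where "Eul = gser q (qpoch p p)"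

sublocale phi0: gauss_series q dq "\<lambda>n. qpoch q q (2 * n)"
  by unfold_locales (use q_pos q_less_1 dq in auto)
sublocale phi1: gauss_series q dq "\<lambda>n. qpoch q q (2 * n + 1)"
  by unfold_locales (use q_pos q_less_1 dq in auto)
sublocale Eul: gauss_series q dp "qpoch p p"
  by unfold_locales (use q_pos q_less_1 dp in auto)

lemmas phi0_sums = phi0.gser_sums[folded phi0_def]
lemmas phi1_sums = phi1.gser_sums[folded phi1_def]
lemmas Eul_sums = Eul.gser_sums[folded Eul_def]

lemma q_powr_split:
  "q powr (real n * (real n - 1 / 2)) = q ^ (n * (n - 1)) * sqrt q ^ n"
  "q powr (real n * (real n + 1 / 2)) = q ^ (n * (n - 1)) * (q * sqrt q) ^ n"
proof -
  have a: "q ^ (n * (n - 1)) = q powr (real n * (real n - 1))"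
    using q_pos by (cases n) (simp_all add: powr_realpow [symmetric] algebra_simps)
  have b: "sqrt q ^ n = q powr (real n / 2)"
    using q_pos by (simp add: powr_half_sqrt [symmetric] powr_powr powr_realpow [symmetric])
  have c: "q ^ n = q powr real n" using q_pos by (simp add: powr_realpow)
  show "q powr (real n * (real n - 1 / 2)) = q ^ (n * (n - 1)) * sqrt q ^ n"
    unfolding a b powr_add [symmetric] by (simp add: algebra_simps)
  show "q powr (real n * (real n + 1 / 2)) = q ^ (n * (n - 1)) * (q * sqrt q) ^ n"
    unfolding a b c power_mult_distrib powr_add [symmetric] by (simp add: algebra_simps)
qed

lemma qcos_eq: "qcos q z = phi0 (of_real (sqrt q) * z\<^sup>2)"
  unfolding qcos_def phi0_def gser_def
  by (intro arg_cong[where f = suminf] ext)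
     (simp add: q_powr_split power_mult_distrib power_mult)

lemma qsin_eq: "qsin q z = z * phi1 (of_real (q * sqrt q) * z\<^sup>2)"
proof -
  have "(\<lambda>n. z * (of_real ((-1) ^ n * q ^ (n * (n - 1)) / qpoch q q (2 * n + 1)) * (of_real (q * sqrt q) * z\<^sup>2) ^ n))
          sums (z * phi1 (of_real (q * sqrt q) * z\<^sup>2))"
    by (intro sums_mult phi1_sums)
  also have "(\<lambda>n. z * (of_real ((-1) ^ n * q ^ (n * (n - 1)) / qpoch q q (2 * n + 1)) * (of_real (q * sqrt q) * z\<^sup>2) ^ n))
    = (\<lambda>n. (-1) ^ n * of_real (q powr (real n * (real n + 1/2))) * z ^ (2 * n + 1)
                      / of_real (qpoch q q (2 * n + 1)))"
    by (intro ext) (simp add: q_powr_split power_mult_distrib power_mult power_add)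
  finally show ?thesis unfolding qsin_def by (rule sums_unique[symmetric])
qed

section \<open>Functional equations in base q\<close>

lemma sums_shift_eq:
  fixes a :: "nat \<Rightarrow> complex"
  assumes "a sums x" "b sums y" "a 0 = 0" "\<And>n. a (Suc n) = b n"
  shows "x = y"
  using sums_Suc[of a y] assms by (metis add.right_neutral ext sums_unique2)

lemma q_exp_Suc: "q ^ (Suc n * (Suc n - 1)) = q ^ (n * (n - 1)) * p ^ n"
proof -
  have "Suc n * (Suc n - 1) = n * (n - 1) + 2 * n" by (cases n) (simp_all add: algebra_simps)
  thus ?thesis by (simp only: power_add power_mult)
qed

lemma phi0_rec: "phi0 y - phi0 (of_real p * y) = - y * phi1 (of_real p * y)"
proof (rule sums_shift_eq)
  define A where "A n = (-1) ^ n * q ^ (n * (n - 1)) / qpoch q q (2 * n)" for n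
  define B where "B n = (-1) ^ n * q ^ (n * (n - 1)) / qpoch q q (2 * n + 1)" for n
  show "(\<lambda>n. of_real (A n) * y ^ n - of_real (A n) * (of_real p * y) ^ n) sums
      (phi0 y - phi0 (of_real p * y))"
    unfolding A_def by (intro sums_diff phi0_sums)
  show "(\<lambda>n. - y * (of_real (B n) * (of_real p * y) ^ n)) sums
      (- y * phi1 (of_real p * y))"
    unfolding B_def by (intro sums_mult phi1_sums)
  have AB: "A (Suc n) * (1 - p ^ Suc n) = - B n * p ^ n" for n
  proof -
    have Q: "qpoch q q (2 * Suc n) = qpoch q q (2 * n + 1) * (1 - p ^ Suc n)"
      by (simp add: qpoch_Suc p_power_eq[of "Suc n"] del: power_Suc)
         (simp add: power2_eq_square)
    have "p ^ Suc n < 1" using p_pos p_less_1 by (intro power_Suc_less_one)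
    thus ?thesis unfolding A_def B_def Q q_exp_Suc by simp
  qed
  show "of_real (A (Suc n)) * y ^ Suc n - of_real (A (Suc n)) * (of_real p * y) ^ Suc n
      = - y * (of_real (B n) * (of_real p * y) ^ n)" for n
  proof -
    have "of_real (A (Suc n)) * y ^ Suc n - of_real (A (Suc n)) * (of_real p * y) ^ Suc n
        = of_real (A (Suc n) * (1 - p ^ Suc n)) * y ^ Suc n"
      by (simp add: power_mult_distrib algebra_simps)
    thus ?thesis unfolding AB by (simp add: power_mult_distrib)
  qed
qed simp

lemma phi1_rec: "phi1 y - of_real q * phi1 (of_real p * y) = phi0 y"
proof (rule sums_unique2)
  define A where "A n = (-1) ^ n * q ^ (n * (n - 1)) / qpoch q q (2 * n)" for n
  define B where "B n = (-1) ^ n * q ^ (n * (n - 1)) / qpoch q q (2 * n + 1)" for n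
  show "(\<lambda>n. of_real (B n) * y ^ n - of_real q * (of_real (B n) * (of_real p * y) ^ n)) sums
      (phi1 y - of_real q * phi1 (of_real p * y))"
    unfolding B_def by (intro sums_diff sums_mult phi1_sums)
  have AB: "B n * (1 - q * p ^ n) = A n" for n
  proof -
    have Q: "qpoch q q (2 * n + 1) = qpoch q q (2 * n) * (1 - q * p ^ n)"
      by (simp add: qpoch_Suc p_power_eq)
    have "q * p ^ n \<le> q" using q_pos p_power_le_1[of n] by simp
    hence "1 - q * p ^ n \<noteq> 0" using q_less_1 by linarith
    thus ?thesis unfolding A_def B_def Q by simp
  qed
  have "of_real (B n) * y ^ n - of_real q * (of_real (B n) * (of_real p * y) ^ n) = of_real (A n) * y ^ n" for n
  proof -
    have "of_real (B n) * y ^ n - of_real q * (of_real (B n) * (of_real p * y) ^ n)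
        = of_real (B n * (1 - q * p ^ n)) * y ^ n"
      by (simp add: power_mult_distrib algebra_simps)
    thus ?thesis unfolding AB .
  qed
  thus "(\<lambda>n. of_real (B n) * y ^ n - of_real q * (of_real (B n) * (of_real p * y) ^ n)) sums phi0 y"
    using phi0_sums[of y] by (simp add: A_def)
qed

lemma Eul_rec: "Eul y = (1 - y) * Eul (of_real p * y)"
proof -
  have "Eul y - Eul (of_real p * y) = - y * Eul (of_real p * y)"
  proof (rule sums_shift_eq)
    define A where "A n = (-1) ^ n * q ^ (n * (n - 1)) / qpoch p p n" for n
    show "(\<lambda>n. of_real (A n) * y ^ n - of_real (A n) * (of_real p * y) ^ n) sums
        (Eul y - Eul (of_real p * y))"
      unfolding A_def by (intro sums_diff Eul_sums)
    show "(\<lambda>n. - y * (of_real (A n) * (of_real p * y) ^ n)) sums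
        (- y * Eul (of_real p * y))"
      unfolding A_def by (intro sums_mult Eul_sums)
    have AB: "A (Suc n) * (1 - p ^ Suc n) = - A n * p ^ n" for n
    proof -
      have "p ^ Suc n < 1" using p_pos p_less_1 by (intro power_Suc_less_one)
      thus ?thesis unfolding A_def qpoch_Suc q_exp_Suc by simp
    qed
    show "of_real (A (Suc n)) * y ^ Suc n - of_real (A (Suc n)) * (of_real p * y) ^ Suc n
        = - y * (of_real (A n) * (of_real p * y) ^ n)" for n
    proof -
      have "of_real (A (Suc n)) * y ^ Suc n - of_real (A (Suc n)) * (of_real p * y) ^ Suc n
          = of_real (A (Suc n) * (1 - p ^ Suc n)) * y ^ Suc n"
        by (simp add: power_mult_distrib algebra_simps)
      thus ?thesis unfolding AB by (simp add: power_mult_distrib)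
    qed
  qed simp
  thus ?thesis by (simp add: algebra_simps)
qed

lemma Eul_prod: "Eul y = (\<Prod>j<n. 1 - of_real (p ^ j) * y) * Eul (of_real (p ^ n) * y)"
proof (induction n)
  case (Suc n)
  have "Eul (of_real (p ^ n) * y) = (1 - of_real (p ^ n) * y) * Eul (of_real (p ^ Suc n) * y)"
    by (subst Eul_rec) (simp add: mult_ac)
  thus ?case using Suc by simp
qed simp

lemma Eul_tendsto: "(\<lambda>n. Eul (of_real (p ^ n) * y)) \<longlonglongrightarrow> 1"
proof -
  have "(\<lambda>n. of_real (p ^ n) * y) \<longlonglongrightarrow> of_real 0 * y"
    by (intro tendsto_intros p_power_tendsto)
  hence "(\<lambda>n. Eul (of_real (p ^ n) * y)) \<longlonglongrightarrow> Eul 0"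
    using isCont_tendsto_compose[OF Eul.continuous_gser] by (simp add: Eul_def)
  thus ?thesis using Eul.gser_0 by (simp add: Eul_def)
qed

text \<open>The functional equation peels off one factor at a time, and what remains tends to \<open>Eul 0 = 1\<close>.\<close>

lemma Eul_limit: "(\<lambda>n. \<Prod>j<n. 1 - of_real (p ^ j) * y) \<longlonglongrightarrow> Eul y"
proof -
  have ev: "eventually (\<lambda>n. Eul (of_real (p ^ n) * y) \<noteq> 0) sequentially"
    using tendsto_imp_eventually_ne[OF Eul_tendsto, of 0] by simp
  have "(\<lambda>n. Eul y / Eul (of_real (p ^ n) * y)) \<longlonglongrightarrow> Eul y / 1"
    by (intro tendsto_intros Eul_tendsto) auto
  moreover have "eventually (\<lambda>n. Eul y / Eul (of_real (p ^ n) * y) = (\<Prod>j<n. 1 - of_real (p ^ j) * y)) sequentially"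
    using ev by eventually_elim (metis Eul_prod nonzero_mult_div_cancel_right)
  ultimately show ?thesis by (simp add: tendsto_cong)
qed

section \<open>Expansion of the q-sine in Euler products\<close>

text \<open>Expanding the inner Euler product gives a double series that is symmetric under exchanging
  \<open>(y, n)\<close> with \<open>(w, l)\<close>.\<close>

lemma Eul_swap:
  fixes a :: "nat \<Rightarrow> real"
  defines "a \<equiv> (\<lambda>n. (-1) ^ n * q ^ (n * (n - 1)) / qpoch p p n)"
  shows "(\<lambda>l. of_real (a l) * w ^ l * Eul (of_real (p ^ l) * y)) sums
           (\<Sum>n. of_real (a n) * y ^ n * Eul (of_real (p ^ n) * w))"
proof -
  define f where "f n l = of_real (a n) * y ^ n * (of_real (a l) * (of_real (p ^ n) * w) ^ l)" for n l
  have f_sym: "f n l = of_real (a l) * w ^ l * (of_real (a n) * (of_real (p ^ l) * y) ^ n)" for n l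
  proof -
    have "(p ^ n) ^ l = (p ^ l) ^ n" by (metis power_mult mult.commute)
    hence "of_real ((p ^ n) ^ l) = (of_real ((p ^ l) ^ n) :: complex)" by simp
    thus ?thesis unfolding f_def power_mult_distrib of_real_power [symmetric] by (simp add: mult_ac)
  qed
  have row: "(\<Sum>l. f n l) = of_real (a n) * y ^ n * Eul (of_real (p ^ n) * w)" for n
    unfolding f_def a_def by (intro sums_unique[symmetric] sums_mult Eul_sums)
  have col: "(\<Sum>n. f n l) = of_real (a l) * w ^ l * Eul (of_real (p ^ l) * y)" for l
    unfolding f_sym unfolding a_def by (intro sums_unique[symmetric] sums_mult Eul_sums)
  have "(\<lambda>l. \<Sum>n. f n l) sums (\<Sum>n. \<Sum>l. f n l)"
  proof (rule suminf_swap_dominated)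
    show "summable (\<lambda>n. norm (of_real (a n) * y ^ n))" "summable (\<lambda>n. norm (of_real (a n) * w ^ n))"
      unfolding a_def by (rule Eul.summable_norm_gser)+
    show "norm (f n l) \<le> norm (of_real (a n) * y ^ n) * norm (of_real (a l) * w ^ l)" for n l
    proof -
      have "norm (f n l) = norm (of_real (a n) * y ^ n) * norm (of_real (a l) * w ^ l) * (p ^ n) ^ l"
        unfolding f_def power_mult_distrib using p_pos by (simp add: norm_mult norm_power mult_ac)
      moreover have "(p ^ n) ^ l \<le> 1"
        using p_power_le_1[of "n * l"] by (simp only: power_mult)
      ultimately show ?thesis by (metis mult_left_le norm_ge_zero zero_le_mult_iff)
    qed
  qed auto
  thus ?thesis unfolding row col .
qed

lemma qpoch_odd: "qpoch q q (2 * n + 1) = (1 - q) * qpoch p p n * qpoch (q ^ 3) p n"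
proof (induction n)
  case (Suc n)
  have "qpoch q q (2 * Suc n + 1) = qpoch q q (2 * n + 1) * (1 - p * p ^ n) * (1 - q ^ 3 * p ^ n)"
    by (simp add: qpoch_Suc p_power_eq) (simp add: power2_eq_square power3_eq_cube mult_ac)
  thus ?case unfolding Suc by (simp add: qpoch_Suc mult_ac)
qed (simp add: qpoch_def)

text \<open>This is the transformation of the \<open>\<^sub>1\<phi>\<^sub>1\<close> series that exchanges its argument with its
  parameter: after it, large arguments are controlled by the Euler product alone.\<close>

lemma phi1_expansion:
  "(\<lambda>l. of_real ((-1) ^ l * q ^ (l * (l - 1)) / qpoch p p l) * of_real (q ^ 3) ^ l * Eul (of_real (p ^ l) * y))
     sums (of_real (1 - q) * Eul (of_real (q ^ 3)) * phi1 y)"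
proof -
  have "of_real ((-1) ^ n * q ^ (n * (n - 1)) / qpoch p p n) * y ^ n * Eul (of_real (p ^ n) * of_real (q ^ 3))
     = of_real (1 - q) * Eul (of_real (q ^ 3)) *
        (of_real ((-1) ^ n * q ^ (n * (n - 1)) / qpoch q q (2 * n + 1)) * y ^ n)" for n
  proof -
    have pos: "q ^ 3 * p ^ j < 1" for j
    proof -
      have "q ^ 3 * p ^ j = q * q ^ (2 + 2 * j)" by (simp add: power_add power_mult power2_eq_square power3_eq_cube)
      also have "\<dots> < 1" using q_pos q_less_1 by (metis power_Suc power_Suc_less_one)
      finally show ?thesis .
    qed
    have "qpoch (q ^ 3) p n \<noteq> 0" unfolding qpoch_def using pos by (auto simp: less_le)
    hence "of_real (qpoch (q ^ 3) p n) \<noteq> (0::complex)" by simp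
    moreover have "Eul (of_real (q ^ 3)) = of_real (qpoch (q ^ 3) p n) * Eul (of_real (p ^ n) * of_real (q ^ 3))"
      by (subst Eul_prod[of _ n]) (simp add: qpoch_def mult.commute)
    moreover have "of_real (1 - q) \<noteq> (0::complex)" using q_less_1 by (simp only: of_real_eq_0_iff)
    ultimately show ?thesis
      unfolding qpoch_odd of_real_divide of_real_mult by (simp only: field_simps) simp
  qed
  hence "(\<Sum>n. of_real ((-1) ^ n * q ^ (n * (n - 1)) / qpoch p p n) * y ^ n * Eul (of_real (p ^ n) * of_real (q ^ 3)))
     = of_real (1 - q) * Eul (of_real (q ^ 3)) * phi1 y"
    using sums_unique[OF sums_mult[OF phi1_sums]] by simp
  thus ?thesis using Eul_swap[of "of_real (q ^ 3)" y] by simp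
qed

end

section \<open>The q-difference system and its Lagrange identities\<close>

lemma holomorphic_suminf:
  fixes f :: "nat \<Rightarrow> complex \<Rightarrow> complex"
  assumes S: "open S" and hol: "\<And>n. f n holomorphic_on S"
    and le: "\<And>n z. z \<in> S \<Longrightarrow> norm (f n z) \<le> M n" and M: "summable M"
  shows "(\<lambda>z. \<Sum>n. f n z) holomorphic_on S"
proof (rule holomorphic_uniform_sequence[OF S])
  show "(\<lambda>z. \<Sum>i<n. f i z) holomorphic_on S" for n
    by (intro holomorphic_intros hol)
  fix x assume "x \<in> S"
  then obtain d where d: "d > 0" "cball x d \<subseteq> S" using S open_contains_cball by blast
  have "uniform_limit (cball x d) (\<lambda>n z. \<Sum>i<n. f i z) (\<lambda>z. \<Sum>n. f n z) sequentially"
    by (rule Weierstrass_m_test[OF _ M]) (use d le in blast)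
  thus "\<exists>d. 0 < d \<and> cball x d \<subseteq> S \<and>
      uniform_limit (cball x d) (\<lambda>n z. \<Sum>i<n. f i z) (\<lambda>z. \<Sum>n. f n z) sequentially"
    using d by blast
qed

context gauss_series begin

lemma gser_cnj: "gser q D (cnj y) = cnj (gser q D y)"
proof -
  have "(\<lambda>n. cnj (of_real ((-1) ^ n * q ^ (n * (n - 1)) / D n) * y ^ n)) sums cnj (gser q D y)"
    using gser_sums by (rule sums_cnj[THEN iffD2])
  hence "(\<lambda>n. of_real ((-1) ^ n * q ^ (n * (n - 1)) / D n) * cnj y ^ n) sums cnj (gser q D y)"
    by (simp del: of_real_mult of_real_divide of_real_power of_real_minus)
  thus ?thesis using gser_sums sums_unique2 by blast
qed

lemma gser_neg_nonzero:
  assumes "0 \<le> x"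
  shows "gser q D (of_real (- x)) \<noteq> 0"
proof -
  define a where "a n = q ^ (n * (n - 1)) / D n * x ^ n" for n
  have "of_real ((-1) ^ n * q ^ (n * (n - 1)) / D n) * of_real (- x) ^ n = (of_real (a n) :: complex)" for n
  proof -
    have "(-1) ^ n * q ^ (n * (n - 1)) / D n * (- x) ^ n = a n"
    proof -
      have "(-1) ^ n * (- x) ^ n = x ^ n" by (simp flip: power_mult_distrib)
      thus ?thesis unfolding a_def by (simp add: mult_ac)
    qed
    thus ?thesis by (simp only: of_real_mult [symmetric] of_real_power [symmetric])
  qed
  hence s: "(\<lambda>n. of_real (a n) :: complex) sums gser q D (of_real (- x))"
    using gser_sums[of "of_real (- x)"] by simp
  hence "summable a" using sums_summable summable_of_real_iff by blast
  hence "of_real (suminf a) = gser q D (of_real (- x))"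
    using s by (metis sums_of_real sums_unique2 summable_sums)
  moreover have "suminf a > 0"
  proof (rule suminf_pos2[OF \<open>summable a\<close>, of 0])
    show "0 \<le> a n" for n unfolding a_def using q_pos D_pos[of n] assms by simp
    show "0 < a 0" unfolding a_def using D_pos[of 0] by simp
  qed
  ultimately show ?thesis by (metis less_irrefl of_real_eq_0_iff)
qed

end

context q_base begin

text \<open>The values of the basis functions of frequency \<open>l\<close> on the grid: the even one equals \<open>cs n l\<close> at
  both points \<open>\<plusminus> q ^ n\<close>, the odd one equals \<open>\<plusminus> sn (Suc n) l\<close> there. The shifted index absorbs the factor
  \<open>q\<close> in the argument of the \<open>q\<close>-sine, and it makes the boundary value \<open>sn 0 l = qsin q l\<close>
  part of the sequence.\<close>

definition cs :: "nat \<Rightarrow> complex \<Rightarrow> complex" where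
  "cs n l = qcos q (of_real (sqrt q) * l * of_real (q ^ n))"
definition sn :: "nat \<Rightarrow> complex \<Rightarrow> complex" where
  "sn n l = qsin q (l * of_real (q ^ n))"

abbreviation arg2 :: "complex \<Rightarrow> complex" where
  "arg2 l \<equiv> of_real (q * sqrt q) * l\<^sup>2"

lemma cs_eq: "cs n l = phi0 (of_real (p ^ n) * arg2 l)"
proof -
  have "of_real (sqrt q) * (of_real (sqrt q) * l * of_real (q ^ n))\<^sup>2
      = of_real (sqrt q * (sqrt q)\<^sup>2 * (q ^ n)\<^sup>2) * l\<^sup>2"
    by (simp add: power_mult_distrib)
  also have "sqrt q * (sqrt q)\<^sup>2 * (q ^ n)\<^sup>2 = p ^ n * (q * sqrt q)"
    using q_pos by (simp add: mult_ac) (simp add: power_mult [symmetric] mult.commute)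
  finally have arg: "of_real (sqrt q) * (of_real (sqrt q) * l * of_real (q ^ n))\<^sup>2
      = of_real (p ^ n * (q * sqrt q)) * l\<^sup>2" .
  show ?thesis unfolding cs_def qcos_eq arg by (simp only: of_real_mult mult.assoc)
qed

lemma sn_eq: "sn n l = l * of_real (q ^ n) * phi1 (of_real (p ^ n) * arg2 l)"
proof -
  have "(q ^ n)\<^sup>2 = p ^ n" by (simp add: power_mult [symmetric] mult.commute)
  hence "(of_real (q ^ n))\<^sup>2 = (of_real (p ^ n) :: complex)" by (metis of_real_power)
  thus ?thesis unfolding sn_def qsin_eq by (simp add: power_mult_distrib mult_ac)
qed

lemma sn_diff: "sn n l - sn (Suc n) l = l * of_real (q ^ n) * cs n l"
  unfolding sn_eq cs_eq phi1_rec[of "of_real (p ^ n) * arg2 l", symmetric]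
  by (simp add: algebra_simps)

lemma cs_diff: "cs n l - cs (Suc n) l = - of_real (sqrt q * q ^ n) * l * sn (Suc n) l"
proof -
  have "cs n l - cs (Suc n) l = - (of_real (p ^ n) * arg2 l) * phi1 (of_real (p ^ Suc n) * arg2 l)"
    unfolding cs_eq using phi0_rec[of "of_real (p ^ n) * arg2 l"] by (simp add: mult_ac)
  also have "of_real (p ^ n) * arg2 l = of_real (sqrt q * q ^ n) * l * (l * of_real (q ^ Suc n))"
  proof -
    have "p ^ n * (q * sqrt q) = sqrt q * q ^ n * q ^ Suc n"
      by (simp add: power2_eq_square power_mult_distrib mult_ac)
    hence "of_real (p ^ n) * of_real (q * sqrt q) = (of_real (sqrt q * q ^ n) * of_real (q ^ Suc n) :: complex)"
      by (metis of_real_mult)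
    thus ?thesis by (simp only: power2_eq_square mult_ac)
  qed
  finally show ?thesis unfolding sn_eq by (simp only: mult_ac mult_minus_left mult_minus_right)
qed

lemma cs_tendsto: "(\<lambda>n. cs n l) \<longlonglongrightarrow> 1"
proof -
  have "(\<lambda>n. of_real (p ^ n) * arg2 l) \<longlonglongrightarrow> of_real 0 * arg2 l"
    by (intro tendsto_intros p_power_tendsto)
  hence "(\<lambda>n. phi0 (of_real (p ^ n) * arg2 l)) \<longlonglongrightarrow> phi0 0"
    using isCont_tendsto_compose[OF phi0.continuous_gser] by (simp add: phi0_def)
  thus ?thesis using phi0.gser_0 by (simp add: phi0_def cs_eq)
qed

lemma sn_tendsto: "(\<lambda>n. sn n l) \<longlonglongrightarrow> 0"
proof -
  have "(\<lambda>n. of_real (p ^ n) * arg2 l) \<longlonglongrightarrow> of_real 0 * arg2 l"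
    by (intro tendsto_intros p_power_tendsto)
  hence "(\<lambda>n. phi1 (of_real (p ^ n) * arg2 l)) \<longlonglongrightarrow> phi1 0"
    using isCont_tendsto_compose[OF phi1.continuous_gser] by (simp add: phi1_def)
  moreover have "(\<lambda>n. q ^ n) \<longlonglongrightarrow> 0" by (intro LIMSEQ_realpow_zero less_imp_le q_pos q_less_1)
  ultimately have "(\<lambda>n. l * of_real (q ^ n) * phi1 (of_real (p ^ n) * arg2 l)) \<longlonglongrightarrow> l * of_real 0 * phi1 0"
    by (intro tendsto_mult tendsto_const tendsto_of_real)
  thus ?thesis by (simp add: sn_eq)
qed

lemma sn_0: "sn 0 l = qsin q l" by (simp add: sn_def)

text \<open>The sequence \<open>cs\<close>, \<open>sn\<close> solves a first-order difference system, a discrete Sturm-Liouville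
  problem with spectral parameter \<open>l\<^sup>2\<close>. In the difference of two consecutive values of the
  Wronskian-like quantity \<open>W\<close> the products of two \<open>sn\<close> are symmetric in \<open>l\<close> and \<open>v\<close> and cancel;
  summing telescopes to the boundary term at \<open>n = 0\<close>.\<close>

lemma lagrange_cos:
  "(\<lambda>n. (l\<^sup>2 - v\<^sup>2) * (of_real (q ^ n) * cs n l * cs n v)) sums
     (l * qsin q l * cs 0 v - v * qsin q v * cs 0 l)"
proof -
  define W where "W n = l * sn n l * cs n v - v * sn n v * cs n l" for n
  have "W \<longlonglongrightarrow> l * 0 * 1 - v * 0 * 1"
    unfolding W_def by (intro tendsto_intros sn_tendsto cs_tendsto)
  hence "(\<lambda>n. W n - W (Suc n)) sums (W 0)" using telescope_sums' by fastforce
  moreover have "W n - W (Suc n) = (l\<^sup>2 - v\<^sup>2) * (of_real (q ^ n) * cs n l * cs n v)" for n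
  proof -
    have *: "cs (Suc n) x = cs n x + of_real (sqrt q * q ^ n) * x * sn (Suc n) x"
         "sn n x = sn (Suc n) x + x * of_real (q ^ n) * cs n x" for x
      using cs_diff[of n x] sn_diff[of n x] by (simp_all add: algebra_simps)
    show ?thesis unfolding W_def *
      by (simp add: algebra_simps power2_eq_square del: of_real_mult of_real_power)
  qed
  ultimately show ?thesis by (simp add: W_def sn_0)
qed

text \<open>With the outer factors \<open>l\<close> and \<open>v\<close> exchanged, the products of two \<open>cs\<close> cancel instead.\<close>

lemma lagrange_sin:
  "(\<lambda>n. (l\<^sup>2 - v\<^sup>2) * of_real (sqrt q) * (of_real (q ^ n) * sn (Suc n) l * sn (Suc n) v)) sums
     (v * qsin q l * cs 0 v - l * qsin q v * cs 0 l)"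
proof -
  define W where "W n = v * sn n l * cs n v - l * sn n v * cs n l" for n
  have "W \<longlonglongrightarrow> v * 0 * 1 - l * 0 * 1"
    unfolding W_def by (intro tendsto_intros sn_tendsto cs_tendsto)
  hence "(\<lambda>n. W n - W (Suc n)) sums (W 0)" using telescope_sums' by fastforce
  moreover have "W n - W (Suc n) = (l\<^sup>2 - v\<^sup>2) * of_real (sqrt q) * (of_real (q ^ n) * sn (Suc n) l * sn (Suc n) v)" for n
  proof -
    have *: "cs n x = cs (Suc n) x - of_real (sqrt q * q ^ n) * x * sn (Suc n) x"
         for x
      using cs_diff[of n x] by (simp_all add: algebra_simps)
    have **: "sn n x = sn (Suc n) x + x * of_real (q ^ n) * cs n x" for x
      using sn_diff[of n x] by (simp_all add: algebra_simps)
    show ?thesis unfolding W_def ** unfolding *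
      by (simp add: algebra_simps power2_eq_square del: of_real_power)
  qed
  ultimately show ?thesis by (simp add: W_def sn_0)
qed

section \<open>Growth bounds and entire transforms\<close>

definition Kq :: real where "Kq = 2 / (dq * (1 - q))"

lemma Kq_pos: "Kq > 0"
  unfolding Kq_def using dq q_less_1 by simp

lemma norm_phi_le:
  assumes "norm y \<le> q powr (- R)"
  shows "norm (phi0 y) \<le> Kq * q powr (- ((R + 1)\<^sup>2 / 4))"
    and "norm (phi1 y) \<le> Kq * q powr (- ((R + 1)\<^sup>2 / 4))"
  using phi0.norm_gser_le[OF assms] phi1.norm_gser_le[OF assms]
  by (simp_all add: phi0_def phi1_def Kq_def)

lemma norm_cs_le:
  assumes "norm (arg2 l) \<le> q powr (- R)"
  shows "norm (cs n l) \<le> Kq * q powr (- ((R + 1)\<^sup>2 / 4))"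
proof -
  have "norm (of_real (p ^ n) * arg2 l) \<le> 1 * norm (arg2 l)"
    unfolding norm_mult[of "of_real (p ^ n)"] using p_power_le_1[of n] p_pos
    by (intro mult_right_mono) (auto simp: norm_power)
  thus ?thesis unfolding cs_eq using assms by (intro norm_phi_le) auto
qed

lemma norm_sn_Suc_le:
  assumes "norm (arg2 l) \<le> q powr (- R)"
  shows "norm (sn (Suc n) l) \<le> Kq * (norm l * q powr (- ((R - 1)\<^sup>2 / 4)))"
proof -
  have "norm (of_real (p ^ Suc n) * arg2 l) = p ^ n * (p * norm (arg2 l))"
    using p_pos by (simp add: norm_mult norm_power mult_ac)
  also have "\<dots> \<le> 1 * (p * norm (arg2 l))"
    using p_power_le_1[of n] p_pos by (intro mult_right_mono) auto
  also have "\<dots> \<le> p * q powr (- R)" using assms p_pos by simp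
  also have "\<dots> = q powr (- (R - 2))"
    using q_pos by (simp add: powr_add [symmetric] powr_numeral [symmetric] del: powr_numeral)
  finally have "norm (phi1 (of_real (p ^ Suc n) * arg2 l)) \<le> Kq * q powr (- ((R - 2 + 1)\<^sup>2 / 4))"
    by (rule norm_phi_le)
  hence 1: "norm (phi1 (of_real (p ^ Suc n) * arg2 l)) \<le> Kq * q powr (- ((R - 1)\<^sup>2 / 4))"
    by (simp add: algebra_simps)
  have 2: "norm (l * of_real (q ^ Suc n)) \<le> norm l * 1"
    unfolding norm_mult using q_pos q_less_1 power_le_one[of q "Suc n"]
    by (intro mult_left_mono) (auto simp: norm_power norm_mult)
  have "norm (sn (Suc n) l) = norm (l * of_real (q ^ Suc n)) * norm (phi1 (of_real (p ^ Suc n) * arg2 l))"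
    unfolding sn_eq norm_mult[of "l * of_real (q ^ Suc n)"] ..
  also have "\<dots> \<le> (norm l * 1) * (Kq * q powr (- ((R - 1)\<^sup>2 / 4)))"
    using 1 2 by (intro mult_mono) auto
  finally show ?thesis by (simp add: mult_ac)
qed

lemma holomorphic_phi [holomorphic_intros]:
  "f holomorphic_on A \<Longrightarrow> (\<lambda>z. phi0 (f z)) holomorphic_on A"
  "f holomorphic_on A \<Longrightarrow> (\<lambda>z. phi1 (f z)) holomorphic_on A"
  using holomorphic_on_compose[OF _ phi0.holomorphic_gser, of f A]
        holomorphic_on_compose[OF _ phi1.holomorphic_gser, of f A]
  by (simp_all add: o_def phi0_def phi1_def)

lemma holomorphic_cs [holomorphic_intros]: "cs n holomorphic_on A"
  unfolding cs_eq[abs_def] by (intro holomorphic_intros)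

lemma holomorphic_sn [holomorphic_intros]: "sn n holomorphic_on A"
  unfolding sn_eq[abs_def] by (intro holomorphic_intros)

lemma holomorphic_qcos [holomorphic_intros]:
  "f holomorphic_on A \<Longrightarrow> (\<lambda>z. qcos q (f z)) holomorphic_on A"
  unfolding qcos_eq by (intro holomorphic_intros)

lemma holomorphic_qsin [holomorphic_intros]:
  "f holomorphic_on A \<Longrightarrow> (\<lambda>z. qsin q (f z)) holomorphic_on A"
  unfolding qsin_eq by (intro holomorphic_intros)

text \<open>Up to the factor \<open>1 - q\<close>, these are the \<open>q\<close>-integrals over \<open>[-1, 1]\<close> that define the Fourier
  coefficients, with the frequency as a complex variable. The sequence \<open>e\<close> stands for the
  sum, respectively the difference, of the values of the integrated function at \<open>\<plusminus> q ^ n\<close>.\<close>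

definition cos_tf :: "(nat \<Rightarrow> complex) \<Rightarrow> complex \<Rightarrow> complex" where
  "cos_tf e l = (\<Sum>n. of_real (q ^ n) * e n * cs n l)"
definition sin_tf :: "(nat \<Rightarrow> complex) \<Rightarrow> complex \<Rightarrow> complex" where
  "sin_tf e l = (\<Sum>n. of_real (q ^ n) * e n * sn (Suc n) l)"

lemma weighted_geometric:
  assumes B: "\<And>n. norm (e n) \<le> B" and C: "\<And>n. norm (h n :: complex) \<le> C"
  shows "norm (of_real (q ^ n) * e n * h n) \<le> B * C * q ^ n"
    and "summable (\<lambda>n. of_real (q ^ n) * e n * h n)"
    and "norm (\<Sum>n. of_real (q ^ n) * e n * h n) \<le> B * C / (1 - q)"
proof -
  have B0: "0 \<le> B" using B[of 0] norm_ge_zero order_trans by blast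
  have "norm (of_real (q ^ n) * e n * h n) = norm (e n) * norm (h n) * q ^ n" for n
    using q_pos by (simp add: norm_mult norm_power)
  also have "\<dots> n \<le> B * C * q ^ n" for n
    using q_pos B C B0 by (intro mult_right_mono mult_mono) auto
  finally show 1: "norm (of_real (q ^ n) * e n * h n) \<le> B * C * q ^ n" for n .
  have 2: "summable (\<lambda>n. B * C * q ^ n)"
    using q_pos q_less_1 by (intro summable_mult summable_geometric) auto
  have 3: "summable (\<lambda>n. norm (of_real (q ^ n) * e n * h n))"
    using 1 by (intro summable_comparison_test'[OF 2, of 0]) simp
  show "summable (\<lambda>n. of_real (q ^ n) * e n * h n)"
    by (rule summable_norm_cancel[OF 3])
  have "norm (\<Sum>n. of_real (q ^ n) * e n * h n) \<le> (\<Sum>n. norm (of_real (q ^ n) * e n * h n))"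
    by (rule summable_norm[OF 3])
  also have "\<dots> \<le> (\<Sum>n. B * C * q ^ n)" by (intro suminf_le 1 2 3)
  also have "\<dots> = B * C / (1 - q)"
    using q_pos q_less_1 by (subst suminf_mult) (auto simp: suminf_geometric)
  finally show "norm (\<Sum>n. of_real (q ^ n) * e n * h n) \<le> B * C / (1 - q)" .
qed

lemma arg2_le_powr:
  assumes "norm l \<le> r"
  shows "norm (arg2 l) \<le> q powr (- (- log q (max 1 (q * sqrt q * r\<^sup>2))))"
proof -
  have "norm (arg2 l) = q * sqrt q * (norm l)\<^sup>2" using q_pos by (simp add: norm_mult norm_power)
  also have "\<dots> \<le> q * sqrt q * r\<^sup>2" using q_pos assms by (intro mult_left_mono power_mono) auto
  also have "\<dots> \<le> max 1 (q * sqrt q * r\<^sup>2)" by simp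
  finally show ?thesis using q_pos q_less_1 by simp
qed

lemma holomorphic_on_UNIV_if_balls:
  assumes "\<And>r. r > 0 \<Longrightarrow> f holomorphic_on ball (0::complex) r"
  shows "f holomorphic_on A"
proof (rule holomorphic_on_subset)
  show "f holomorphic_on (\<Union>r\<in>{0<..}. ball 0 r)"
    by (rule holomorphic_on_UN_open) (use assms in auto)
  show "A \<subseteq> (\<Union>r\<in>{0<..}. ball (0::complex) r)"
  proof
    fix x :: complex
    have "x \<in> ball 0 (norm x + 1)" "norm x + 1 > 0" by (auto simp: add_nonneg_pos)
    thus "x \<in> (\<Union>r\<in>{0<..}. ball (0::complex) r)" by blast
  qed
qed

lemma holomorphic_cos_tf:
  assumes B: "\<And>n. norm (e n) \<le> B"
  shows "cos_tf e holomorphic_on A"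
proof (rule holomorphic_on_UNIV_if_balls)
  fix r :: real assume "r > 0"
  define C where "C = Kq * q powr (- ((- log q (max 1 (q * sqrt q * r\<^sup>2)) + 1)\<^sup>2 / 4))"
  have C: "norm (cs n l) \<le> C" if "l \<in> ball 0 r" for n l
    unfolding C_def using that by (intro norm_cs_le arg2_le_powr) auto
  show "cos_tf e holomorphic_on ball 0 r"
    unfolding cos_tf_def[abs_def]
  proof (rule holomorphic_suminf)
    show "norm (of_real (q ^ n) * e n * cs n l) \<le> B * C * q ^ n" if "l \<in> ball 0 r" for n l
      using C[OF that] B by (intro weighted_geometric)
    show "summable (\<lambda>n. B * C * q ^ n)"
      using q_pos q_less_1 by (intro summable_mult summable_geometric) auto
  qed (auto intro!: holomorphic_intros)
qed

lemma holomorphic_sin_tf: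
  assumes B: "\<And>n. norm (e n) \<le> B"
  shows "sin_tf e holomorphic_on A"
proof (rule holomorphic_on_UNIV_if_balls)
  fix r :: real assume "r > 0"
  define C where "C = Kq * (r * q powr (- ((- log q (max 1 (q * sqrt q * r\<^sup>2)) - 1)\<^sup>2 / 4)))"
  have C: "norm (sn (Suc n) l) \<le> C" if "l \<in> ball 0 r" for n l
  proof -
    have "norm (sn (Suc n) l) \<le> Kq * (norm l * q powr (- ((- log q (max 1 (q * sqrt q * r\<^sup>2)) - 1)\<^sup>2 / 4)))"
      using that by (intro norm_sn_Suc_le arg2_le_powr) auto
    also have "\<dots> \<le> C" unfolding C_def using that Kq_pos
      by (intro mult_left_mono mult_right_mono) auto
    finally show ?thesis .
  qed
  show "sin_tf e holomorphic_on ball 0 r"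
    unfolding sin_tf_def[abs_def]
  proof (rule holomorphic_suminf)
    show "norm (of_real (q ^ n) * e n * sn (Suc n) l) \<le> B * C * q ^ n" if "l \<in> ball 0 r" for n l
      using C[OF that] B by (intro weighted_geometric)
    show "summable (\<lambda>n. B * C * q ^ n)"
      using q_pos q_less_1 by (intro summable_mult summable_geometric) auto
  qed (auto intro!: holomorphic_intros)
qed

lemma bounded_cs: "\<exists>B. \<forall>n. norm (cs n l) \<le> B"
  using convergent_imp_Bseq[OF convergentI[OF cs_tendsto[of l]]] by (auto simp: Bseq_def)

lemma bounded_sn: "\<exists>B. \<forall>n. norm (sn (Suc n) l) \<le> B"
  using convergent_imp_Bseq[OF convergentI[OF LIMSEQ_Suc[OF sn_tendsto[of l]]]] by (auto simp: Bseq_def)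

lemma cos_tf_sums:
  assumes "\<And>n. norm (e n) \<le> B"
  shows "(\<lambda>n. of_real (q ^ n) * e n * cs n l) sums cos_tf e l"
proof -
  obtain C where "\<And>n. norm (cs n l) \<le> C" using bounded_cs by blast
  thus ?thesis unfolding cos_tf_def using assms by (intro summable_sums weighted_geometric(2))
qed

lemma sin_tf_sums:
  assumes "\<And>n. norm (e n) \<le> B"
  shows "(\<lambda>n. of_real (q ^ n) * e n * sn (Suc n) l) sums sin_tf e l"
proof -
  obtain C where "\<And>n. norm (sn (Suc n) l) \<le> C" using bounded_sn by blast
  thus ?thesis unfolding sin_tf_def using assms by (intro summable_sums weighted_geometric(2))
qed

lemma lagrange_cos_tf:
  "(l\<^sup>2 - v\<^sup>2) * cos_tf (\<lambda>n. cs n l) v = l * qsin q l * cs 0 v - v * qsin q v * cs 0 l"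
proof -
  obtain B where "\<And>n. norm (cs n l) \<le> B" using bounded_cs by blast
  from sums_mult[OF cos_tf_sums[of "\<lambda>n. cs n l" B v, OF this], of "l\<^sup>2 - v\<^sup>2"] lagrange_cos[of l v]
  show ?thesis by (rule sums_unique2)
qed

lemma lagrange_sin_tf:
  "(l\<^sup>2 - v\<^sup>2) * (of_real (sqrt q) * sin_tf (\<lambda>n. sn (Suc n) l) v) =
     v * qsin q l * cs 0 v - l * qsin q v * cs 0 l"
proof -
  obtain B where "\<And>n. norm (sn (Suc n) l) \<le> B" using bounded_sn by blast
  from sums_mult[OF sin_tf_sums[of "\<lambda>n. sn (Suc n) l" B v, OF this], of "(l\<^sup>2 - v\<^sup>2) * of_real (sqrt q)"] lagrange_sin[of l v]
  have "(l\<^sup>2 - v\<^sup>2) * of_real (sqrt q) * sin_tf (\<lambda>n. sn (Suc n) l) v =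
     v * qsin q l * cs 0 v - l * qsin q v * cs 0 l" by (rule sums_unique2)
  thus ?thesis by (simp only: mult.assoc)
qed

section \<open>Zeros of the q-sine are real and simple\<close>

lemma cs_cnj: "cs n (cnj l) = cnj (cs n l)"
proof -
  have "cnj (of_real (p ^ n) * arg2 l) = of_real (p ^ n) * arg2 (cnj l)" by simp
  thus ?thesis
    using phi0.gser_cnj[of "of_real (p ^ n) * arg2 l"] by (simp only: cs_eq phi0_def)
qed

lemma qsin_cnj: "qsin q (cnj l) = cnj (qsin q l)"
proof -
  have "cnj (arg2 l) = arg2 (cnj l)" by simp
  thus ?thesis
    using phi1.gser_cnj[of "arg2 l"] by (simp only: qsin_eq phi1_def complex_cnj_mult)
qed

lemma cs_square_sums:
  assumes "l \<in> \<real>"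
  shows "(\<lambda>n. q ^ n * (norm (cs n l))\<^sup>2) sums Re (cos_tf (\<lambda>n. cs n l) l)"
proof -
  obtain B where "\<And>n. norm (cs n l) \<le> B" using bounded_cs by blast
  note s = cos_tf_sums[of "\<lambda>n. cs n l" B l, OF this]
  have "cs n l = cnj (cs n l)" for n using assms cs_cnj[of n l] by (simp add: Reals_cnj_iff)
  hence eq: "of_real (q ^ n) * cs n l * cs n l = of_real (q ^ n * (norm (cs n l))\<^sup>2)" for n
    using complex_norm_square[of "cs n l"] by (simp add: mult.assoc)
  have s': "(\<lambda>n. of_real (q ^ n * (norm (cs n l))\<^sup>2)) sums cos_tf (\<lambda>n. cs n l) l"
    using s by (simp only: eq)
  show ?thesis
    using sums_Re[OF s'] by (simp del: of_real_mult of_real_power)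
qed

lemma cos_tf_ge:
  assumes "l \<in> \<real>"
  shows "q ^ n * (norm (cs n l))\<^sup>2 \<le> norm (cos_tf (\<lambda>n. cs n l) l)"
proof -
  note s = cs_square_sums[OF assms]
  have "(\<Sum>i\<in>{n}. q ^ i * (norm (cs i l))\<^sup>2) \<le> (\<Sum>n. q ^ n * (norm (cs n l))\<^sup>2)"
    using q_pos by (intro sum_le_suminf sums_summable[OF s]) auto
  also have "\<dots> = Re (cos_tf (\<lambda>n. cs n l) l)" using s by (simp add: sums_iff)
  also have "\<dots> \<le> norm (cos_tf (\<lambda>n. cs n l) l)" by (rule complex_Re_le_cmod)
  finally show ?thesis by simp
qed

lemma cos_tf_nonzero:
  assumes "l \<in> \<real>"
  shows "cos_tf (\<lambda>n. cs n l) l \<noteq> 0"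
proof -
  have "eventually (\<lambda>n. cs n l \<noteq> 0) sequentially"
    using tendsto_imp_eventually_ne[OF cs_tendsto, of 0] by simp
  then obtain n where "cs n l \<noteq> 0" by (auto simp: eventually_sequentially)
  hence "q ^ n * (norm (cs n l))\<^sup>2 > 0" using q_pos by simp
  thus ?thesis using cos_tf_ge[OF assms, of n] by auto
qed

text \<open>Symmetry of the \<open>q\<close>-difference operator: for a zero \<open>l\<close> the Lagrange identity at \<open>l\<close> and its
  conjugate forces \<open>l\<^sup>2\<close> to be real, and for negative \<open>l\<^sup>2\<close> the series has positive terms.\<close>

lemma qsin_zero_real:
  assumes z: "qsin q l = 0"
  shows "l \<in> \<real>"
proof -
  have z': "qsin q (cnj l) = 0" by (simp add: qsin_cnj z)
  have sq: "l\<^sup>2 = (cnj l)\<^sup>2"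
  proof (rule ccontr)
    assume ne: "l\<^sup>2 \<noteq> (cnj l)\<^sup>2"
    have "(\<lambda>n. (l\<^sup>2 - (cnj l)\<^sup>2) * (of_real (q ^ n) * cs n l * cs n (cnj l))) sums 0"
      using lagrange_cos[of l "cnj l"] by (simp only: z z') simp
    hence "(\<lambda>n. of_real (q ^ n) * cs n l * cs n (cnj l)) sums (0 / (l\<^sup>2 - (cnj l)\<^sup>2))"
      by (rule sums_mult_D) (use ne in simp)
    moreover have eq: "of_real (q ^ n) * cs n l * cs n (cnj l) = of_real (q ^ n * (norm (cs n l))\<^sup>2)" for n
      unfolding cs_cnj using complex_norm_square[of "cs n l"] by (simp add: mult.assoc)
    ultimately have "(\<lambda>n. of_real (q ^ n * (norm (cs n l))\<^sup>2) :: complex) sums of_real 0"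
      by (simp only: eq div_0 of_real_0)
    hence "(\<lambda>n. q ^ n * (norm (cs n l))\<^sup>2) sums 0"
      by (simp only: sums_of_real_iff)
    hence "\<forall>n. q ^ n * (norm (cs n l))\<^sup>2 = 0"
      using q_pos suminf_eq_zero_iff[of "\<lambda>n. q ^ n * (norm (cs n l))\<^sup>2"] by (simp add: sums_iff)
    hence "\<And>n. cs n l = 0" using q_pos by simp
    thus False using cs_tendsto[of l] LIMSEQ_unique[OF tendsto_const, of "0::complex" 1] by simp
  qed
  hence "(l - cnj l) * (l + cnj l) = 0" by (simp add: algebra_simps power2_eq_square)
  then consider "l = cnj l" | "Re l = 0"
    by (auto simp: complex_eq_iff)
  thus ?thesis
  proof cases
    case 1 thus ?thesis by (simp add: Reals_cnj_iff)
  next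
    case 2
    have "l\<^sup>2 = of_real (- (Im l)\<^sup>2)" using 2 by (simp add: complex_eq_iff power2_eq_square)
    hence "arg2 l = of_real (- (q * sqrt q * (Im l)\<^sup>2))" by simp
    moreover have "phi1 (of_real (- (q * sqrt q * (Im l)\<^sup>2))) \<noteq> 0"
      unfolding phi1_def using q_pos by (intro phi1.gser_neg_nonzero) auto
    ultimately have "l = 0" using z unfolding qsin_eq by simp
    thus ?thesis by simp
  qed
qed

lemma has_derivative_unique_zero_fun:
  assumes "\<And>v. F v = (0::complex)" "(F has_field_derivative D) (at l)"
  shows "D = 0"
proof -
  have "F = (\<lambda>_. 0)" using assms(1) by auto
  thus ?thesis using assms(2) DERIV_unique DERIV_const by blast
qed

lemma qsin_deriv: "(qsin q has_field_derivative deriv (qsin q) l) (at l)"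
  using holomorphic_qsin[of "\<lambda>z. z" UNIV] by (auto intro!: holomorphic_derivI[of _ UNIV])

text \<open>Both identities arise by differentiating a Lagrange identity with respect to \<open>v\<close> at \<open>v = l\<close>. They
  evaluate the squared norms of the basis functions, and so explain the normalising factor \<open>qmu\<close>.
  Since the first norm is positive, they also show that the zero \<open>l\<close> is simple.\<close>

lemma qsin_zero_norm:
  assumes z: "qsin q l = 0" and "l \<noteq> 0"
  shows "2 * cos_tf (\<lambda>n. cs n l) l = deriv (qsin q) l * cs 0 l"
    and "2 * (of_real (sqrt q) * sin_tf (\<lambda>n. sn (Suc n) l) l) = deriv (qsin q) l * cs 0 l"
proof -
  obtain B where B: "\<And>n. norm (cs n l) \<le> B" using bounded_cs by blast
  obtain C where C: "\<And>n. norm (sn (Suc n) l) \<le> C" using bounded_sn by blast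
  define T where "T = cos_tf (\<lambda>n. cs n l)"
  define U where "U = sin_tf (\<lambda>n. sn (Suc n) l)"
  have dT: "(T has_field_derivative deriv T l) (at l)"
    unfolding T_def by (rule holomorphic_derivI[OF holomorphic_cos_tf[of "\<lambda>n. cs n l" B UNIV, OF B] open_UNIV]) auto
  have dU: "(U has_field_derivative deriv U l) (at l)"
    unfolding U_def by (rule holomorphic_derivI[OF holomorphic_sin_tf[of "\<lambda>n. sn (Suc n) l" C UNIV, OF C] open_UNIV]) auto
  have "((\<lambda>v. (l\<^sup>2 - v\<^sup>2) * T v + v * qsin q v * cs 0 l) has_field_derivative
      - 2 * l * T l + l * deriv (qsin q) l * cs 0 l) (at l)"
    by (rule derivative_eq_intros dT qsin_deriv refl)+ (simp add: z algebra_simps)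
  hence "- 2 * l * T l + l * deriv (qsin q) l * cs 0 l = 0"
    by (rule has_derivative_unique_zero_fun[rotated]) (simp add: T_def lagrange_cos_tf z)
  thus "2 * cos_tf (\<lambda>n. cs n l) l = deriv (qsin q) l * cs 0 l"
    using \<open>l \<noteq> 0\<close> unfolding T_def [symmetric] by (simp add: mult.assoc)
  have "((\<lambda>v. (l\<^sup>2 - v\<^sup>2) * (of_real (sqrt q) * U v) + l * qsin q v * cs 0 l) has_field_derivative
      - 2 * l * (of_real (sqrt q) * U l) + l * deriv (qsin q) l * cs 0 l) (at l)"
    by (rule derivative_eq_intros dU qsin_deriv refl)+ (simp add: z algebra_simps)
  hence "- 2 * l * (of_real (sqrt q) * U l) + l * deriv (qsin q) l * cs 0 l = 0"
    by (rule has_derivative_unique_zero_fun[rotated]) (simp add: U_def lagrange_sin_tf z)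
  thus "2 * (of_real (sqrt q) * sin_tf (\<lambda>n. sn (Suc n) l) l) = deriv (qsin q) l * cs 0 l"
    using \<open>l \<noteq> 0\<close> unfolding U_def [symmetric] by (simp add: mult.assoc)
qed

lemma qsin_deriv_0: "deriv (qsin q) 0 = phi1 0"
proof -
  have "((\<lambda>z. z * phi1 (arg2 z)) has_field_derivative deriv (\<lambda>z. z * phi1 (arg2 z)) 0) (at 0)"
    by (intro holomorphic_derivI[of _ UNIV] holomorphic_intros) auto
  have d: "((\<lambda>z. phi1 (arg2 z)) has_field_derivative deriv (\<lambda>z. phi1 (arg2 z)) 0) (at 0)"
    by (intro holomorphic_derivI[of _ UNIV] holomorphic_intros) auto
  have "((\<lambda>z. z * phi1 (arg2 z)) has_field_derivative phi1 0) (at 0)"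
    by (rule derivative_eq_intros d refl)+ simp
  thus ?thesis unfolding qsin_eq[abs_def] by (rule DERIV_imp_deriv)
qed

lemma phi1_0: "phi1 0 = of_real (1 / (1 - q))"
  unfolding phi1_def phi1.gser_0 by (simp add: qpoch_def)

lemma qsin_zero_simple:
  assumes z: "qsin q l = 0"
  shows "deriv (qsin q) l \<noteq> 0"
proof (cases "l = 0")
  case True
  thus ?thesis using qsin_deriv_0 phi1_0 q_less_1
    by simp
next
  case False
  show ?thesis
    using qsin_zero_norm(1)[OF z False] cos_tf_nonzero[OF qsin_zero_real[OF z]] by auto
qed

text \<open>The zeros of \<open>phi1\<close> are the squares of the nonzero zeros of the \<open>q\<close>-sine, up to a factor. Counting in
  the variable of \<open>phi1\<close> has the advantage that the zeros \<open>\<plusminus> x\<close> merge.\<close>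

lemma phi1_zero_cases:
  assumes "phi1 y = 0"
  obtains x where "x > 0" "qsin q (of_real x) = 0" "y = arg2 (of_real x)"
proof -
  define l where "l = csqrt (y / of_real (q * sqrt q))"
  have y: "y = arg2 l" unfolding l_def using q_pos by simp
  have "y \<noteq> 0" using assms phi1_0 q_less_1 by auto
  hence "l \<noteq> 0" using y by auto
  have "qsin q l = 0" unfolding qsin_eq using assms y by simp
  hence "l \<in> \<real>" by (rule qsin_zero_real)
  then obtain t where t: "l = of_real t" by (elim Reals_cases)
  have "qsin q (of_real \<bar>t\<bar>) = 0"
    using \<open>qsin q l = 0\<close> unfolding t qsin_eq by (cases "t \<ge> 0") auto
  moreover have "y = arg2 (of_real \<bar>t\<bar>)" unfolding y t by (simp flip: of_real_power)
  ultimately show ?thesis using that[of "\<bar>t\<bar>"] \<open>l \<noteq> 0\<close> t by simp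
qed

lemma phi1_zero_simple:
  assumes "phi1 y = 0"
  shows "deriv phi1 y \<noteq> 0"
proof -
  obtain x where x: "x > 0" "qsin q (of_real x) = 0" "y = arg2 (of_real x)"
    by (rule phi1_zero_cases[OF assms])
  have d: "(phi1 has_field_derivative deriv phi1 y) (at (arg2 (of_real x)))"
    unfolding x(3) using holomorphic_phi(2)[of "\<lambda>z. z" UNIV]
    by (auto intro!: holomorphic_derivI[of _ UNIV])
  define l :: complex where "l = of_real x"
  have "((\<lambda>z. phi1 (arg2 z)) has_field_derivative deriv phi1 y * (of_real (q * sqrt q) * (2 * l))) (at l)"
    by (rule DERIV_chain2[where f = phi1 and g = arg2, OF d[folded l_def]]) (auto intro!: derivative_eq_intros)
  hence "((\<lambda>z. z * phi1 (arg2 z)) has_field_derivative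
      1 * phi1 (arg2 l) + deriv phi1 y * (of_real (q * sqrt q) * (2 * l)) * l) (at l)"
    by (rule DERIV_mult[OF DERIV_ident])
  hence "deriv (qsin q) l = 1 * phi1 (arg2 l) + deriv phi1 y * (of_real (q * sqrt q) * (2 * l)) * l"
    unfolding qsin_eq[abs_def] by (rule DERIV_imp_deriv)
  moreover have "phi1 (arg2 l) = 0" using assms x by (simp add: l_def)
  ultimately show ?thesis using qsin_zero_simple[OF x(2)] by (auto simp: l_def)
qed

section \<open>Comparison with the Euler product on circles\<close>

text \<open>For \<open>0 < \<epsilon> < 1\<close>, these radii avoid the zeros \<open>q powr (- 2 * j)\<close> of the Euler product by a fixed factor.\<close>

definition rho :: "real \<Rightarrow> nat \<Rightarrow> real" where
  "rho \<epsilon> m = q powr (- 2 * (real m + \<epsilon>))"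

lemma rho_pos: "rho \<epsilon> m > 0"
  using q_pos by (simp add: rho_def)

lemma p_powr: "p ^ j = q powr (2 * real j)"
  using powr_realpow[of q "2 * j"] q_pos by (simp add: p_power_eq)

text \<open>On the circle of radius \<open>rho \<epsilon> m\<close>, the modulus of \<open>p ^ j * y\<close> is \<open>q powr (2 * (j - m - \<epsilon>))\<close>, so that a
  factor of the product misses the maximum of \<open>1\<close> and this modulus by a relative error that decays
  geometrically as \<open>j\<close> moves away from \<open>m\<close> in either direction. The product of the corresponding ratios is at least
  a product of two \<open>q\<close>-shifted factorials, independently of \<open>m\<close>.\<close>

lemma prod_lower:
  assumes eps: "0 < \<epsilon>" "\<epsilon> < 1"
  shows "\<exists>P>0. \<forall>m l. \<forall>y::complex. norm y = rho \<epsilon> m \<longrightarrow>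
           P * (\<Prod>j<l. max 1 (p ^ j * rho \<epsilon> m)) \<le> norm (\<Prod>j<l. 1 - of_real (p ^ j) * y)"
proof -
  define e1 e2 where "e1 = q powr (2 * \<epsilon>)" and "e2 = q powr (2 * (1 - \<epsilon>))"
  have e: "0 < e1" "e1 < 1" "0 < e2" "e2 < 1"
    unfolding e1_def e2_def 
    using q_pos q_less_1 eps powr_less_mono'[of q 0 "2 * \<epsilon>"] powr_less_mono'[of q 0 "2 * (1 - \<epsilon>)"]
    by auto
  obtain d1 where d1: "d1 > 0" "\<And>n. d1 \<le> qpoch e1 p n"
    using qpoch_bounded_below[of e1 p] e p_pos p_less_1 by auto
  obtain d2 where d2: "d2 > 0" "\<And>n. d2 \<le> qpoch e2 p n"
    using qpoch_bounded_below[of e2 p] e p_pos p_less_1 by auto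
  have "d1 * d2 * (\<Prod>j<l. max 1 (p ^ j * rho \<epsilon> m)) \<le> norm (\<Prod>j<l. 1 - of_real (p ^ j) * y)"
    if y: "norm y = rho \<epsilon> m" for m l and y :: complex
  proof -
    define b where "b j = (if j \<le> m then 1 - e1 * p ^ (m - j) else 1 - e2 * p ^ (j - Suc m))" for j
    have ep: "x * p ^ i < 1" "0 < x * p ^ i" if "x < 1" "0 < x" for x i
    proof -
      have "x * p ^ i \<le> x * 1" using that by (intro mult_left_mono p_power_le_1) auto
      thus "x * p ^ i < 1" using that by linarith
      show "0 < x * p ^ i" using that p_pos by simp
    qed
    have b: "0 < b j" "b j \<le> 1" for j
      unfolding b_def using ep[OF e(2,1)] ep[OF e(4,3)] by (auto simp: less_imp_le)
    have factor: "b j * max 1 (p ^ j * rho \<epsilon> m) \<le> norm (1 - of_real (p ^ j) * y)" for j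
    proof -
      have n: "norm (of_real (p ^ j) * y) = p ^ j * rho \<epsilon> m"
        using p_pos y by (simp add: norm_mult norm_power)
      have pr: "p ^ j * rho \<epsilon> m = q powr (2 * (real j - real m - \<epsilon>))"
        unfolding p_powr rho_def powr_add [symmetric] by (simp add: algebra_simps)
      show ?thesis
      proof (cases "j \<le> m")
        case True
        have "e1 * p ^ (m - j) * (p ^ j * rho \<epsilon> m) = 1"
          unfolding e1_def p_powr rho_def powr_add [symmetric] using True q_pos
          by (simp add: algebra_simps of_nat_diff)
        moreover have "e1 * p ^ (m - j) * (p ^ j * rho \<epsilon> m) < 1 * (p ^ j * rho \<epsilon> m)"
          using ep[OF e(2,1), of "m - j"] rho_pos[of \<epsilon> m] p_pos
          by (intro mult_strict_right_mono) auto
        ultimately have "b j * max 1 (p ^ j * rho \<epsilon> m) = p ^ j * rho \<epsilon> m - 1"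
          using True by (simp add: b_def algebra_simps)
        also have "\<dots> \<le> norm (1 - of_real (p ^ j) * y)"
          using norm_triangle_ineq2[of "of_real (p ^ j) * y" 1] n by (simp add: norm_minus_commute)
        finally show ?thesis .
      next
        case False
        have eq: "p ^ j * rho \<epsilon> m = e2 * p ^ (j - Suc m)"
          unfolding e2_def p_powr rho_def powr_add [symmetric] using False
          by (simp add: algebra_simps of_nat_diff)
        have "b j * max 1 (p ^ j * rho \<epsilon> m) = 1 - p ^ j * rho \<epsilon> m"
          using False ep[OF e(4,3), of "j - Suc m"] unfolding eq by (simp add: b_def)
        also have "\<dots> \<le> norm (1 - of_real (p ^ j) * y)"
          using norm_triangle_ineq2[of 1 "of_real (p ^ j) * y"] n by simp
        finally show ?thesis .
      qed
    qed
    have low: "(\<Prod>j<Suc m. b j) = qpoch e1 p (Suc m)"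
    proof -
      have "(\<Prod>j<Suc m. b j) = (\<Prod>j<Suc m. 1 - e1 * p ^ (Suc m - Suc j))"
        by (intro prod.cong) (auto simp: b_def)
      also have "\<dots> = (\<Prod>j<Suc m. 1 - e1 * p ^ j)" by (rule prod.nat_diff_reindex)
      finally show ?thesis by (simp add: qpoch_def)
    qed
    have high: "(\<Prod>j<Suc m + i. b j) = qpoch e1 p (Suc m) * qpoch e2 p i" for i
    proof (induction i)
      case (Suc i)
      have "b (Suc m + i) = 1 - e2 * p ^ i" by (simp add: b_def)
      thus ?case using Suc by (simp add: qpoch_Suc)
    qed (use low in simp)
    have mono: "(\<Prod>j<l + i. b j) \<le> (\<Prod>j<l. b j)" for i
    proof (induction i)
      case (Suc i)
      have "(\<Prod>j<l + i. b j) * b (l + i) \<le> (\<Prod>j<l + i. b j) * 1"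
        using b by (intro mult_left_mono prod_nonneg) (auto simp: less_imp_le)
      thus ?case using Suc by simp
    qed simp
    have "d1 * d2 \<le> qpoch e1 p (Suc m) * qpoch e2 p l"
      using d1 d2 by (intro mult_mono) (auto intro: order_trans[OF less_imp_le])
    also have "\<dots> = (\<Prod>j<l + Suc m. b j)" using high[of l] by (simp add: add.commute)
    also have "\<dots> \<le> (\<Prod>j<l. b j)" by (rule mono)
    finally have "d1 * d2 \<le> (\<Prod>j<l. b j)" .
    hence "d1 * d2 * (\<Prod>j<l. max 1 (p ^ j * rho \<epsilon> m)) \<le> (\<Prod>j<l. b j) * (\<Prod>j<l. max 1 (p ^ j * rho \<epsilon> m))"
      by (intro mult_right_mono prod_nonneg) (auto simp: le_max_iff_disj)
    also have "\<dots> = (\<Prod>j<l. b j * max 1 (p ^ j * rho \<epsilon> m))" by (rule prod.distrib[symmetric])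
    also have "\<dots> \<le> (\<Prod>j<l. norm (1 - of_real (p ^ j) * y))"
      using factor b by (intro prod_mono) (auto simp: less_imp_le le_max_iff_disj)
    finally show ?thesis by (simp add: prod_norm)
  qed
  thus ?thesis using d1(1) d2(1) by (intro exI[of _ "d1 * d2"]) auto
qed

text \<open>In the expansion of \<open>phi1\<close>, the term with index \<open>0\<close> is \<open>Eul y\<close>. Every other term contains
  \<open>Eul (p ^ l * y)\<close>, which lacks at least the factor \<open>1 - y\<close> of \<open>Eul y\<close> and is therefore smaller by
  the order of \<open>rho \<epsilon> m\<close>.\<close>

lemma Eul_circle:
  assumes eps: "0 < \<epsilon>" "\<epsilon> < 1"
  shows "\<exists>C>0. \<forall>m. \<forall>y::complex. norm y = rho \<epsilon> m \<longrightarrow>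
           C * q powr (- ((real m + 1) * (real m + 2 * \<epsilon>))) \<le> norm (Eul y) \<and>
           norm (of_real (1 - q) * Eul (of_real (q ^ 3)) * phi1 y - Eul y) \<le> norm (Eul y) / (C * rho \<epsilon> m)"
proof -
  obtain P where P: "P > 0" and P_le: "\<And>m l (y::complex). norm y = rho \<epsilon> m \<Longrightarrow>
           P * (\<Prod>j<l. max 1 (p ^ j * rho \<epsilon> m)) \<le> norm (\<Prod>j<l. 1 - of_real (p ^ j) * y)"
    using prod_lower[OF eps] by blast
  define a :: "nat \<Rightarrow> complex" where
    "a l = of_real ((-1) ^ l * q ^ (l * (l - 1)) / qpoch p p l) * of_real (q ^ 3) ^ l" for l
  have a_sum: "summable (\<lambda>l. norm (a l))"
    unfolding a_def by (rule Eul.summable_norm_gser)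
  define A where "A = (\<Sum>l. norm (a (Suc l))) + 1"
  have a_sum': "summable (\<lambda>l. norm (a (Suc l)))" using a_sum by (subst summable_Suc_iff)
  have A: "A > 0" unfolding A_def using suminf_nonneg[OF a_sum'] by (simp add: add_nonneg_pos)
  define C where "C = min P (P / A)"
  have C: "C > 0" "C \<le> P" "C \<le> P / A" unfolding C_def using P A by auto
  have low: "C * q powr (- ((real m + 1) * (real m + 2 * \<epsilon>))) \<le> norm (Eul y)"
    if y: "norm y = rho \<epsilon> m" for m and y :: complex
  proof (rule tendsto_lowerbound)
    show "(\<lambda>n. norm (\<Prod>j<n. 1 - of_real (p ^ j) * y)) \<longlonglongrightarrow> norm (Eul y)"
      by (intro tendsto_norm Eul_limit)
    have "C * q powr (- ((real m + 1) * (real m + 2 * \<epsilon>))) \<le> norm (\<Prod>j<n. 1 - of_real (p ^ j) * y)"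
      if "n \<ge> Suc m" for n
    proof -
      have "(\<Prod>j<k. p ^ j * rho \<epsilon> m) = q powr (real k * (real k - 1) - 2 * real k * (real m + \<epsilon>))" for k
      proof (induction k)
        case (Suc k)
        have "p ^ k * rho \<epsilon> m = q powr (2 * real k - 2 * (real m + \<epsilon>))"
          unfolding p_powr rho_def powr_add [symmetric] by (simp add: algebra_simps)
        thus ?case using Suc by (simp add: powr_add [symmetric] algebra_simps)
      qed (use q_pos in simp)
      from this[of "Suc m"]
      have "q powr (- ((real m + 1) * (real m + 2 * \<epsilon>))) = (\<Prod>j<Suc m. p ^ j * rho \<epsilon> m)"
        by (simp only:) (simp add: algebra_simps)
      also have "\<dots> \<le> (\<Prod>j<Suc m. max 1 (p ^ j * rho \<epsilon> m))"
        using p_pos rho_pos[of \<epsilon> m] by (intro prod_mono) auto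
      also have "\<dots> \<le> (\<Prod>j<n. max 1 (p ^ j * rho \<epsilon> m))"
        using that by (intro prod_mono2) (auto simp: le_max_iff_disj)
      finally have "C * q powr (- ((real m + 1) * (real m + 2 * \<epsilon>))) \<le> P * (\<Prod>j<n. max 1 (p ^ j * rho \<epsilon> m))"
        using C P by (intro mult_mono) auto
      thus ?thesis using P_le[OF y, of n] by linarith
    qed
    thus "eventually (\<lambda>n. C * q powr (- ((real m + 1) * (real m + 2 * \<epsilon>))) \<le> norm (\<Prod>j<n. 1 - of_real (p ^ j) * y)) sequentially"
      by (auto simp: eventually_sequentially)
  qed simp
  have up: "norm (of_real (1 - q) * Eul (of_real (q ^ 3)) * phi1 y - Eul y) \<le> norm (Eul y) / (C * rho \<epsilon> m)"
    if y: "norm y = rho \<epsilon> m" for m and y :: complex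
  proof -
    define B where "B = norm (Eul y) / (P * rho \<epsilon> m)"
    have shifted: "norm (Eul (of_real (p ^ Suc l) * y)) \<le> B" for l
    proof -
      have "rho \<epsilon> m \<le> (\<Prod>j<1. max 1 (p ^ j * rho \<epsilon> m))" by simp
      also have "\<dots> \<le> (\<Prod>j<Suc l. max 1 (p ^ j * rho \<epsilon> m))"
        by (intro prod_mono2) (auto simp: le_max_iff_disj)
      finally have "P * rho \<epsilon> m \<le> P * (\<Prod>j<Suc l. max 1 (p ^ j * rho \<epsilon> m))"
        using P by (intro mult_left_mono) auto
      also have "\<dots> \<le> norm (\<Prod>j<Suc l. 1 - of_real (p ^ j) * y)" by (rule P_le[OF y])
      finally have "P * rho \<epsilon> m * norm (Eul (of_real (p ^ Suc l) * y))
          \<le> norm (\<Prod>j<Suc l. 1 - of_real (p ^ j) * y) * norm (Eul (of_real (p ^ Suc l) * y))"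
        by (intro mult_right_mono) auto
      also have "\<dots> = norm (Eul y)"
        unfolding norm_mult [symmetric] Eul_prod[of y "Suc l", symmetric] ..
      finally show ?thesis unfolding B_def using P rho_pos[of \<epsilon> m]
        by (simp add: pos_le_divide_eq mult_ac)
    qed
    have s: "(\<lambda>l. a l * Eul (of_real (p ^ l) * y)) sums (of_real (1 - q) * Eul (of_real (q ^ 3)) * phi1 y)"
      using phi1_expansion[of y] by (simp only: a_def)
    have s': "(\<lambda>l. a (Suc l) * Eul (of_real (p ^ Suc l) * y)) sums
        (of_real (1 - q) * Eul (of_real (q ^ 3)) * phi1 y - Eul y)"
      using s[THEN sums_split_initial_segment, of 1] by (simp add: a_def)
    have le: "norm (a (Suc l) * Eul (of_real (p ^ Suc l) * y)) \<le> norm (a (Suc l)) * B" for l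
      unfolding norm_mult using shifted by (intro mult_left_mono) auto
    have sB: "summable (\<lambda>l. norm (a (Suc l)) * B)" by (intro summable_mult2 a_sum')
    have "norm (of_real (1 - q) * Eul (of_real (q ^ 3)) * phi1 y - Eul y) \<le> (\<Sum>l. norm (a (Suc l)) * B)"
      unfolding sums_unique[OF s'] by (rule norm_suminf_le[OF le sB])
    also have "\<dots> = (A - 1) * B" unfolding A_def by (simp add: suminf_mult2[OF a_sum'])
    also have "\<dots> \<le> A * B" unfolding B_def using P rho_pos[of \<epsilon> m] by (intro mult_right_mono) auto
    also have "\<dots> = norm (Eul y) / (P / A * rho \<epsilon> m)" unfolding B_def by simp
    also have "\<dots> \<le> norm (Eul y) / (C * rho \<epsilon> m)"
      using C P A rho_pos[of \<epsilon> m] by (intro divide_left_mono mult_right_mono) auto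
    finally show ?thesis .
  qed
  show ?thesis using C(1) low up by blast
qed

lemma rho_at_top:
  assumes "0 < \<epsilon>"
  shows "filterlim (rho \<epsilon>) at_top sequentially"
proof -
  have "1 / p > 1" using p_pos p_less_1 by simp
  hence "filterlim (\<lambda>m. (1 / p) ^ m) at_infinity sequentially"
    by (intro filterlim_realpow_sequentially_gt1) auto
  hence L: "filterlim (\<lambda>m. (1 / p) ^ m) at_top sequentially"
    by (rule filterlim_at_infinity_imp_filterlim_at_top) (use p_pos in auto)
  have LE: "(1 / p) ^ m \<le> rho \<epsilon> m" for m
  proof -
    have "(1 / p) ^ m = q powr (- 2 * real m)"
      using q_pos by (simp only: power_one_over p_powr) (simp add: powr_minus_divide)
    also have "\<dots> \<le> rho \<epsilon> m"
      unfolding rho_def using q_pos q_less_1 assms by (intro powr_mono') auto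
    finally show ?thesis .
  qed
  show ?thesis
    by (rule filterlim_at_top_mono[OF L]) (use LE in auto)
qed

lemma phi1_Eul_close:
  assumes eps: "0 < \<epsilon>" "\<epsilon> < 1"
  shows "eventually (\<lambda>m. \<forall>y::complex. norm y = rho \<epsilon> m \<longrightarrow>
     norm (of_real (1 - q) * Eul (of_real (q ^ 3)) * phi1 y - Eul y) \<le> norm (Eul y) / 2 \<and> Eul y \<noteq> 0) sequentially"
proof -
  obtain C where C: "C > 0" and C_le: "\<And>m (y::complex). norm y = rho \<epsilon> m \<Longrightarrow>
     C * q powr (- ((real m + 1) * (real m + 2 * \<epsilon>))) \<le> norm (Eul y) \<and>
     norm (of_real (1 - q) * Eul (of_real (q ^ 3)) * phi1 y - Eul y) \<le> norm (Eul y) / (C * rho \<epsilon> m)"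
    using Eul_circle[OF eps] by blast
  have "eventually (\<lambda>m. rho \<epsilon> m \<ge> 2 / C) sequentially"
    using rho_at_top[OF eps(1)] by (simp add: filterlim_at_top)
  thus ?thesis
  proof eventually_elim
    case (elim m)
    hence ge: "2 \<le> C * rho \<epsilon> m" using C by (simp add: field_simps)
    show ?case
    proof (intro allI impI conjI)
      fix y :: complex assume y: "norm y = rho \<epsilon> m"
      have "norm (Eul y) / (C * rho \<epsilon> m) \<le> norm (Eul y) / 2"
        using ge by (intro divide_left_mono) auto
      thus "norm (of_real (1 - q) * Eul (of_real (q ^ 3)) * phi1 y - Eul y) \<le> norm (Eul y) / 2"
        using C_le[OF y] by linarith
      have "0 < C * q powr (- ((real m + 1) * (real m + 2 * \<epsilon>)))" using C q_pos by simp
      hence "0 < norm (Eul y)" using C_le[OF y] by linarith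
      thus "Eul y \<noteq> 0" by simp
    qed
  qed
qed

end

section \<open>Counting the zeros of the q-sine\<close>

lemma locally_finite_counting:
  fixes Z :: "real set"
  assumes pos: "\<And>x. x \<in> Z \<Longrightarrow> 0 < x" and fin: "\<And>x. finite {y \<in> Z. y \<le> x}" and inf: "infinite Z"
  shows "\<exists>x\<ge>0. (k > 0 \<longrightarrow> x \<in> Z) \<and> card {y \<in> Z. y \<le> x} = k"
proof (induction k)
  case 0
  have "{y \<in> Z. y \<le> 0} = {}" using pos by force
  hence "card {y \<in> Z. y \<le> 0} = 0" by (simp only: card.empty)
  thus ?case by blast
next
  case (Suc k)
  then obtain x where x: "x \<ge> 0" "card {y \<in> Z. y \<le> x} = k" by blast
  have "infinite (Z - {y \<in> Z. y \<le> x})" by (rule Diff_infinite_finite[OF fin inf])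
  hence "Z - {y \<in> Z. y \<le> x} \<noteq> {}" by (rule infinite_imp_nonempty)
  then obtain z where "z \<in> Z - {y \<in> Z. y \<le> x}" by blast
  hence z: "z \<in> Z" "z > x" by auto
  define A where "A = {y \<in> Z. x < y \<and> y \<le> z}"
  have A: "finite A" "z \<in> A" using fin[of z] z by (auto simp: A_def intro: finite_subset[OF _ fin[of z]])
  define w where "w = Min A"
  have w: "w \<in> A" "\<And>y. y \<in> A \<Longrightarrow> w \<le> y" unfolding w_def using A by (auto intro: Min_in)
  have "{y \<in> Z. y \<le> w} = insert w {y \<in> Z. y \<le> x}"
  proof (intro set_eqI iffI)
    fix y assume y: "y \<in> {y \<in> Z. y \<le> w}"
    show "y \<in> insert w {y \<in> Z. y \<le> x}"
    proof (cases "y \<le> x")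
      case False
      hence "y \<in> A" using y w(1) unfolding A_def by auto
      hence "w \<le> y" by (rule w(2))
      thus ?thesis using y by auto
    qed (use y in auto)
  qed (use w(1) in \<open>auto simp: A_def\<close>)
  moreover have "w \<notin> {y \<in> Z. y \<le> x}" using w(1) by (auto simp: A_def)
  ultimately have "card {y \<in> Z. y \<le> w} = Suc k" using x(2) fin[of x] by simp
  thus ?case using w(1) x(1) by (intro exI[of _ w]) (auto simp: A_def)
qed

lemma locally_finite_counting_less:
  fixes Z :: "real set"
  assumes fin: "\<And>x. finite {y \<in> Z. y \<le> x}" and "x < z" "z \<in> Z"
  shows "card {y \<in> Z. y \<le> x} < card {y \<in> Z. y \<le> z}"
proof (rule psubset_card_mono[OF fin])
  have "z \<in> {y \<in> Z. y \<le> z}" "z \<notin> {y \<in> Z. y \<le> x}" using assms(2,3) by auto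
  moreover have "{y \<in> Z. y \<le> x} \<subseteq> {y \<in> Z. y \<le> z}" using assms(2) by auto
  ultimately show "{y \<in> Z. y \<le> x} \<subset> {y \<in> Z. y \<le> z}" by blast
qed

context q_base begin

lemma phi1_holo: "phi1 holomorphic_on A"
  using holomorphic_phi(2)[of "\<lambda>z. z" A] by simp

lemma Eul_holo: "Eul holomorphic_on A"
  unfolding Eul_def by (rule Eul.holomorphic_gser)

lemma Eul_0: "Eul 0 = 1"
  unfolding Eul_def Eul.gser_0 by simp

lemma Eul_zero: "Eul (of_real (1 / p ^ j)) = 0"
proof -
  have "(1 - of_real (p ^ j) * of_real (1 / p ^ j) :: complex) = 0"
    using p_pos by (simp only: of_real_mult [symmetric]) simp
  thus ?thesis by (subst Eul_prod[of _ "Suc j"]) simp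
qed

lemma phi1_not_constant: "\<not> phi1 constant_on UNIV"
proof
  assume "phi1 constant_on UNIV"
  then obtain k where k: "\<And>y. phi1 y = k" unfolding constant_on_def by auto
  have "k \<noteq> 0" using k[of 0] phi1_0 q_less_1 by auto
  have "phi0 y = k - of_real q * k" for y using phi1_rec[of y] by (simp add: k)
  hence "phi1 (of_real p * 1) = 0" using phi0_rec[of 1] by simp
  thus False using k \<open>k \<noteq> 0\<close> by simp
qed

text \<open>Rouche's theorem, applied to the Euler product, whose zeros in the disc are the numbers
  \<open>1 / p ^ j\<close> with \<open>j \<le> m\<close>.\<close>

lemma phi1_zero_count:
  assumes eps: "0 < \<epsilon>" "\<epsilon> < 1"
    and close: "\<And>y::complex. norm y = rho \<epsilon> m \<Longrightarrow>
      norm (of_real (1 - q) * Eul (of_real (q ^ 3)) * phi1 y - Eul y) \<le> norm (Eul y) / 2 \<and> Eul y \<noteq> 0"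
  shows "finite {y::complex. norm y < rho \<epsilon> m \<and> phi1 y = 0}" "Suc m \<le> card {y::complex. norm y < rho \<epsilon> m \<and> phi1 y = 0}"
proof -
  define r where "r = rho \<epsilon> m"
  define c where "c = of_real (1 - q) * Eul (of_real (q ^ 3))"
  note close = close[folded r_def c_def]
  have r: "r > 0" unfolding r_def by (rule rho_pos)
  have nr: "norm (of_real r :: complex) = r" using r by simp
  have c0: "c \<noteq> 0" using close[OF nr] by auto
  define S where "S = ball (0::complex) (r + 1)"
  have sphere: "path_image (circlepath 0 r) = sphere 0 r" using r by simp
  have fin_phi: "finite {y \<in> cball 0 (r + 1). phi1 y = 0}"
    by (rule holomorphic_compact_finite_zeros[of phi1 UNIV]) (auto simp: phi1_holo phi1_not_constant)
  have "\<not> Eul constant_on UNIV"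
  proof
    assume "Eul constant_on UNIV"
    hence "Eul 0 = Eul 1" by (auto simp: constant_on_def)
    thus False using Eul_0 Eul_zero[of 0] by simp
  qed
  hence fin_Eul: "finite {y \<in> cball 0 (r + 1). Eul y = 0}"
    by (intro holomorphic_compact_finite_zeros[of Eul UNIV]) (auto simp: Eul_holo)
  have sum_eq: "Eul y + (c * phi1 y - Eul y) = c * phi1 y" for y by simp
  have zeros_eq: "{y \<in> S. c * phi1 y = 0} = {y \<in> S. phi1 y = 0}" using c0 by auto
  have fin1: "finite {y \<in> S. phi1 y = 0}"
    by (rule finite_subset[OF _ fin_phi]) (auto simp: S_def)
  have fin2: "finite {y \<in> S. Eul y = 0}"
    by (rule finite_subset[OF _ fin_Eul]) (auto simp: S_def)
  have rouche: "(\<Sum>y\<in>{y \<in> S. c * phi1 y = 0}. winding_number (circlepath 0 r) y * of_int (zorder (\<lambda>y. c * phi1 y) y))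
      = (\<Sum>y\<in>{y \<in> S. Eul y = 0}. winding_number (circlepath 0 r) y * of_int (zorder Eul y))"
  proof (rule Rouche_theorem[of S Eul "\<lambda>y. c * phi1 y - Eul y" "circlepath 0 r", unfolded sum_eq])
    show "open S" "connected S" by (auto simp: S_def)
    show "finite {y \<in> S. c * phi1 y = 0}" unfolding zeros_eq by (rule fin1)
    show "finite {y \<in> S. Eul y = 0}" by (rule fin2)
    show "Eul holomorphic_on S" by (rule Eul_holo)
    show "(\<lambda>y. c * phi1 y - Eul y) holomorphic_on S"
      by (intro holomorphic_intros phi1_holo Eul_holo)
    show "path_image (circlepath 0 r) \<subseteq> S" unfolding sphere S_def by auto
    show "\<forall>z\<in>path_image (circlepath 0 r). norm (c * phi1 z - Eul z) < norm (Eul z)"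
    proof
      fix z assume "z \<in> path_image (circlepath 0 r)"
      hence "norm z = r" unfolding sphere by simp
      from close[OF this] have "norm (c * phi1 z - Eul z) \<le> norm (Eul z) / 2" "0 < norm (Eul z)" by auto
      thus "norm (c * phi1 z - Eul z) < norm (Eul z)" by linarith
    qed
    show "\<forall>z. z \<notin> S \<longrightarrow> winding_number (circlepath 0 r) z = 0"
    proof (intro allI impI)
      fix z assume "z \<notin> S"
      thus "winding_number (circlepath 0 r) z = 0"
        using r by (intro winding_number_zero_outside[of _ "cball 0 r"]) (auto simp: S_def)
    qed
  qed auto
  have wind: "winding_number (circlepath 0 r) y = (if norm y < r then 1 else 0)" if "norm y \<noteq> r" for y :: complex
  proof (cases "norm y < r")
    case True
    thus ?thesis by (simp add: winding_number_circlepath)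
  next
    case False
    thus ?thesis
      using r that by (subst winding_number_zero_outside[of _ "cball 0 r"]) auto
  qed
  have lhs: "(\<Sum>y\<in>{y \<in> S. c * phi1 y = 0}. winding_number (circlepath 0 r) y * of_int (zorder (\<lambda>y. c * phi1 y) y))
     = of_int (int (card {y::complex. norm y < r \<and> phi1 y = 0}))"
  proof -
    have "winding_number (circlepath 0 r) y * of_int (zorder (\<lambda>y. c * phi1 y) y) = (if norm y < r then 1 else 0)"
      if y: "phi1 y = 0" for y
    proof -
      have "norm y \<noteq> r" using close[of y] y by auto
      moreover have "zorder (\<lambda>y. c * phi1 y) y = 1"
      proof (rule zorder_zero_eqI)
        show "(\<lambda>y. c * phi1 y) holomorphic_on UNIV" by (intro holomorphic_intros phi1_holo)
        have "phi1 field_differentiable at y"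
          using phi1_holo[of UNIV] holomorphic_on_imp_differentiable_at by blast
        hence "deriv (\<lambda>y. c * phi1 y) y = c * deriv phi1 y" by (rule deriv_cmult)
        thus "(deriv ^^ nat 1) (\<lambda>y. c * phi1 y) y \<noteq> 0" using c0 phi1_zero_simple[OF y] by simp
        show "(deriv ^^ i) (\<lambda>y. c * phi1 y) y = 0" if "i < nat 1" for i using that y by simp
      qed auto
      ultimately show ?thesis by (simp add: wind)
    qed
    hence "(\<Sum>y\<in>{y \<in> S. c * phi1 y = 0}. winding_number (circlepath 0 r) y * of_int (zorder (\<lambda>y. c * phi1 y) y))
        = (\<Sum>y\<in>{y \<in> S. phi1 y = 0}. if norm y < r then 1 else 0)"
      unfolding zeros_eq by (intro sum.cong) auto
    also have "\<dots> = (\<Sum>y\<in>{y \<in> {y \<in> S. phi1 y = 0}. norm y < r}. 1)"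
      by (rule sum.inter_filter[symmetric, OF fin1])
    also have "{y \<in> {y \<in> S. phi1 y = 0}. norm y < r} = {y::complex. norm y < r \<and> phi1 y = 0}"
      by (auto simp: S_def)
    finally show ?thesis by simp
  qed
  define E where "E = {y::complex. norm y < r \<and> Eul y = 0}"
  have finE: "finite E" by (rule finite_subset[OF _ fin2]) (auto simp: S_def E_def)
  have zE: "zorder Eul y \<ge> 1" if "Eul y = 0" for y
  proof -
    have "int 1 \<le> zorder Eul y"
      by (rule zorder_geI[of _ _ UNIV 0])
         (use that Eul_0 Eul_holo in \<open>auto simp: analytic_on_holomorphic\<close>)
    thus ?thesis by simp
  qed
  have rhs: "(\<Sum>y\<in>{y \<in> S. Eul y = 0}. winding_number (circlepath 0 r) y * of_int (zorder Eul y))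
     = of_int (\<Sum>y\<in>E. zorder Eul y)"
  proof -
    have "(\<Sum>y\<in>{y \<in> S. Eul y = 0}. winding_number (circlepath 0 r) y * of_int (zorder Eul y))
        = (\<Sum>y\<in>{y \<in> S. Eul y = 0}. if norm y < r then of_int (zorder Eul y) else 0)"
    proof (rule sum.cong)
      fix y assume "y \<in> {y \<in> S. Eul y = 0}"
      hence "norm y \<noteq> r" using close[of y] by auto
      thus "winding_number (circlepath 0 r) y * of_int (zorder Eul y) = (if norm y < r then of_int (zorder Eul y) else 0)"
        by (simp add: wind)
    qed auto
    also have "\<dots> = (\<Sum>y\<in>{y \<in> {y \<in> S. Eul y = 0}. norm y < r}. of_int (zorder Eul y))"
      by (rule sum.inter_filter[symmetric, OF fin2])
    also have "{y \<in> {y \<in> S. Eul y = 0}. norm y < r} = E"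
      by (auto simp: S_def E_def)
    finally show ?thesis by simp
  qed
  have "int (card {y::complex. norm y < r \<and> phi1 y = 0}) = (\<Sum>y\<in>E. zorder Eul y)"
    using rouche unfolding lhs rhs by (simp only: of_int_eq_iff)
  also have "\<dots> \<ge> (\<Sum>y\<in>E. 1)" by (intro sum_mono zE) (auto simp: E_def)
  finally have ge: "int (card E) \<le> int (card {y::complex. norm y < r \<and> phi1 y = 0})" by simp
  have "(\<lambda>j. complex_of_real (1 / p ^ j)) ` {..m} \<subseteq> E"
  proof
    fix y assume "y \<in> (\<lambda>j. complex_of_real (1 / p ^ j)) ` {..m}"
    then obtain j where j: "j \<le> m" "y = of_real (1 / p ^ j)" by auto
    have "norm y = q powr (- 2 * real j)"
      using p_pos q_pos by (simp add: j(2) norm_divide norm_power powr_minus_divide p_powr [symmetric] del: of_real_divide)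
    also have "\<dots> < r" unfolding r_def rho_def using q_pos q_less_1 j(1) eps
      by (intro powr_less_mono') auto
    finally show "y \<in> E" using Eul_zero[of j] by (simp add: E_def j(2) del: of_real_divide)
  qed
  moreover have "inj_on (\<lambda>j. complex_of_real (1 / p ^ j)) {..m}"
  proof (rule inj_onI)
    fix i j assume "complex_of_real (1 / p ^ i) = complex_of_real (1 / p ^ j)"
    hence "p ^ i = p ^ j" by (simp only: of_real_eq_iff) simp
    thus "i = j" using p_pos p_less_1 by (metis power_inject_exp' less_irrefl)
  qed
  ultimately have "card {..m} \<le> card E" by (metis card_image card_mono finE)
  thus "Suc m \<le> card {y::complex. norm y < rho \<epsilon> m \<and> phi1 y = 0}" using ge unfolding r_def by simp
  show "finite {y::complex. norm y < rho \<epsilon> m \<and> phi1 y = 0}"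
    by (rule finite_subset[OF _ fin1]) (auto simp: S_def r_def)
qed

definition Zq :: "real set" where "Zq = {x. 0 < x \<and> qsin q (of_real x) = 0}"

lemma finite_Zq: "finite {y \<in> Zq. y \<le> x}"
proof -
  have "\<not> qsin q constant_on UNIV"
  proof
    assume "qsin q constant_on UNIV"
    then obtain k where "\<And>y. qsin q y = k" unfolding constant_on_def by auto
    hence eq: "qsin q = (\<lambda>_. k)" by auto
    have "deriv (qsin q) 0 = 0" unfolding eq by simp
    moreover have "qsin q 0 = 0" by (simp add: qsin_eq)
    ultimately show False using qsin_zero_simple by blast
  qed
  hence "finite {y \<in> cball 0 x. qsin q y = 0}"
    using holomorphic_qsin[of "\<lambda>z. z" UNIV] by (intro holomorphic_compact_finite_zeros[of "qsin q" UNIV]) auto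
  hence "finite (complex_of_real ` {y \<in> Zq. y \<le> x})"
    by (rule finite_subset[rotated]) (auto simp: Zq_def)
  thus ?thesis by (rule finite_imageD) (auto simp: inj_on_def)
qed

lemma Zq_count:
  assumes eps: "0 < \<epsilon>" "\<epsilon> < 1"
  shows "eventually (\<lambda>m. Suc m \<le> card {x \<in> Zq. x \<le> sqrt (rho \<epsilon> m / (q * sqrt q))}) sequentially"
  using phi1_Eul_close[OF eps]
proof eventually_elim
  case (elim m)
  note c = phi1_zero_count[OF eps, of m] elim
  let ?Y = "{y::complex. norm y < rho \<epsilon> m \<and> phi1 y = 0}" and ?X = "{x \<in> Zq. x \<le> sqrt (rho \<epsilon> m / (q * sqrt q))}"
  have "?Y \<subseteq> (\<lambda>x. arg2 (of_real x)) ` ?X"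
  proof
    fix y assume y: "y \<in> ?Y"
    then obtain x where x: "x > 0" "qsin q (of_real x) = 0" "y = arg2 (of_real x)"
      using phi1_zero_cases by blast
    have "norm y = q * sqrt q * x\<^sup>2" using q_pos x by (simp add: norm_mult norm_power)
    hence "x\<^sup>2 < rho \<epsilon> m / (q * sqrt q)" using y q_pos by (simp add: pos_less_divide_eq mult_ac)
    hence "x \<le> sqrt (rho \<epsilon> m / (q * sqrt q))" by (intro real_le_rsqrt) auto
    hence "x \<in> ?X" using x by (simp add: Zq_def)
    thus "y \<in> (\<lambda>x. arg2 (of_real x)) ` ?X" using x(3) by blast
  qed
  hence "card ?Y \<le> card ?X" by (rule surj_card_le[OF finite_Zq])
  moreover have "Suc m \<le> card ?Y" using c by blast
  ultimately show ?case by linarith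
qed

lemma infinite_Zq: "infinite Zq"
proof
  assume fin: "finite Zq"
  have "eventually (\<lambda>m. Suc m \<le> card {x \<in> Zq. x \<le> sqrt (rho (1/2) m / (q * sqrt q))}) sequentially"
    by (rule Zq_count) auto
  hence "eventually (\<lambda>m. Suc m \<le> card Zq) sequentially"
  proof eventually_elim
    case (elim m)
    have "card {x \<in> Zq. x \<le> sqrt (rho (1/2) m / (q * sqrt q))} \<le> card Zq"
      by (rule card_mono[OF fin]) auto
    thus ?case using elim by linarith
  qed
  moreover have "eventually (\<lambda>m. m > card Zq) sequentially" by (rule eventually_gt_at_top)
  ultimately have "eventually (\<lambda>m::nat. False) sequentially" by eventually_elim linarith
  thus False by simp
qed

lemma qomega_unique:
  assumes "k > 0"
  shows "\<exists>!x. x \<in> Zq \<and> card {y \<in> Zq. y \<le> x} = k"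
proof -
  obtain x where "x \<in> Zq" "card {y \<in> Zq. y \<le> x} = k"
    using locally_finite_counting[of Zq k, OF _ finite_Zq infinite_Zq] assms by (auto simp: Zq_def)
  moreover have "x = y" if "x \<in> Zq" "y \<in> Zq" "card {z \<in> Zq. z \<le> x} = card {z \<in> Zq. z \<le> y}" for x y
    using locally_finite_counting_less[OF finite_Zq, of x y] locally_finite_counting_less[OF finite_Zq, of y x]
      that by (metis less_irrefl linorder_neqE_linordered_idom)
  ultimately show ?thesis by metis
qed

lemma qomega_eq: "qomega q k = (THE x. x \<in> Zq \<and> card {y \<in> Zq. y \<le> x} = k)"
  unfolding qomega_def Zq_def by (simp add: conj_ac)

lemma qomega:
  assumes "k > 0"
  shows "qomega q k > 0" "qsin q (of_real (qomega q k)) = 0" "card {y \<in> Zq. y \<le> qomega q k} = k"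
  using theI'[OF qomega_unique[OF assms]] unfolding qomega_eq by (auto simp: Zq_def)

lemma qomega_inj:
  assumes "j > 0" "k > 0" "qomega q j = qomega q k"
  shows "j = k"
  using qomega(3)[OF assms(1)] qomega(3)[OF assms(2)] unfolding assms(3) by (rule trans[OF sym])

lemma Zq_qomega:
  assumes "x \<in> Zq"
  shows "\<exists>k>0. x = qomega q k"
proof -
  define k where "k = card {y \<in> Zq. y \<le> x}"
  have "x \<in> {y \<in> Zq. y \<le> x}" using assms by simp
  hence "k > 0" unfolding k_def using finite_Zq card_gt_0_iff by blast
  moreover have "x = qomega q k"
    unfolding qomega_eq by (rule the1_equality[symmetric, OF qomega_unique[OF \<open>k > 0\<close>]])
      (use assms k_def in auto)
  ultimately show ?thesis by blast
qed

text \<open>At least \<open>m + 1\<close> zeros lie below the radius, so the zero with number \<open>m + 1\<close> does. Here \<open>\<epsilon>\<close> may be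
  arbitrarily small: a bound up to a constant factor would not suffice for the convergence of
  the series, because the factor would enter the Gaussian growth of the basis functions.\<close>

lemma qomega_le:
  assumes eps: "0 < \<epsilon>" "\<epsilon> < 1"
  shows "eventually (\<lambda>m. norm (arg2 (of_real (qomega q (Suc m)))) \<le> rho \<epsilon> m) sequentially"
  using Zq_count[OF eps]
proof eventually_elim
  case (elim m)
  define R where "R = sqrt (rho \<epsilon> m / (q * sqrt q))"
  have o: "qomega q (Suc m) > 0" "qomega q (Suc m) \<in> Zq" "card {y \<in> Zq. y \<le> qomega q (Suc m)} = Suc m"
    using qomega[of "Suc m"] by (auto simp: Zq_def)
  have "qomega q (Suc m) \<le> R"
  proof (rule ccontr)
    assume "\<not> qomega q (Suc m) \<le> R"
    hence "card {y \<in> Zq. y \<le> R} < card {y \<in> Zq. y \<le> qomega q (Suc m)}"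
      using o by (intro locally_finite_counting_less finite_Zq) auto
    thus False using elim o(3) by (simp add: R_def)
  qed
  hence "(qomega q (Suc m))\<^sup>2 \<le> R\<^sup>2" using o by (intro power_mono) auto
  also have "R\<^sup>2 = rho \<epsilon> m / (q * sqrt q)"
    unfolding R_def using rho_pos[of \<epsilon> m] q_pos by (intro real_sqrt_pow2) auto
  finally have "q * sqrt q * (qomega q (Suc m))\<^sup>2 \<le> rho \<epsilon> m" using q_pos by (simp add: field_simps)
  thus ?case using q_pos by (simp add: norm_mult norm_power)
qed

end

section \<open>Completeness\<close>

text \<open>Near a zero \<open>a\<close> of \<open>S\<close>, both \<open>N\<close> and \<open>S\<close> can be divided by \<open>z - a\<close>, and the new denominator does not
  vanish at \<open>a\<close>.\<close>

lemma holomorphic_quotient_simple_zeros: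
  fixes N S :: "complex \<Rightarrow> complex"
  assumes N: "N holomorphic_on UNIV" and S: "S holomorphic_on UNIV"
    and simple: "\<And>a. S a = 0 \<Longrightarrow> deriv S a \<noteq> 0" and zero: "\<And>a. S a = 0 \<Longrightarrow> N a = 0"
  shows "(\<lambda>z. if S z = 0 then deriv N z / deriv S z else N z / S z) holomorphic_on UNIV" (is "?Q holomorphic_on _")
proof -
  have loc: "\<exists>U. open U \<and> a \<in> U \<and> ?Q holomorphic_on U" for a
  proof (cases "S a = 0")
    case False
    define U where "U = {z. S z \<noteq> 0}"
    have "continuous_on UNIV S" using S by (rule holomorphic_on_imp_continuous_on)
    hence "open U" unfolding U_def by (intro open_Collect_neq continuous_intros)
    moreover have "(\<lambda>z. N z / S z) holomorphic_on U"
      unfolding U_def by (intro holomorphic_intros holomorphic_on_subset[OF N] holomorphic_on_subset[OF S]) auto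
    hence "?Q holomorphic_on U" by (rule holomorphic_transform) (auto simp: U_def)
    ultimately show ?thesis using False by (intro exI[of _ U]) (auto simp: U_def)
  next
    case True
    define N' where "N' z = (if z = a then deriv N a else (N z - N a) / (z - a))" for z
    define S' where "S' z = (if z = a then deriv S a else (S z - S a) / (z - a))" for z
    have N': "N' holomorphic_on UNIV" unfolding N'_def[abs_def] by (rule pole_lemma[OF N]) simp
    have S': "S' holomorphic_on UNIV" unfolding S'_def[abs_def] by (rule pole_lemma[OF S]) simp
    define U where "U = {z. S' z \<noteq> 0}"
    have "continuous_on UNIV S'" using S' by (rule holomorphic_on_imp_continuous_on)
    hence "open U" unfolding U_def by (intro open_Collect_neq continuous_intros)
    moreover have "a \<in> U" using simple[OF True] by (simp add: U_def S'_def)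
    moreover have "(\<lambda>z. N' z / S' z) holomorphic_on U"
      unfolding U_def by (intro holomorphic_intros holomorphic_on_subset[OF N'] holomorphic_on_subset[OF S']) auto
    hence "?Q holomorphic_on U"
    proof (rule holomorphic_transform)
      fix z assume "z \<in> U"
      thus "N' z / S' z = ?Q z"
        using True zero[OF True] by (cases "z = a") (auto simp: U_def N'_def S'_def)
    qed
    ultimately show ?thesis by blast
  qed
  show ?thesis unfolding holomorphic_on_def
  proof
    fix a
    from loc[of a] obtain U where "open U" "a \<in> U" "?Q holomorphic_on U" by (elim exE conjE)
    thus "?Q field_differentiable at a within UNIV"
      using holomorphic_on_imp_differentiable_at by simp
  qed
qed

lemma bounded_on_spheres:
  fixes f :: "complex \<Rightarrow> complex"
  assumes f: "f holomorphic_on UNIV" and r: "filterlim r at_top sequentially"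
    and le: "eventually (\<lambda>m. \<forall>z. norm z = r m \<longrightarrow> norm (f z) \<le> B m) sequentially"
  shows "eventually (\<lambda>m. norm (f z) \<le> B m) sequentially"
proof -
  have "eventually (\<lambda>m. r m > norm z) sequentially"
    using r by (simp add: filterlim_at_top_dense)
  with le show ?thesis
  proof eventually_elim
    case (elim m)
    show ?case
    proof (rule maximum_modulus_frontier[of f "cball 0 (r m)"])
      show "norm (f w) \<le> B m" if "w \<in> frontier (cball 0 (r m))" for w
        using that elim by (auto simp: frontier_cball)
    qed (use elim f in \<open>auto intro: holomorphic_on_subset holomorphic_on_imp_continuous_on\<close>)
  qed
qed

text \<open>If \<open>g\<close> vanishes below \<open>N\<close>, then dividing the moment with exponent \<open>j\<close> by \<open>x ^ (N * j)\<close> and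
  letting \<open>j\<close> tend to infinity isolates \<open>g N\<close>.\<close>

lemma moments_zero:
  fixes g :: "nat \<Rightarrow> complex" and x :: real
  assumes x: "0 < x" "x < 1" and g: "summable (\<lambda>n. norm (g n))"
    and M: "\<And>j. (\<lambda>n. g n * of_real ((x ^ n) ^ j)) sums 0"
  shows "g n = 0"
proof (induction n rule: less_induct)
  case (less N)
  define G where "G = (\<Sum>n. norm (g (n + Suc N)))"
  have sG: "summable (\<lambda>n. norm (g (n + Suc N)))" using g by (subst summable_iff_shift)
  have "norm (g N) \<le> x ^ j * G" for j
  proof -
    have "(\<lambda>n. g (n + N) * of_real ((x ^ (n + N)) ^ j)) sums 0"
      using M[of j, THEN sums_split_initial_segment, of N] less by simp
    hence "(\<lambda>n. of_real (1 / (x ^ N) ^ j) * (g (n + N) * of_real ((x ^ (n + N)) ^ j))) sums (of_real (1 / (x ^ N) ^ j) * 0)"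
      by (rule sums_mult)
    moreover have "of_real (1 / (x ^ N) ^ j) * (g (n + N) * of_real ((x ^ (n + N)) ^ j)) = g (n + N) * of_real ((x ^ n) ^ j)" for n
    proof -
      have "1 / (x ^ N) ^ j * (x ^ (n + N)) ^ j = (x ^ n) ^ j"
        using x by (simp add: power_add power_mult_distrib)
      hence "of_real (1 / (x ^ N) ^ j) * of_real ((x ^ (n + N)) ^ j) = (of_real ((x ^ n) ^ j) :: complex)"
        by (metis of_real_mult)
      thus ?thesis by (metis mult.left_commute)
    qed
    ultimately have "(\<lambda>n. g (n + N) * of_real ((x ^ n) ^ j)) sums 0" by (simp only: mult_zero_right)
    from this[THEN sums_split_initial_segment, of 1]
    have s: "(\<lambda>n. g (n + Suc N) * of_real ((x ^ Suc n) ^ j)) sums (- g N)" by simp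
    have "norm (- g N) \<le> (\<Sum>n. x ^ j * norm (g (n + Suc N)))"
      unfolding sums_unique[OF s]
    proof (rule norm_suminf_le)
      show "summable (\<lambda>n. x ^ j * norm (g (n + Suc N)))" by (intro summable_mult sG)
      fix n
      have "(x ^ Suc n) ^ j \<le> x ^ j"
      proof (rule power_mono)
        have "x ^ n \<le> 1" using x by (intro power_le_one) auto
        thus "x ^ Suc n \<le> x" using x by (simp add: mult_left_le)
      qed (use x in auto)
      hence "norm (g (n + Suc N)) * (x ^ Suc n) ^ j \<le> norm (g (n + Suc N)) * x ^ j"
        by (intro mult_left_mono) auto
      moreover have "norm (of_real ((x ^ Suc n) ^ j) :: complex) = (x ^ Suc n) ^ j"
        unfolding norm_of_real using x by simp
      ultimately show "norm (g (n + Suc N) * of_real ((x ^ Suc n) ^ j)) \<le> x ^ j * norm (g (n + Suc N))"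
        by (simp only: norm_mult mult.commute)
    qed
    also have "\<dots> = x ^ j * G" unfolding G_def by (rule suminf_mult[OF sG])
    finally show ?thesis by simp
  qed
  moreover have "(\<lambda>j. x ^ j * G) \<longlonglongrightarrow> 0 * G"
    using x by (intro tendsto_mult tendsto_const LIMSEQ_realpow_zero) auto
  ultimately have "norm (g N) \<le> 0 * G"
    by (intro tendsto_lowerbound[of "\<lambda>j. x ^ j * G" "0 * G" sequentially]) auto
  thus "g N = 0" by simp
qed

context gauss_series begin

text \<open>The power series coefficients of the sum are the moments of \<open>g\<close>, up to the nonzero coefficients of \<open>gser\<close>.\<close>

lemma dilation_series_zero:
  fixes g :: "nat \<Rightarrow> complex" and x :: real
  assumes x: "0 < x" "x < 1" and g: "summable (\<lambda>n. norm (g n))"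
    and zero: "\<And>w. w \<noteq> 0 \<Longrightarrow> (\<Sum>n. g n * gser q D (of_real (x ^ n) * w)) = 0"
  shows "g n = 0"
proof (rule moments_zero[OF x g])
  define A :: "nat \<Rightarrow> complex" where "A j = of_real ((-1) ^ j * q ^ (j * (j - 1)) / D j)" for j
  have A0: "A j \<noteq> 0" for j using q_pos D_pos[of j] by (simp add: A_def)
  have x1: "(x ^ n) ^ j \<le> 1" "0 \<le> (x ^ n) ^ j" for n j using x by (auto intro!: power_le_one)
  have nx: "norm (of_real ((x ^ n) ^ j) :: complex) \<le> 1" for n j
    unfolding norm_of_real using x1[of n j] by simp
  define M where "M j = (\<Sum>n. g n * of_real ((x ^ n) ^ j))" for j
  have sM: "(\<lambda>n. g n * of_real ((x ^ n) ^ j)) sums M j" for j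
    unfolding M_def
  proof (rule summable_sums, rule summable_comparison_test'[OF g, of 0])
    fix n :: nat
    have "norm (g n) * norm (of_real ((x ^ n) ^ j) :: complex) \<le> norm (g n) * 1"
      by (intro mult_left_mono nx) auto
    thus "norm (g n * of_real ((x ^ n) ^ j)) \<le> norm (g n)" by (simp only: norm_mult mult_1_right)
  qed
  have series: "(\<lambda>j. A j * M j * w ^ j) sums 0" if "w \<noteq> 0" for w
  proof -
    define f where "f n j = g n * (A j * (of_real (x ^ n) * w) ^ j)" for n j
    have f_eq: "f n j = A j * w ^ j * (g n * of_real ((x ^ n) ^ j))" for n j
      unfolding f_def power_mult_distrib of_real_power by (simp only: mult_ac)
    have "(\<lambda>j. \<Sum>n. f n j) sums (\<Sum>n. \<Sum>j. f n j)"
    proof (rule suminf_swap_dominated[OF g])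
      show "summable (\<lambda>j. norm (A j * w ^ j))" unfolding A_def by (rule summable_norm_gser)
      show "norm (f n j) \<le> norm (g n) * norm (A j * w ^ j)" for n j
      proof -
        have "norm (f n j) = norm (g n) * norm (A j * w ^ j) * norm (of_real ((x ^ n) ^ j) :: complex)"
          unfolding f_eq norm_mult by (simp only: mult_ac)
        also have "\<dots> \<le> norm (g n) * norm (A j * w ^ j) * 1"
          by (intro mult_left_mono nx) auto
        finally show ?thesis by simp
      qed
    qed auto
    moreover have "(\<Sum>n. f n j) = A j * M j * w ^ j" for j
      unfolding f_eq using sums_unique[OF sums_mult[OF sM[of j], of "A j * w ^ j"]] by (simp add: mult_ac)
    moreover have "(\<Sum>j. f n j) = g n * gser q D (of_real (x ^ n) * w)" for n
      unfolding f_def A_def by (intro sums_unique[symmetric] sums_mult gser_sums)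
    ultimately show ?thesis using zero[OF that] by simp
  qed
  \<comment> \<open>Multiplying by \<open>w\<close> makes the identity valid at \<open>w = 0\<close> as well.\<close>
  define b where "b j = (case j of 0 \<Rightarrow> 0 | Suc i \<Rightarrow> A i * M i)" for j
  have b: "(\<lambda>j. b j * (w - 0) ^ j) sums 0" for w
  proof (cases "w = 0")
    case True
    have "b j * (w - 0) ^ j = 0" for j using True by (cases j) (auto simp: b_def)
    thus ?thesis by (simp only: sums_zero)
  next
    case False
    have "(\<lambda>j. w * (A j * M j * w ^ j)) sums (w * 0)" by (intro sums_mult series False)
    hence "(\<lambda>j. b (Suc j) * (w - 0) ^ Suc j) sums 0" by (simp add: b_def mult_ac)
    from sums_Suc[OF this] show ?thesis by (simp add: b_def)
  qed
  have "M j = 0" for j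
  proof (rule ccontr)
    assume "M j \<noteq> 0"
    hence "b (Suc j) \<noteq> 0" using A0 by (simp add: b_def)
    then obtain s where "0 < s" "\<And>z. z \<in> cball 0 s - {0} \<Longrightarrow> (\<lambda>_::complex. 0::complex) z \<noteq> 0"
      using powser_0_nonzero[of 1 0 b "\<lambda>_. 0" "Suc j"] b by auto
    from this(1) this(2)[of "of_real s"] show False by simp
  qed
  thus "(\<lambda>n. g n * of_real ((x ^ n) ^ j)) sums 0" for j using sM[of j] by simp
qed

end

context q_base begin

lemma cs_minus: "cs n (- l) = cs n l"
  by (simp add: cs_eq)

lemma sn_minus: "sn n (- l) = - sn n l"
  by (simp add: sn_eq)

lemma qsin_zero_cases:
  assumes "qsin q l = 0"
  obtains "l = 0" | k where "k > 0" "l = of_real (qomega q k)" | k where "k > 0" "l = - of_real (qomega q k)"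
proof -
  obtain t where t: "l = of_real t" using qsin_zero_real[OF assms] by (elim Reals_cases)
  consider "t = 0" | "t > 0" | "t < 0" by linarith
  thus ?thesis
  proof cases
    case 1 thus ?thesis using that(1) t by simp
  next
    case 2
    hence "t \<in> Zq" using assms t by (simp add: Zq_def)
    thus ?thesis using Zq_qomega that(2) t by blast
  next
    case 3
    have "qsin q (- l) = - qsin q l" by (simp add: qsin_eq)
    hence "- t \<in> Zq" using 3 assms t by (simp add: Zq_def)
    then obtain k where "k > 0" "- t = qomega q k" using Zq_qomega by blast
    hence "l = - of_real (qomega q k)" using t by (metis minus_minus of_real_minus)
    thus ?thesis using that(3) \<open>k > 0\<close> by blast
  qed
qed

definition rad :: "nat \<Rightarrow> real" where "rad m = sqrt (rho (1/2) m / (q * sqrt q))"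

lemma rad_pos: "rad m > 0"
  unfolding rad_def using rho_pos[of "1/2" m] q_pos by simp

lemma arg2_rad:
  assumes "norm l = rad m"
  shows "norm (arg2 l) = rho (1/2) m"
proof -
  have "(rad m)\<^sup>2 = rho (1/2) m / (q * sqrt q)"
    unfolding rad_def using rho_pos[of "1/2" m] q_pos by (intro real_sqrt_pow2) auto
  thus ?thesis using q_pos assms by (simp add: norm_mult norm_power)
qed

lemma rho_half: "rho (1/2) m = q powr (- (2 * real m + 1))"
  by (simp add: rho_def algebra_simps)

lemma rad_at_top: "filterlim rad at_top sequentially"
proof -
  have "filterlim (\<lambda>m. rho (1/2) m * (1 / (q * sqrt q))) at_top sequentially"
    by (rule filterlim_at_top_mult_tendsto_pos[OF tendsto_const])
       (use q_pos in \<open>auto intro!: rho_at_top\<close>)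
  hence "filterlim (\<lambda>m. sqrt (rho (1/2) m * (1 / (q * sqrt q)))) at_top sequentially"
    by (rule filterlim_compose[OF sqrt_at_top])
  thus ?thesis unfolding rad_def[abs_def] by simp
qed

lemma phi1_circle_lower:
  "\<exists>\<kappa>>0. eventually (\<lambda>m. \<forall>y::complex. norm y = rho (1/2) m \<longrightarrow>
      \<kappa> * q powr (- (real m + 1)\<^sup>2) \<le> norm (phi1 y)) sequentially"
proof -
  obtain C where C: "C > 0" and C_le: "\<And>m (y::complex). norm y = rho (1/2) m \<Longrightarrow>
     C * q powr (- ((real m + 1) * (real m + 2 * (1/2)))) \<le> norm (Eul y)"
    using Eul_circle[of "1/2"] by auto
  define c where "c = of_real (1 - q) * Eul (of_real (q ^ 3))"
  define \<kappa> where "\<kappa> = C / (2 * (norm c + 1))"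
  have "\<kappa> > 0" unfolding \<kappa>_def using C by (simp add: add_nonneg_pos)
  moreover have "eventually (\<lambda>m. \<forall>y::complex. norm y = rho (1/2) m \<longrightarrow>
     norm (c * phi1 y - Eul y) \<le> norm (Eul y) / 2 \<and> Eul y \<noteq> 0) sequentially"
    unfolding c_def by (rule phi1_Eul_close) auto
  hence "eventually (\<lambda>m. \<forall>y::complex. norm y = rho (1/2) m \<longrightarrow>
      \<kappa> * q powr (- (real m + 1)\<^sup>2) \<le> norm (phi1 y)) sequentially"
  proof eventually_elim
    case (elim m)
    show ?case
    proof (intro allI impI)
      fix y :: complex assume y: "norm y = rho (1/2) m"
      have "norm (Eul y) - norm (c * phi1 y) \<le> norm (Eul y - c * phi1 y)" by (rule norm_triangle_ineq2)
      also have "\<dots> \<le> norm (Eul y) / 2" using elim y by (simp add: norm_minus_commute)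
      finally have "norm (Eul y) / 2 \<le> norm c * norm (phi1 y)" by (simp add: norm_mult)
      also have "\<dots> \<le> (norm c + 1) * norm (phi1 y)" by (intro mult_right_mono) auto
      finally have le: "C * q powr (- ((real m + 1) * (real m + 2 * (1/2)))) / 2 \<le> (norm c + 1) * norm (phi1 y)"
        using C_le[OF y] by linarith
      have eq: "(real m + 1) * (real m + 2 * (1/2)) = (real m + 1)\<^sup>2"
        by (simp add: power2_eq_square)
      have "C * x \<le> norm (phi1 y) * (2 * (norm c + 1))" if "C * x / 2 \<le> (norm c + 1) * norm (phi1 y)" for x
        using that by (simp add: algebra_simps)
      from this[OF le[unfolded eq]]
      have "C * q powr (- (real m + 1)\<^sup>2) \<le> norm (phi1 y) * (2 * (norm c + 1))" .
      moreover have "0 < 2 * (norm c + 1)" by (simp add: add_nonneg_pos)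
      ultimately have "C * q powr (- (real m + 1)\<^sup>2) / (2 * (norm c + 1)) \<le> norm (phi1 y)"
        by (simp only: pos_divide_le_eq)
      thus "\<kappa> * q powr (- (real m + 1)\<^sup>2) \<le> norm (phi1 y)" by (simp add: \<kappa>_def)
    qed
  qed
  ultimately show ?thesis by blast
qed

text \<open>The quotient by the \<open>q\<close>-sine is entire and, by the comparison with the Euler product, bounded
  on a sequence of circles, hence constant; its value at \<open>0\<close> is a multiple of the zeroth coefficient.\<close>

lemma cos_complete:
  assumes B: "\<And>n. norm (e n) \<le> B"
    and e0: "(\<Sum>n. of_real (q ^ n) * e n) = 0"
    and ek: "\<And>k. k > 0 \<Longrightarrow> cos_tf e (of_real (qomega q k)) = 0"
  shows "e n = 0"
proof -
  have B0: "0 \<le> B" using B[of 0] norm_ge_zero order_trans by blast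
  have sin_hol: "qsin q holomorphic_on UNIV" using holomorphic_qsin[of "\<lambda>z. z" UNIV] by simp
  have zero0: "cos_tf e 0 = 0" unfolding cos_tf_def using e0 phi0.gser_0 by (simp add: cs_eq phi0_def)
  have even: "cos_tf e (- l) = cos_tf e l" for l unfolding cos_tf_def cs_minus ..
  have zero: "cos_tf e l = 0" if "qsin q l = 0" for l
    using that by (rule qsin_zero_cases) (auto simp: zero0 even ek)
  \<comment> \<open>The factor \<open>l\<close> compensates for the zero of the \<open>q\<close>-sine at \<open>0\<close>: dividing by \<open>phi1\<close> is what matches the growth.\<close>
  define N where "N l = l * cos_tf e l" for l
  have N: "N holomorphic_on UNIV" unfolding N_def[abs_def]
    by (intro holomorphic_intros holomorphic_cos_tf[OF B])
  define Q where "Q l = (if qsin q l = 0 then deriv N l / deriv (qsin q) l else N l / qsin q l)" for l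
  have Q: "Q holomorphic_on UNIV" unfolding Q_def[abs_def]
    by (rule holomorphic_quotient_simple_zeros[OF N sin_hol]) (auto simp: qsin_zero_simple N_def zero)
  obtain \<kappa> where \<kappa>: "\<kappa> > 0" and low: "eventually (\<lambda>m. \<forall>y::complex. norm y = rho (1/2) m \<longrightarrow>
      \<kappa> * q powr (- (real m + 1)\<^sup>2) \<le> norm (phi1 y)) sequentially"
    using phi1_circle_lower by blast
  define C where "C = B * Kq / (1 - q) / \<kappa>"
  have "eventually (\<lambda>m. \<forall>l. norm l = rad m \<longrightarrow> norm (Q l) \<le> C) sequentially"
    using low
  proof eventually_elim
    case (elim m)
    show ?case
    proof (intro allI impI)
      fix l :: complex assume l: "norm l = rad m"
      note a = arg2_rad[OF l]
      hence "norm (arg2 l) \<le> q powr (- (2 * real m + 1))" unfolding rho_half by simp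
      from norm_cs_le[OF this] have "norm (cs n l) \<le> Kq * q powr (- ((2 * real m + 1 + 1)\<^sup>2 / 4))" for n .
      moreover have "(2 * real m + 1 + 1)\<^sup>2 / 4 = (real m + 1)\<^sup>2"
        by (simp add: power2_eq_square field_simps)
      ultimately have "norm (cs n l) \<le> Kq * q powr (- (real m + 1)\<^sup>2)" for n by simp
      from weighted_geometric(3)[OF B this]
      have up: "norm (cos_tf e l) \<le> B * (Kq * q powr (- (real m + 1)\<^sup>2)) / (1 - q)"
        by (simp add: cos_tf_def)
      have lo: "\<kappa> * q powr (- (real m + 1)\<^sup>2) \<le> norm (phi1 (arg2 l))" using elim a by blast
      have pos: "0 < \<kappa> * q powr (- (real m + 1)\<^sup>2)" using \<kappa> q_pos by simp
      hence "phi1 (arg2 l) \<noteq> 0" using lo by auto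
      moreover have "l \<noteq> 0" using l rad_pos[of m] by auto
      ultimately have "Q l = cos_tf e l / phi1 (arg2 l)" by (simp add: Q_def qsin_eq N_def)
      hence "norm (Q l) = norm (cos_tf e l) / norm (phi1 (arg2 l))" by (simp add: norm_divide)
      also have "\<dots> \<le> (B * (Kq * q powr (- (real m + 1)\<^sup>2)) / (1 - q)) / (\<kappa> * q powr (- (real m + 1)\<^sup>2))"
        by (intro frac_le order_trans[OF norm_ge_zero up] up lo pos)
      also have "\<dots> = C" unfolding C_def using pos q_pos by simp
      finally show "norm (Q l) \<le> C" .
    qed
  qed
  hence "eventually (\<lambda>m::nat. norm (Q l) \<le> C) sequentially" for l
    by (rule bounded_on_spheres[OF Q rad_at_top])
  hence "norm (Q l) \<le> C" for l by simp
  hence "bounded (range Q)" by (auto simp: bounded_iff)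
  hence "Q constant_on UNIV" by (rule Liouville_theorem[OF Q])
  then obtain K where K: "\<And>l. Q l = K" by (auto simp: constant_on_def)
  have "deriv N 0 = 0"
  proof (rule DERIV_imp_deriv)
    have "(cos_tf e has_field_derivative deriv (cos_tf e) 0) (at 0)"
      by (rule holomorphic_derivI[OF holomorphic_cos_tf[OF B] open_UNIV]) auto
    thus "(N has_field_derivative 0) (at 0)" unfolding N_def[abs_def]
      by (auto intro!: derivative_eq_intros simp: zero0)
  qed
  hence "Q 0 = 0" by (simp add: Q_def qsin_eq)
  hence Q0: "Q l = 0" for l using K by metis
  have cos0: "cos_tf e l = 0" for l
  proof (cases "qsin q l = 0")
    case False
    hence "N l = 0" using Q0[of l] by (simp add: Q_def)
    moreover have "l \<noteq> 0" using False by (auto simp: qsin_eq)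
    ultimately show ?thesis by (simp add: N_def)
  qed (rule zero)
  have "of_real (q ^ n) * e n = 0"
  proof (rule phi0.dilation_series_zero[OF p_pos p_less_1])
    have "summable (\<lambda>n. B * 1 * q ^ n)"
      using q_pos q_less_1 by (intro summable_mult summable_geometric) auto
    thus "summable (\<lambda>n. norm (of_real (q ^ n) * e n))"
      by (rule summable_comparison_test'[where N = 0])
         (use B q_pos in \<open>auto simp: norm_mult norm_power mult_ac intro!: mult_right_mono\<close>)
    fix w :: complex
    define l where "l = csqrt (w / of_real (q * sqrt q))"
    have "arg2 l = w" unfolding l_def using q_pos by simp
    thus "(\<Sum>n. of_real (q ^ n) * e n * gser q (\<lambda>n. qpoch q q (2 * n)) (of_real (p ^ n) * w)) = 0"
      using cos0[of l] by (simp add: cos_tf_def cs_eq phi0_def)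
  qed
  thus ?thesis using q_pos by simp
qed

text \<open>Here the quotient even tends to \<open>0\<close> along the circles: the argument of \<open>sn (Suc n)\<close> carries an additional
  factor \<open>q\<close>, which makes the numerator smaller by \<open>q ^ (2 * m + 1)\<close>. So there is no analogue of the
  zeroth coefficient.\<close>

lemma sin_complete:
  assumes B: "\<And>n. norm (e n) \<le> B"
    and ek: "\<And>k. k > 0 \<Longrightarrow> sin_tf e (of_real (qomega q k)) = 0"
  shows "e n = 0"
proof -
  have B0: "0 \<le> B" using B[of 0] norm_ge_zero order_trans by blast
  have sin_hol: "qsin q holomorphic_on UNIV" using holomorphic_qsin[of "\<lambda>z. z" UNIV] by simp
  have zero0: "sin_tf e 0 = 0" unfolding sin_tf_def by (simp add: sn_eq)
  have odd: "sin_tf e (- l) = - sin_tf e l" for l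
  proof -
    obtain C where "\<And>n. norm (sn (Suc n) l) \<le> C" using bounded_sn by blast
    from sums_minus[OF sin_tf_sums[of e B l, OF B]] show ?thesis
      unfolding sin_tf_def[of e "- l"] sn_minus by (simp add: sums_iff)
  qed
  have zero: "sin_tf e l = 0" if "qsin q l = 0" for l
    using that by (rule qsin_zero_cases) (auto simp: zero0 odd ek)
  have N: "sin_tf e holomorphic_on UNIV" by (rule holomorphic_sin_tf[OF B])
  define Q where "Q l = (if qsin q l = 0 then deriv (sin_tf e) l / deriv (qsin q) l else sin_tf e l / qsin q l)" for l
  have Q: "Q holomorphic_on UNIV" unfolding Q_def[abs_def]
    by (rule holomorphic_quotient_simple_zeros[OF N sin_hol]) (auto simp: qsin_zero_simple zero)
  obtain \<kappa> where \<kappa>: "\<kappa> > 0" and low: "eventually (\<lambda>m. \<forall>y::complex. norm y = rho (1/2) m \<longrightarrow>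
      \<kappa> * q powr (- (real m + 1)\<^sup>2) \<le> norm (phi1 y)) sequentially"
    using phi1_circle_lower by blast
  define C where "C = B * Kq / (1 - q) / \<kappa>"
  have "eventually (\<lambda>m. \<forall>l. norm l = rad m \<longrightarrow> norm (Q l) \<le> C * q ^ (2 * m + 1)) sequentially"
    using low
  proof eventually_elim
    case (elim m)
    show ?case
    proof (intro allI impI)
      fix l :: complex assume l: "norm l = rad m"
      note a = arg2_rad[OF l]
      hence "norm (arg2 l) \<le> q powr (- (2 * real m + 1))" unfolding rho_half by simp
      from norm_sn_Suc_le[OF this]
      have "norm (sn (Suc n) l) \<le> Kq * (norm l * q powr (- ((2 * real m + 1 - 1)\<^sup>2 / 4)))" for n .
      hence "norm (sn (Suc n) l) \<le> Kq * (norm l * q powr (- (real m)\<^sup>2))" for n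
        by (simp add: power2_eq_square)
      from weighted_geometric(3)[OF B this]
      have up: "norm (sin_tf e l) \<le> B * (Kq * (norm l * q powr (- (real m)\<^sup>2))) / (1 - q)"
        by (simp add: sin_tf_def)
      have l0: "norm l > 0" using l rad_pos[of m] by auto
      have lo: "norm l * (\<kappa> * q powr (- (real m + 1)\<^sup>2)) \<le> norm l * norm (phi1 (arg2 l))"
        using elim a by (intro mult_left_mono) auto
      have pos: "0 < norm l * (\<kappa> * q powr (- (real m + 1)\<^sup>2))" using \<kappa> q_pos l0 by simp
      have sin_norm: "norm (qsin q l) = norm l * norm (phi1 (arg2 l))" by (simp add: qsin_eq norm_mult)
      hence "qsin q l \<noteq> 0" using lo pos by auto
      hence "norm (Q l) = norm (sin_tf e l) / (norm l * norm (phi1 (arg2 l)))"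
        unfolding sin_norm [symmetric] by (simp add: Q_def norm_divide)
      also have "\<dots> \<le> (B * (Kq * (norm l * q powr (- (real m)\<^sup>2))) / (1 - q)) / (norm l * (\<kappa> * q powr (- (real m + 1)\<^sup>2)))"
        by (intro frac_le order_trans[OF norm_ge_zero up] up lo pos)
      also have "\<dots> = C * (q powr (- (real m)\<^sup>2) / q powr (- (real m + 1)\<^sup>2))"
        unfolding C_def using l0 \<kappa> q_less_1 by simp
      also have "q powr (- (real m)\<^sup>2) / q powr (- (real m + 1)\<^sup>2) = q powr (real (2 * m + 1))"
        unfolding powr_diff [symmetric] by (simp add: power2_eq_square algebra_simps)
      also have "\<dots> = q ^ (2 * m + 1)" using q_pos by (rule powr_realpow)
      finally show "norm (Q l) \<le> C * q ^ (2 * m + 1)" .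
    qed
  qed
  hence ev: "eventually (\<lambda>m::nat. norm (Q l) \<le> C * q ^ (2 * m + 1)) sequentially" for l
    by (rule bounded_on_spheres[OF Q rad_at_top])
  have lim: "(\<lambda>m. C * q ^ (2 * m + 1)) \<longlonglongrightarrow> 0"
  proof -
    have "(\<lambda>m. C * q * p ^ m) \<longlonglongrightarrow> C * q * 0"
      by (intro tendsto_mult tendsto_const p_power_tendsto)
    thus ?thesis by (simp add: p_power_eq mult_ac)
  qed
  have "norm (Q l) \<le> 0" for l
    by (rule tendsto_lowerbound[OF lim ev]) simp
  hence Q0: "Q l = 0" for l by simp
  have sin0: "sin_tf e l = 0" for l
    using Q0[of l] zero[of l] by (cases "qsin q l = 0") (auto simp: Q_def)
  have "of_real (q ^ n * q ^ Suc n) * e n = 0"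
  proof (rule phi1.dilation_series_zero[OF p_pos p_less_1])
    have "summable (\<lambda>n. B * 1 * q ^ n)"
      using q_pos q_less_1 by (intro summable_mult summable_geometric) auto
    thus "summable (\<lambda>n. norm (of_real (q ^ n * q ^ Suc n) * e n))"
    proof (rule summable_comparison_test'[where N = 0])
      fix n :: nat
      have "norm (of_real (q ^ n * q ^ Suc n) * e n) = norm (e n) * q ^ Suc n * q ^ n"
        using q_pos by (simp add: norm_mult norm_power mult_ac)
      also have "\<dots> \<le> B * 1 * q ^ n"
        using B B0 q_pos q_less_1 by (intro mult_right_mono mult_mono power_le_one) auto
      finally show "norm (norm (of_real (q ^ n * q ^ Suc n) * e n)) \<le> B * 1 * q ^ n" by simp
    qed
    fix w :: complex assume "w \<noteq> 0"
    define l where "l = csqrt (w / of_real (p * (q * sqrt q)))"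
    have l: "of_real p * arg2 l = w" unfolding l_def using q_pos by simp
    hence l0: "l \<noteq> 0" using \<open>w \<noteq> 0\<close> by auto
    have arg: "of_real (p ^ Suc n) * arg2 l = of_real (p ^ n) * w" for n
      unfolding l [symmetric] by simp
    have "(\<lambda>n. of_real (q ^ n) * e n * sn (Suc n) l) sums 0"
      using sin_tf_sums[of e B l, OF B] sin0[of l] by simp
    hence "(\<lambda>n. 1 / l * (of_real (q ^ n) * e n * sn (Suc n) l)) sums (1 / l * 0)" by (rule sums_mult)
    moreover have "1 / l * (of_real (q ^ n) * e n * sn (Suc n) l)
        = of_real (q ^ n * q ^ Suc n) * e n * gser q (\<lambda>n. qpoch q q (2 * n + 1)) (of_real (p ^ n) * w)" for n
      unfolding sn_eq arg phi1_def using l0 by simp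
    ultimately show "(\<Sum>n. of_real (q ^ n * q ^ Suc n) * e n *
        gser q (\<lambda>n. qpoch q q (2 * n + 1)) (of_real (p ^ n) * w)) = 0"
      by (simp add: sums_iff)
  qed
  thus ?thesis using q_pos by simp
qed

end

lemma dominated_by_summable:
  fixes g :: "nat \<Rightarrow> 'a \<Rightarrow> real"
  assumes bdd: "\<And>m. \<exists>C. \<forall>z\<in>Z. g m z \<le> C" and ev: "eventually (\<lambda>m. \<forall>z\<in>Z. g m z \<le> h m) sequentially"
    and h: "summable h"
  shows "\<exists>M. summable M \<and> (\<forall>m. \<forall>z\<in>Z. g m z \<le> M m)"
proof -
  obtain C where C: "\<And>m z. z \<in> Z \<Longrightarrow> g m z \<le> C m" using bdd by metis
  obtain N where N: "\<And>m z. m \<ge> N \<Longrightarrow> z \<in> Z \<Longrightarrow> g m z \<le> h m"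
    using ev unfolding eventually_sequentially by blast
  define M where "M m = (if m < N then C m else h m)" for m
  have "eventually (\<lambda>m. M m = h m) sequentially"
    unfolding eventually_sequentially M_def by (intro exI[of _ N]) auto
  hence "summable M" using h summable_cong by blast
  moreover have "\<forall>m. \<forall>z\<in>Z. g m z \<le> M m" using C N by (auto simp: M_def)
  ultimately show ?thesis by blast
qed

context q_base begin

section \<open>Orthogonal expansions on the grid\<close>

abbreviation cnorm :: "complex \<Rightarrow> complex" where
  "cnorm l \<equiv> cos_tf (\<lambda>n. cs n l) l"

lemma cs_orthogonal:
  assumes "qsin q l = 0" "qsin q v = 0" "l\<^sup>2 \<noteq> v\<^sup>2"
  shows "cos_tf (\<lambda>n. cs n l) v = 0"
  using lagrange_cos_tf[of l v] assms by simp

lemma sn_orthogonal: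
  assumes "qsin q l = 0" "qsin q v = 0" "l\<^sup>2 \<noteq> v\<^sup>2"
  shows "sin_tf (\<lambda>n. sn (Suc n) l) v = 0"
  using lagrange_sin_tf[of l v] assms q_pos by simp

lemma sin_norm_eq:
  assumes "qsin q l = 0" "l \<noteq> 0"
  shows "of_real (sqrt q) * sin_tf (\<lambda>n. sn (Suc n) l) l = cnorm l"
proof -
  have "2 * (of_real (sqrt q) * sin_tf (\<lambda>n. sn (Suc n) l) l) = 2 * cnorm l"
    by (rule trans[OF qsin_zero_norm(2)[OF assms] qsin_zero_norm(1)[OF assms, symmetric]])
  thus ?thesis unfolding mult_cancel_left by simp
qed

text \<open>The constant term of the Fourier series is the even basis function of frequency \<open>0\<close>. Since \<open>0\<close> is a zero
  of the \<open>q\<close>-sine as well, orthogonality treats it like the others.\<close>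

definition freq :: "nat \<Rightarrow> complex" where
  "freq k = (if k = 0 then 0 else of_real (qomega q k))"

lemma qsin_freq: "qsin q (freq k) = 0"
  using qomega(2)[of k] by (simp add: freq_def qsin_eq)

lemma freq_real: "freq k \<in> \<real>"
  by (simp add: freq_def)

lemma freq_Suc_nonzero: "freq (Suc k) \<noteq> 0"
  using qomega(1)[of "Suc k"] by (simp add: freq_def)

lemma freq_square_inj:
  assumes "j \<noteq> k"
  shows "(freq j)\<^sup>2 \<noteq> (freq k)\<^sup>2"
proof
  define x where "x k = (if k = 0 then 0 else qomega q k)" for k
  have x: "freq k = of_real (x k)" "x k \<ge> 0" for k
    using qomega(1)[of k] by (auto simp: freq_def x_def)
  assume "(freq j)\<^sup>2 = (freq k)\<^sup>2"
  hence "(x j)\<^sup>2 = (x k)\<^sup>2" unfolding x by (metis of_real_eq_iff of_real_power)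
  hence "x j = x k" using x(2) by (simp add: power2_eq_iff_nonneg)
  thus False using assms qomega(1)[of j] qomega(1)[of k] qomega_inj[of j k]
    by (auto simp: x_def split: if_splits)
qed

lemma cs_0_right: "cs n 0 = 1"
  using phi0.gser_0 by (simp add: cs_eq phi0_def)

lemma bounded_seq_le:
  fixes f :: "nat \<Rightarrow> nat \<Rightarrow> complex"
  assumes "\<And>k n. norm (f k n) \<le> M k" "summable M"
  shows "norm (\<Sum>k. f k n) \<le> suminf M"
  by (rule norm_suminf_le) (use assms in auto)

text \<open>The majorant permits exchanging the sum over frequencies with the sum over the grid, after which
  orthogonality leaves a single term.\<close>

lemma cos_tf_series:
  assumes M: "\<And>k n. norm (a k * cs n (freq k)) \<le> M k" "summable M"
  shows "cos_tf (\<lambda>n. \<Sum>k. a k * cs n (freq k)) (freq j) = a j * cnorm (freq j)"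
proof -
  obtain C where C: "\<And>n. norm (cs n (freq j)) \<le> C" using bounded_cs by blast
  have C0: "0 \<le> C" using C[of 0] norm_ge_zero order_trans by blast
  have M0: "0 \<le> M k" for k using M(1)[of k 0] norm_ge_zero order_trans by blast
  define f where "f n k = of_real (q ^ n) * (a k * cs n (freq k)) * cs n (freq j)" for n k
  have "(\<lambda>k. \<Sum>n. f n k) sums (\<Sum>n. \<Sum>k. f n k)"
  proof (rule suminf_swap_dominated)
    show "summable (\<lambda>n. C * q ^ n)" using q_pos q_less_1 by (intro summable_mult summable_geometric) auto
    show "summable M" by fact
    show "norm (f n k) \<le> C * q ^ n * M k" for n k
    proof -
      have "norm (f n k) = norm (a k * cs n (freq k)) * norm (cs n (freq j)) * q ^ n"
        unfolding f_def norm_mult using q_pos by (simp add: norm_power)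
      also have "\<dots> \<le> M k * C * q ^ n"
        using M C M0 q_pos by (intro mult_right_mono mult_mono) auto
      finally show ?thesis by (simp add: mult_ac)
    qed
  qed (use M0 C0 q_pos in auto)
  moreover have "(\<Sum>n. f n k) = (if k = j then a j * cnorm (freq j) else 0)" for k
  proof -
    obtain B where "\<And>n. norm (cs n (freq k)) \<le> B" using bounded_cs by blast
    from sums_mult[OF cos_tf_sums[of "\<lambda>n. cs n (freq k)" B "freq j", OF this], of "a k"]
    have "(\<lambda>n. f n k) sums (a k * cos_tf (\<lambda>n. cs n (freq k)) (freq j))"
      unfolding f_def by (simp add: mult_ac)
    moreover have "cos_tf (\<lambda>n. cs n (freq k)) (freq j) = 0" if "k \<noteq> j"
      using that by (intro cs_orthogonal qsin_freq freq_square_inj)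
    ultimately show ?thesis by (auto simp: sums_iff)
  qed
  moreover have "(\<Sum>k. f n k) = of_real (q ^ n) * (\<Sum>k. a k * cs n (freq k)) * cs n (freq j)" for n
  proof -
    have "summable (\<lambda>k. a k * cs n (freq k))"
      by (rule summable_comparison_test'[OF M(2), of 0]) (use M(1) in auto)
    thus ?thesis unfolding f_def by (simp add: suminf_mult suminf_mult2 [symmetric] summable_mult)
  qed
  ultimately have "(\<lambda>k. if k = j then a j * cnorm (freq j) else 0) sums
      cos_tf (\<lambda>n. \<Sum>k. a k * cs n (freq k)) (freq j)"
    by (simp add: cos_tf_def)
  moreover have "(\<lambda>k. if k = j then a j * cnorm (freq j) else 0) sums (a j * cnorm (freq j))"
    by (rule sums_single)
  ultimately show ?thesis by (rule sums_unique2)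
qed

lemma sin_tf_series:
  assumes M: "\<And>k n. norm (a k * sn (Suc n) (freq (Suc k))) \<le> M k" "summable M"
  shows "sin_tf (\<lambda>n. \<Sum>k. a k * sn (Suc n) (freq (Suc k))) (freq (Suc j))
     = a j * sin_tf (\<lambda>n. sn (Suc n) (freq (Suc j))) (freq (Suc j))"
proof -
  obtain C where C: "\<And>n. norm (sn (Suc n) (freq (Suc j))) \<le> C" using bounded_sn by blast
  have C0: "0 \<le> C" using C[of 0] norm_ge_zero order_trans by blast
  have M0: "0 \<le> M k" for k using M(1)[of k 0] norm_ge_zero order_trans by blast
  define f where "f n k = of_real (q ^ n) * (a k * sn (Suc n) (freq (Suc k))) * sn (Suc n) (freq (Suc j))" for n k
  have "(\<lambda>k. \<Sum>n. f n k) sums (\<Sum>n. \<Sum>k. f n k)"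
  proof (rule suminf_swap_dominated)
    show "summable (\<lambda>n. C * q ^ n)" using q_pos q_less_1 by (intro summable_mult summable_geometric) auto
    show "summable M" by fact
    show "norm (f n k) \<le> C * q ^ n * M k" for n k
    proof -
      have "norm (f n k) = norm (a k * sn (Suc n) (freq (Suc k))) * norm (sn (Suc n) (freq (Suc j))) * q ^ n"
        unfolding f_def norm_mult using q_pos by (simp add: norm_power)
      also have "\<dots> \<le> M k * C * q ^ n"
        using M C M0 q_pos by (intro mult_right_mono mult_mono) auto
      finally show ?thesis by (simp add: mult_ac)
    qed
  qed (use M0 C0 q_pos in auto)
  moreover have "(\<Sum>n. f n k) = (if k = j then a j * sin_tf (\<lambda>n. sn (Suc n) (freq (Suc j))) (freq (Suc j)) else 0)" for k
  proof -
    obtain B where "\<And>n. norm (sn (Suc n) (freq (Suc k))) \<le> B" using bounded_sn by blast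
    from sums_mult[OF sin_tf_sums[of "\<lambda>n. sn (Suc n) (freq (Suc k))" B "freq (Suc j)", OF this], of "a k"]
    have "(\<lambda>n. f n k) sums (a k * sin_tf (\<lambda>n. sn (Suc n) (freq (Suc k))) (freq (Suc j)))"
      unfolding f_def by (simp add: mult_ac)
    moreover have "sin_tf (\<lambda>n. sn (Suc n) (freq (Suc k))) (freq (Suc j)) = 0" if "k \<noteq> j"
      using that by (intro sn_orthogonal qsin_freq freq_square_inj) auto
    ultimately show ?thesis by (auto simp: sums_iff)
  qed
  moreover have "(\<Sum>k. f n k) = of_real (q ^ n) * (\<Sum>k. a k * sn (Suc n) (freq (Suc k))) * sn (Suc n) (freq (Suc j))" for n
  proof -
    have "summable (\<lambda>k. a k * sn (Suc n) (freq (Suc k)))"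
      by (rule summable_comparison_test'[OF M(2), of 0]) (use M(1) in auto)
    thus ?thesis unfolding f_def by (simp add: suminf_mult suminf_mult2 [symmetric] summable_mult)
  qed
  ultimately have "(\<lambda>k. if k = j then a j * sin_tf (\<lambda>n. sn (Suc n) (freq (Suc j))) (freq (Suc j)) else 0) sums
      sin_tf (\<lambda>n. \<Sum>k. a k * sn (Suc n) (freq (Suc k))) (freq (Suc j))"
    by (simp add: sin_tf_def)
  moreover have "(\<lambda>k. if k = j then a j * sin_tf (\<lambda>n. sn (Suc n) (freq (Suc j))) (freq (Suc j)) else 0)
      sums (a j * sin_tf (\<lambda>n. sn (Suc n) (freq (Suc j))) (freq (Suc j)))"
    by (rule sums_single)
  ultimately show ?thesis by (rule sums_unique2)
qed

lemma cos_tf_diff: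
  assumes "\<And>n. norm (e n) \<le> B" "\<And>n. norm (h n) \<le> C"
  shows "cos_tf (\<lambda>n. e n - h n) l = cos_tf e l - cos_tf h l"
  using sums_diff[OF cos_tf_sums[of e B l] cos_tf_sums[of h C l]] assms
  unfolding cos_tf_def[of "\<lambda>n. e n - h n"] by (simp add: sums_iff algebra_simps)

lemma sin_tf_diff:
  assumes "\<And>n. norm (e n) \<le> B" "\<And>n. norm (h n) \<le> C"
  shows "sin_tf (\<lambda>n. e n - h n) l = sin_tf e l - sin_tf h l"
  using sums_diff[OF sin_tf_sums[of e B l] sin_tf_sums[of h C l]] assms
  unfolding sin_tf_def[of "\<lambda>n. e n - h n"] by (simp add: sums_iff algebra_simps)

text \<open>The difference of \<open>e\<close> and its series is bounded and its transform vanishes at all frequencies,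
  hence it is zero by completeness.\<close>

lemma cos_expansion:
  assumes B: "\<And>n. norm (e n) \<le> B"
    and a: "\<And>k. a k * cnorm (freq k) = cos_tf e (freq k)"
    and M: "\<And>k n. norm (a k * cs n (freq k)) \<le> M k" "summable M"
  shows "e n = (\<Sum>k. a k * cs n (freq k))"
proof -
  define h where "h n = (\<Sum>k. a k * cs n (freq k))" for n
  have h: "norm (h n) \<le> suminf M" for n unfolding h_def by (rule bounded_seq_le) (use M in auto)
  have z: "cos_tf (\<lambda>n. e n - h n) (freq k) = 0" for k
    unfolding cos_tf_diff[of e B h "suminf M", OF B h]
    using a[of k] cos_tf_series[of a M k] M by (simp add: h_def[abs_def])
  have "e n - h n = 0"
  proof (rule cos_complete[of "\<lambda>n. e n - h n" "B + suminf M"])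
    show "norm (e n - h n) \<le> B + suminf M" for n
      using norm_triangle_ineq4[of "e n" "h n"] B[of n] h[of n] by linarith
    show "(\<Sum>n. of_real (q ^ n) * (e n - h n)) = 0"
      using z[of 0] by (simp add: cos_tf_def freq_def cs_0_right)
    show "cos_tf (\<lambda>n. e n - h n) (of_real (qomega q k)) = 0" if "k > 0" for k
      using z[of k] that by (simp add: freq_def)
  qed
  thus ?thesis by (simp add: h_def)
qed

lemma sin_expansion:
  assumes B: "\<And>n. norm (e n) \<le> B"
    and a: "\<And>k. a k * sin_tf (\<lambda>n. sn (Suc n) (freq (Suc k))) (freq (Suc k)) = sin_tf e (freq (Suc k))"
    and M: "\<And>k n. norm (a k * sn (Suc n) (freq (Suc k))) \<le> M k" "summable M"
  shows "e n = (\<Sum>k. a k * sn (Suc n) (freq (Suc k)))"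
proof -
  define h where "h n = (\<Sum>k. a k * sn (Suc n) (freq (Suc k)))" for n
  have h: "norm (h n) \<le> suminf M" for n unfolding h_def by (rule bounded_seq_le) (use M in auto)
  have z: "sin_tf (\<lambda>n. e n - h n) (freq (Suc k)) = 0" for k
    unfolding sin_tf_diff[of e B h "suminf M", OF B h]
    using a[of k] sin_tf_series[of a M k] M by (simp add: h_def[abs_def])
  have "e n - h n = 0"
  proof (rule sin_complete[of "\<lambda>n. e n - h n" "B + suminf M"])
    show "norm (e n - h n) \<le> B + suminf M" for n
      using norm_triangle_ineq4[of "e n" "h n"] B[of n] h[of n] by linarith
    show "sin_tf (\<lambda>n. e n - h n) (of_real (qomega q k)) = 0" if "k > 0" for k
      using z[of "k - 1"] that by (simp add: freq_def)
  qed
  thus ?thesis by (simp add: h_def)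
qed

section \<open>Size of the normalising constants\<close>

text \<open>A single term of the sum suffices: the one with index \<open>n = m + N + 1\<close>, where \<open>N\<close> is fixed so large that
  \<open>q ^ n\<close> times the frequency, which is of order \<open>q ^ N\<close> at most, keeps the \<open>q\<close>-cosine close to \<open>1\<close>.\<close>

lemma cnorm_lower:
  "\<exists>\<kappa>>0. eventually (\<lambda>m. \<kappa> * q ^ m \<le> norm (cnorm (freq (Suc m)))) sequentially"
proof -
  have "phi0 \<midarrow>0\<rightarrow> 1"
    using phi0.continuous_gser[of 0] phi0.gser_0 by (simp add: isCont_def phi0_def)
  hence "eventually (\<lambda>w. dist (phi0 w) 1 < 1/2) (at 0)" by (rule tendstoD) simp
  then obtain \<eta> where \<eta>: "\<eta> > 0" "\<And>w. w \<noteq> 0 \<Longrightarrow> norm w < \<eta> \<Longrightarrow> norm (phi0 w - 1) < 1/2"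
    by (auto simp: eventually_at dist_norm)
  have "eventually (\<lambda>N. p ^ N < \<eta>) sequentially"
    using order_tendstoD(2)[OF p_power_tendsto \<eta>(1)] .
  then obtain N where N: "p ^ N < \<eta>" by (auto simp: eventually_sequentially)
  define \<kappa> where "\<kappa> = q ^ Suc N / 4"
  have "\<kappa> > 0" unfolding \<kappa>_def using q_pos by simp
  moreover have "eventually (\<lambda>m. norm (arg2 (of_real (qomega q (Suc m)))) \<le> rho (1/2) m) sequentially"
    by (rule qomega_le) auto
  hence "eventually (\<lambda>m. \<kappa> * q ^ m \<le> norm (cnorm (freq (Suc m)))) sequentially"
  proof eventually_elim
    case (elim m)
    define l where "l = freq (Suc m)"
    have "rho (1/2) m \<le> q powr (- real (2 * Suc m))"
      unfolding rho_def using q_pos q_less_1 by (intro powr_mono') auto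
    also have "\<dots> = 1 / p ^ Suc m"
      by (simp only: powr_minus_divide powr_realpow[OF q_pos] p_power_eq)
    finally have "norm (arg2 l) \<le> 1 / p ^ Suc m"
      using elim by (simp add: l_def freq_def)
    hence "p ^ Suc (m + N) * norm (arg2 l) \<le> p ^ Suc (m + N) * (1 / p ^ Suc m)"
      using p_pos by (intro mult_left_mono) auto
    also have "\<dots> = p ^ N" using p_pos by (simp add: power_add)
    finally have "norm (of_real (p ^ Suc (m + N)) * arg2 l) < \<eta>"
      using N p_pos unfolding norm_mult[of "of_real (p ^ Suc (m + N))"] norm_of_real by simp
    moreover have "of_real (p ^ Suc (m + N)) * arg2 l \<noteq> 0"
      using q_pos freq_Suc_nonzero[of m] by (simp add: l_def)
    ultimately have "norm (cs (Suc (m + N)) l - 1) < 1/2" unfolding cs_eq using \<eta>(2) by blast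
    hence "norm (cs (Suc (m + N)) l) \<ge> 1/2"
      using norm_triangle_ineq2[of 1 "1 - cs (Suc (m + N)) l"] by (simp add: norm_minus_commute)
    hence "(1/2)\<^sup>2 \<le> (norm (cs (Suc (m + N)) l))\<^sup>2" by (intro power_mono) auto
    hence "q ^ Suc (m + N) * (1/2)\<^sup>2 \<le> q ^ Suc (m + N) * (norm (cs (Suc (m + N)) l))\<^sup>2"
      using q_pos by (intro mult_left_mono) auto
    also have "\<dots> \<le> norm (cnorm l)" unfolding l_def by (rule cos_tf_ge[OF freq_real])
    also have "q ^ Suc (m + N) * (1/2)\<^sup>2 = \<kappa> * q ^ m"
      by (simp add: \<kappa>_def power_add power2_eq_square)
    finally show ?case by (simp add: l_def)
  qed
  ultimately show ?thesis by blast
qed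

section \<open>Majorants for the series\<close>

lemma arg2_mult: "norm (arg2 (l * z)) = norm (arg2 l) * (norm z)\<^sup>2"
  by (simp add: power_mult_distrib norm_mult norm_power mult_ac)

lemma cs_bounded_on: "\<exists>C. \<forall>z\<in>cball 0 r. norm (cs 0 (l * z)) \<le> C"
proof -
  have "norm (cs 0 (l * z)) \<le> Kq * q powr (- ((- log q (max 1 (q * sqrt q * (norm l * r)\<^sup>2)) + 1)\<^sup>2 / 4))"
    if "z \<in> cball 0 r" for z
    using that by (intro norm_cs_le arg2_le_powr) (auto simp: norm_mult intro!: mult_left_mono)
  thus ?thesis by blast
qed

lemma sn_bounded_on: "\<exists>C. \<forall>z\<in>cball 0 r. norm (sn (Suc 0) (l * z)) \<le> C"
proof -
  have "norm (sn (Suc 0) (l * z)) \<le> Kq * (norm l * r *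
      q powr (- ((- log q (max 1 (q * sqrt q * (norm l * r)\<^sup>2)) - 1)\<^sup>2 / 4)))"
    if z: "z \<in> cball 0 r" for z
  proof -
    have lz: "norm (l * z) \<le> norm l * r" using z by (auto simp: norm_mult intro!: mult_left_mono)
    have "norm (sn (Suc 0) (l * z)) \<le> Kq * (norm (l * z) *
      q powr (- ((- log q (max 1 (q * sqrt q * (norm l * r)\<^sup>2)) - 1)\<^sup>2 / 4)))"
      by (intro norm_sn_Suc_le arg2_le_powr lz)
    also have "\<dots> \<le> Kq * (norm l * r *
      q powr (- ((- log q (max 1 (q * sqrt q * (norm l * r)\<^sup>2)) - 1)\<^sup>2 / 4)))"
      using Kq_pos by (intro mult_left_mono mult_right_mono lz) auto
    finally show ?thesis .
  qed
  thus ?thesis by blast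
qed

lemma arg2_freq_growth:
  assumes eps: "0 < \<epsilon>" "\<epsilon> < 1"
  shows "eventually (\<lambda>m. \<forall>z\<in>cball 0 (q powr (- \<sigma>)).
    norm (arg2 (freq (Suc m) * z)) \<le> q powr (- (2 * (real m + (\<epsilon> + \<sigma>))))) sequentially"
  using qomega_le[OF eps]
proof eventually_elim
  case (elim m)
  show ?case
  proof
    fix z :: complex assume "z \<in> cball 0 (q powr (- \<sigma>))"
    hence "(norm z)\<^sup>2 \<le> (q powr (- \<sigma>))\<^sup>2" by (intro power_mono) auto
    also have "\<dots> = q powr (- (2 * \<sigma>))" by (simp add: power2_eq_square flip: powr_add)
    finally have z2: "(norm z)\<^sup>2 \<le> q powr (- (2 * \<sigma>))" .
    have "norm (arg2 (freq (Suc m) * z)) = norm (arg2 (freq (Suc m))) * (norm z)\<^sup>2" by (rule arg2_mult)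
    also have "\<dots> \<le> rho \<epsilon> m * q powr (- (2 * \<sigma>))"
      using elim z2 rho_pos[of \<epsilon> m] by (intro mult_mono) (auto simp: freq_def)
    also have "\<dots> = q powr (- (2 * (real m + (\<epsilon> + \<sigma>))))"
      unfolding rho_def powr_add [symmetric] by (simp add: algebra_simps)
    finally show "norm (arg2 (freq (Suc m) * z)) \<le> q powr (- (2 * (real m + (\<epsilon> + \<sigma>))))" .
  qed
qed

lemma cs_growth:
  assumes eps: "0 < \<epsilon>" "\<epsilon> < 1"
  shows "eventually (\<lambda>m. \<forall>z\<in>cball 0 (q powr (- \<sigma>)).
    norm (cs 0 (freq (Suc m) * z)) \<le> Kq * q powr (- (real m + (\<epsilon> + \<sigma>) + 1 / 2)\<^sup>2)) sequentially"
  using arg2_freq_growth[OF eps, of \<sigma>]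
proof eventually_elim
  case (elim m)
  have "(2 * (real m + (\<epsilon> + \<sigma>)) + 1)\<^sup>2 / 4 = (real m + (\<epsilon> + \<sigma>) + 1 / 2)\<^sup>2"
    by (simp add: power2_eq_square field_simps)
  thus ?case using elim norm_cs_le by metis
qed

lemma sn_growth:
  assumes eps: "0 < \<epsilon>" "\<epsilon> < 1"
  shows "\<exists>K>0. eventually (\<lambda>m. \<forall>z\<in>cball 0 (q powr (- \<sigma>)).
    norm (sn (Suc 0) (freq (Suc m) * z)) \<le>
      K * q powr (- (real m + (\<epsilon> + \<sigma>)) - (real m + (\<epsilon> + \<sigma>) - 1 / 2)\<^sup>2)) sequentially"
proof -
  define D where "D = sqrt (1 / (q * sqrt q))"
  have D: "D > 0" unfolding D_def using q_pos by simp
  have "eventually (\<lambda>m. \<forall>z\<in>cball 0 (q powr (- \<sigma>)).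
    norm (sn (Suc 0) (freq (Suc m) * z)) \<le>
      Kq * D * q powr (- (real m + (\<epsilon> + \<sigma>)) - (real m + (\<epsilon> + \<sigma>) - 1 / 2)\<^sup>2)) sequentially"
    using arg2_freq_growth[OF eps, of \<sigma>]
  proof eventually_elim
    case (elim m)
    define x where "x = real m + (\<epsilon> + \<sigma>)"
    show ?case unfolding x_def [symmetric]
    proof
      fix z :: complex assume "z \<in> cball 0 (q powr (- \<sigma>))"
      hence le: "norm (arg2 (freq (Suc m) * z)) \<le> q powr (- (2 * x))" using elim by (simp add: x_def)
      have "q * sqrt q * (norm (freq (Suc m) * z))\<^sup>2 \<le> q powr (- (2 * x))"
        using le q_pos by (simp add: norm_mult norm_power)
      hence "(norm (freq (Suc m) * z))\<^sup>2 \<le> 1 / (q * sqrt q) * q powr (- (2 * x))"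
        using q_pos by (simp add: field_simps)
      also have "\<dots> = (D * q powr (- x))\<^sup>2"
      proof -
        have "(q powr (- x))\<^sup>2 = q powr (- (2 * x))" by (simp add: power2_eq_square flip: powr_add)
        thus ?thesis unfolding D_def power_mult_distrib using q_pos by simp
      qed
      finally have n: "norm (freq (Suc m) * z) \<le> D * q powr (- x)"
        by (rule power2_le_imp_le) (use D in auto)
      have e: "(2 * x - 1)\<^sup>2 / 4 = (x - 1 / 2)\<^sup>2" by (simp add: power2_eq_square field_simps)
      have "norm (sn (Suc 0) (freq (Suc m) * z))
          \<le> Kq * (norm (freq (Suc m) * z) * q powr (- ((2 * x - 1)\<^sup>2 / 4)))"
        by (rule norm_sn_Suc_le[OF le])
      also have "\<dots> \<le> Kq * (D * q powr (- x) * q powr (- ((2 * x - 1)\<^sup>2 / 4)))"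
        using Kq_pos by (intro mult_left_mono mult_right_mono n) auto
      also have "\<dots> = Kq * D * q powr (- x - (x - 1 / 2)\<^sup>2)"
        unfolding e by (simp add: mult.assoc flip: powr_add)
      finally show "norm (sn (Suc 0) (freq (Suc m) * z)) \<le> Kq * D * q powr (- x - (x - 1 / 2)\<^sup>2)" .
    qed
  qed
  thus ?thesis using Kq_pos D by (intro exI[of _ "Kq * D"]) auto
qed

lemma summable_gauss_quotient:
  assumes "s < c"
  shows "summable (\<lambda>m. K * q powr (2 * real m * (c - s) + t))"
proof -
  have "q powr (2 * (c - s)) < 1"
    using powr_less_mono'[of q 0 "2 * (c - s)"] q_pos q_less_1 assms by simp
  hence "summable (\<lambda>m. K * q powr t * (q powr (2 * (c - s))) ^ m)"
    by (intro summable_mult summable_geometric) simp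
  moreover have eq: "K * q powr t * (q powr (2 * (c - s))) ^ m = K * q powr (2 * real m * (c - s) + t)" for m
  proof -
    have "(q powr (2 * (c - s))) ^ m = q powr (2 * real m * (c - s))"
      using q_pos by (simp add: powr_power mult_ac)
    thus ?thesis by (simp add: powr_add mult_ac)
  qed
  ultimately show ?thesis by (simp only: eq)
qed

text \<open>The decay \<open>q powr ((m + 1 + c)\<^sup>2 - m)\<close> of the coefficients against the growth
  \<open>q powr (- (m + \<epsilon> + \<sigma> + 1/2)\<^sup>2)\<close> of the basis functions leaves a geometric series of ratio
  \<open>q powr (2 * (c - \<sigma> - \<epsilon>))\<close>; this is why \<open>\<sigma>\<close> must be smaller than \<open>c\<close>, and \<open>\<epsilon>\<close> is taken below
  \<open>c - \<sigma>\<close>.\<close>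

lemma cos_majorant:
  assumes X: "eventually (\<lambda>m. norm (X m) \<le> K * q powr ((real m + 1 + c)\<^sup>2 - real m)) sequentially"
    and "K \<ge> 0" and "\<sigma> < c"
  shows "\<exists>M. summable M \<and> (\<forall>m. \<forall>z\<in>cball 0 (q powr (- \<sigma>)). norm (X m * cs 0 (freq (Suc m) * z)) \<le> M m)"
proof -
  define \<epsilon> where "\<epsilon> = min (1/2) ((c - \<sigma>) / 2)"
  have eps: "0 < \<epsilon>" "\<epsilon> < 1" "\<epsilon> + \<sigma> < c" using \<open>\<sigma> < c\<close> by (auto simp: \<epsilon>_def min_def field_simps)
  define s where "s = \<epsilon> + \<sigma>"
  define t where "t = (1 + c)\<^sup>2 - (s + 1 / 2)\<^sup>2"
  show ?thesis
  proof (rule dominated_by_summable)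
    fix m
    obtain C where C: "\<forall>z\<in>cball 0 (q powr (- \<sigma>)). norm (cs 0 (freq (Suc m) * z)) \<le> C"
      using cs_bounded_on by blast
    show "\<exists>C. \<forall>z\<in>cball 0 (q powr (- \<sigma>)). norm (X m * cs 0 (freq (Suc m) * z)) \<le> C"
      by (rule exI[of _ "norm (X m) * C"]) (use C in \<open>auto simp: norm_mult intro!: mult_left_mono\<close>)
  next
    show "eventually (\<lambda>m. \<forall>z\<in>cball 0 (q powr (- \<sigma>)). norm (X m * cs 0 (freq (Suc m) * z))
        \<le> K * Kq * q powr (2 * real m * (c - s) + t)) sequentially"
      using X cs_growth[OF eps(1,2), of \<sigma>]
    proof eventually_elim
      case (elim m)
      show ?case
      proof
        fix z :: complex assume z: "z \<in> cball 0 (q powr (- \<sigma>))"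
        have "norm (X m * cs 0 (freq (Suc m) * z))
            \<le> (K * q powr ((real m + 1 + c)\<^sup>2 - real m)) * (Kq * q powr (- (real m + s + 1 / 2)\<^sup>2))"
          unfolding norm_mult using elim z \<open>K \<ge> 0\<close> by (intro mult_mono) (auto simp: s_def)
        also have "\<dots> = K * Kq * q powr ((real m + 1 + c)\<^sup>2 - real m + - (real m + s + 1 / 2)\<^sup>2)"
          by (simp only: powr_add mult_ac)
        also have "(real m + 1 + c)\<^sup>2 - real m + - (real m + s + 1 / 2)\<^sup>2 = 2 * real m * (c - s) + t"
          by (simp add: t_def power2_eq_square algebra_simps)
        finally show "norm (X m * cs 0 (freq (Suc m) * z)) \<le> K * Kq * q powr (2 * real m * (c - s) + t)" .
      qed
    qed
    show "summable (\<lambda>m. K * Kq * q powr (2 * real m * (c - s) + t))"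
      using eps(3) by (intro summable_gauss_quotient) (simp add: s_def)
  qed
qed

lemma sin_majorant:
  assumes X: "eventually (\<lambda>m. norm (X m) \<le> K * q powr ((real m + 1 / 2 + c)\<^sup>2 - real m)) sequentially"
    and "K \<ge> 0" and "\<sigma> < c"
  shows "\<exists>M. summable M \<and> (\<forall>m. \<forall>z\<in>cball 0 (q powr (- \<sigma>)). norm (X m * sn (Suc 0) (freq (Suc m) * z)) \<le> M m)"
proof -
  define \<epsilon> where "\<epsilon> = min (1/2) ((c - \<sigma>) / 2)"
  have eps: "0 < \<epsilon>" "\<epsilon> < 1" "\<epsilon> + \<sigma> < c" using \<open>\<sigma> < c\<close> by (auto simp: \<epsilon>_def min_def field_simps)
  define s where "s = \<epsilon> + \<sigma>"
  define t where "t = (1 / 2 + c)\<^sup>2 - s - (s - 1 / 2)\<^sup>2"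
  obtain L where "L > 0" and L: "eventually (\<lambda>m. \<forall>z\<in>cball 0 (q powr (- \<sigma>)).
    norm (sn (Suc 0) (freq (Suc m) * z)) \<le> L * q powr (- (real m + (\<epsilon> + \<sigma>)) - (real m + (\<epsilon> + \<sigma>) - 1 / 2)\<^sup>2)) sequentially"
    using sn_growth[OF eps(1,2)] by blast
  show ?thesis
  proof (rule dominated_by_summable)
    fix m
    obtain C where C: "\<forall>z\<in>cball 0 (q powr (- \<sigma>)). norm (sn (Suc 0) (freq (Suc m) * z)) \<le> C"
      using sn_bounded_on by blast
    show "\<exists>C. \<forall>z\<in>cball 0 (q powr (- \<sigma>)). norm (X m * sn (Suc 0) (freq (Suc m) * z)) \<le> C"
      by (rule exI[of _ "norm (X m) * C"]) (use C in \<open>auto simp: norm_mult intro!: mult_left_mono\<close>)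
  next
    show "eventually (\<lambda>m. \<forall>z\<in>cball 0 (q powr (- \<sigma>)). norm (X m * sn (Suc 0) (freq (Suc m) * z))
        \<le> K * L * q powr (2 * real m * (c - s) + t)) sequentially"
      using X L
    proof eventually_elim
      case (elim m)
      show ?case
      proof
        fix z :: complex assume z: "z \<in> cball 0 (q powr (- \<sigma>))"
        have "norm (X m * sn (Suc 0) (freq (Suc m) * z))
            \<le> (K * q powr ((real m + 1 / 2 + c)\<^sup>2 - real m)) * (L * q powr (- (real m + s) - (real m + s - 1 / 2)\<^sup>2))"
          unfolding norm_mult using elim z \<open>K \<ge> 0\<close> by (intro mult_mono) (auto simp: s_def)
        also have "\<dots> = K * L * q powr ((real m + 1 / 2 + c)\<^sup>2 - real m + (- (real m + s) - (real m + s - 1 / 2)\<^sup>2))"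
          by (simp only: powr_add mult_ac)
        also have "(real m + 1 / 2 + c)\<^sup>2 - real m + (- (real m + s) - (real m + s - 1 / 2)\<^sup>2) = 2 * real m * (c - s) + t"
          by (simp add: t_def power2_eq_square algebra_simps)
        finally show "norm (X m * sn (Suc 0) (freq (Suc m) * z)) \<le> K * L * q powr (2 * real m * (c - s) + t)" .
      qed
    qed
    show "summable (\<lambda>m. K * L * q powr (2 * real m * (c - s) + t))"
      using eps(3) by (intro summable_gauss_quotient) (simp add: s_def)
  qed
qed

section \<open>The q-Fourier series\<close>

lemma qint_symmetric:
  assumes "summable (\<lambda>n. g (of_real (q ^ n)) * of_real (q ^ n))"
    and "summable (\<lambda>n. g (- of_real (q ^ n)) * of_real (q ^ n))"
  shows "qint q (- 1) 1 g = of_real (1 - q) * (\<Sum>n. (g (of_real (q ^ n)) + g (- of_real (q ^ n))) * of_real (q ^ n))"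
proof -
  have "(\<Sum>n. (g (of_real (q ^ n)) + g (- of_real (q ^ n))) * of_real (q ^ n))
      = (\<Sum>n. g (of_real (q ^ n)) * of_real (q ^ n)) + (\<Sum>n. g (- of_real (q ^ n)) * of_real (q ^ n))"
    unfolding suminf_add[OF assms] by (simp add: ring_distribs)
  thus ?thesis unfolding qint_def qint0_def by (simp add: ring_distribs)
qed

definition even_part :: "(complex \<Rightarrow> complex) \<Rightarrow> nat \<Rightarrow> complex" where
  "even_part f n = f (of_real (q ^ n)) + f (- of_real (q ^ n))"
definition odd_part :: "(complex \<Rightarrow> complex) \<Rightarrow> nat \<Rightarrow> complex" where
  "odd_part f n = f (of_real (q ^ n)) - f (- of_real (q ^ n))"

lemma qcos_integral_eq:
  assumes B: "\<And>n. norm (f (of_real (q ^ n))) \<le> B" "\<And>n. norm (f (- of_real (q ^ n))) \<le> B"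
  shows "qint q (- 1) 1 (\<lambda>t. f t * qcos q (of_real (sqrt q) * l * t)) = of_real (1 - q) * cos_tf (even_part f) l"
proof -
  obtain C where C: "\<And>n. norm (cs n l) \<le> C" using bounded_cs by blast
  have c: "qcos q (of_real (sqrt q) * l * of_real (q ^ n)) = cs n l"
       "qcos q (of_real (sqrt q) * l * - of_real (q ^ n)) = cs n l" for n
  proof -
    show "qcos q (of_real (sqrt q) * l * of_real (q ^ n)) = cs n l" by (simp add: cs_def)
    have "qcos q (of_real (sqrt q) * l * - of_real (q ^ n)) = cs n (- l)" by (simp add: cs_def)
    thus "qcos q (of_real (sqrt q) * l * - of_real (q ^ n)) = cs n l" by (simp only: cs_minus)
  qed
  have s: "summable (\<lambda>n. f (of_real (q ^ n)) * cs n l * of_real (q ^ n))"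
     "summable (\<lambda>n. f (- of_real (q ^ n)) * cs n l * of_real (q ^ n))"
    using weighted_geometric(2)[of "\<lambda>n. f (of_real (q ^ n))" B "\<lambda>n. cs n l" C]
      weighted_geometric(2)[of "\<lambda>n. f (- of_real (q ^ n))" B "\<lambda>n. cs n l" C] B C
    by (simp_all add: mult_ac)
  show ?thesis
    by (subst qint_symmetric, unfold c)
       (rule s, rule s, simp add: cos_tf_def even_part_def algebra_simps)
qed

lemma qsin_integral_eq:
  assumes B: "\<And>n. norm (f (of_real (q ^ n))) \<le> B" "\<And>n. norm (f (- of_real (q ^ n))) \<le> B"
  shows "qint q (- 1) 1 (\<lambda>t. f t * qsin q (of_real q * l * t)) = of_real (1 - q) * sin_tf (odd_part f) l"
proof -
  obtain C where C: "\<And>n. norm (sn (Suc n) l) \<le> C" using bounded_sn by blast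
  have c: "qsin q (of_real q * l * of_real (q ^ n)) = sn (Suc n) l"
       "qsin q (of_real q * l * - of_real (q ^ n)) = - sn (Suc n) l" for n
  proof -
    show "qsin q (of_real q * l * of_real (q ^ n)) = sn (Suc n) l" by (simp add: sn_def mult_ac)
    have "qsin q (of_real q * l * - of_real (q ^ n)) = sn (Suc n) (- l)" by (simp add: sn_def mult_ac)
    thus "qsin q (of_real q * l * - of_real (q ^ n)) = - sn (Suc n) l" by (simp only: sn_minus)
  qed
  have s: "summable (\<lambda>n. f (of_real (q ^ n)) * sn (Suc n) l * of_real (q ^ n))"
     "summable (\<lambda>n. f (- of_real (q ^ n)) * - sn (Suc n) l * of_real (q ^ n))"
    using weighted_geometric(2)[of "\<lambda>n. f (of_real (q ^ n))" B "\<lambda>n. sn (Suc n) l" C]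
      weighted_geometric(2)[of "\<lambda>n. f (- of_real (q ^ n))" B "\<lambda>n. - sn (Suc n) l" C] B C
    by (simp_all add: mult_ac)
  show ?thesis
    by (subst qint_symmetric, unfold c)
       (rule s, rule s, simp add: sin_tf_def odd_part_def algebra_simps)
qed

lemma qmu_eq: "qmu q (Suc m) = of_real (2 * (1 - q)) * cnorm (freq (Suc m))"
proof -
  have "2 * cnorm (freq (Suc m)) = deriv (qsin q) (freq (Suc m)) * cs 0 (freq (Suc m))"
    by (rule qsin_zero_norm(1)[OF qsin_freq freq_Suc_nonzero])
  moreover have "qmu q (Suc m) = of_real (1 - q) * (deriv (qsin q) (freq (Suc m)) * cs 0 (freq (Suc m)))"
    by (simp add: qmu_def cs_def freq_def mult_ac)
  ultimately show ?thesis by (metis mult.assoc mult.commute of_real_mult of_real_numeral)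
qed

lemma cnorm_freq_nonzero: "cnorm (freq k) \<noteq> 0"
  by (rule cos_tf_nonzero[OF freq_real])

lemma bigo_quotient_bound:
  assumes O: "g \<in> O(\<lambda>k. complex_of_real (q powr ((real k + d)\<^sup>2)))"
  shows "\<exists>K\<ge>0. eventually (\<lambda>m. norm (g (Suc m) / qmu q (Suc m)) \<le> K * q powr ((real m + (1 + d))\<^sup>2 - real m)) sequentially"
proof -
  obtain C where C: "C > 0" and ev: "eventually (\<lambda>k. norm (g k) \<le> C * norm (complex_of_real (q powr ((real k + d)\<^sup>2)))) sequentially"
    using landau_o.bigE[OF O] by blast
  obtain \<kappa> where \<kappa>: "\<kappa> > 0" and low: "eventually (\<lambda>m. \<kappa> * q ^ m \<le> norm (cnorm (freq (Suc m)))) sequentially"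
    using cnorm_lower by blast
  define K where "K = C / (2 * (1 - q) * \<kappa>)"
  have ev': "eventually (\<lambda>m. norm (g (Suc m)) \<le> C * norm (complex_of_real (q powr ((real (Suc m) + d)\<^sup>2)))) sequentially"
    using eventually_compose_filterlim[OF ev filterlim_Suc] by simp
  have "eventually (\<lambda>m. norm (g (Suc m) / qmu q (Suc m)) \<le> K * q powr ((real m + (1 + d))\<^sup>2 - real m)) sequentially"
    using ev' low
  proof eventually_elim
    case (elim m)
    have pos: "0 < 2 * (1 - q) * (\<kappa> * q ^ m)" using \<kappa> q_pos q_less_1 by simp
    have "norm (qmu q (Suc m)) = 2 * (1 - q) * norm (cnorm (freq (Suc m)))"
      unfolding qmu_eq norm_mult norm_of_real using q_less_1 by simp
    hence mu: "2 * (1 - q) * (\<kappa> * q ^ m) \<le> norm (qmu q (Suc m))"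
      using elim(2) q_less_1 by simp
    have gle: "norm (g (Suc m)) \<le> C * q powr ((real m + (1 + d))\<^sup>2)"
      using elim(1) by (simp add: algebra_simps)
    have "norm (g (Suc m) / qmu q (Suc m)) = norm (g (Suc m)) / norm (qmu q (Suc m))" by (rule norm_divide)
    also have "\<dots> \<le> C * q powr ((real m + (1 + d))\<^sup>2) / (2 * (1 - q) * (\<kappa> * q ^ m))"
      by (intro frac_le order_trans[OF norm_ge_zero gle] gle mu pos)
    also have "\<dots> = K * (q powr ((real m + (1 + d))\<^sup>2) / q powr real m)"
      using q_pos by (simp add: K_def powr_realpow)
    also have "\<dots> = K * q powr ((real m + (1 + d))\<^sup>2 - real m)" by (simp only: powr_diff)
    finally show ?case .
  qed
  moreover have "K \<ge> 0" unfolding K_def using C \<kappa> q_less_1 by simp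
  ultimately show ?thesis by blast
qed

lemma qfourier_term_eq:
  "qfourier_term q f z (Suc m) = qfourier_a q f (Suc m) * cs 0 (freq (Suc m) * z)
     + qfourier_b q f (Suc m) * sn (Suc 0) (freq (Suc m) * z)"
  by (simp add: qfourier_term_def cs_def sn_def freq_def mult_ac)

text \<open>By the majorants, the series converges to a function \<open>F\<close> that is holomorphic in the disc of radius
  \<open>q powr (- \<sigma>)\<close>, which contains the grid. The expansions on the grid give \<open>F = f\<close> there, and the grid
  accumulates at \<open>0\<close>.\<close>

lemma q_fourier_expansion:
  assumes f: "f \<in> Lq_infty q"
    and Ocos: "qcos_integral q f \<in> O(\<lambda>k. complex_of_real (q powr ((real k + c)\<^sup>2)))"
    and Osin: "qsin_integral q f \<in> O(\<lambda>k. complex_of_real (q powr ((real k + c - 1 / 2)\<^sup>2)))"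
    and \<sigma>: "0 < \<sigma>" "\<sigma> < c" and \<delta>: "0 < \<delta>" "\<delta> \<le> q powr (- \<sigma>)"
    and ana: "f analytic_on ball 0 \<delta>" and z: "z \<in> ball 0 \<delta>"
  shows "summable (\<lambda>k. qfourier_term q f z (Suc k))" "f z = qfourier q f z"
proof -
  obtain B where B: "\<And>x. x \<in> Vq q \<Longrightarrow> norm (f x) \<le> B"
    using f unfolding Lq_infty_def bdd_above_def by auto
  have Bf: "norm (f (of_real (q ^ n))) \<le> B" "norm (f (- of_real (q ^ n))) \<le> B" for n
    by (rule B, unfold Vq_def, blast)+
  have Be: "norm (even_part f n) \<le> 2 * B" for n
    unfolding even_part_def using norm_triangle_ineq[of "f (of_real (q ^ n))" "f (- of_real (q ^ n))"] Bf[of n] by linarith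
  have Bo: "norm (odd_part f n) \<le> 2 * B" for n
    unfolding odd_part_def using norm_triangle_ineq4[of "f (of_real (q ^ n))" "f (- of_real (q ^ n))"] Bf[of n] by linarith
  define r where "r = q powr (- \<sigma>)"
  define A where "A m = qfourier_a q f (Suc m)" for m
  define D where "D m = qfourier_b q f (Suc m)" for m
  have a_eq: "2 * A m * cnorm (freq (Suc m)) = cos_tf (even_part f) (freq (Suc m))" for m
  proof -
    define u where "u = complex_of_real (1 - q)"
    have u: "u \<noteq> 0" unfolding u_def using q_less_1 by (simp only: of_real_eq_0_iff)
    have "qcos_integral q f (Suc m) = u * cos_tf (even_part f) (freq (Suc m))"
      using qcos_integral_eq[of f B "freq (Suc m)", OF Bf]
      by (simp add: qcos_integral_def freq_def u_def)
    moreover have "qmu q (Suc m) = 2 * u * cnorm (freq (Suc m))"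
      unfolding qmu_eq u_def by (simp only: of_real_mult of_real_numeral)
    ultimately show ?thesis using cnorm_freq_nonzero[of "Suc m"] u
      by (simp add: A_def qfourier_a_def field_simps)
  qed
  have b_eq: "2 * D m * sin_tf (\<lambda>n. sn (Suc n) (freq (Suc m))) (freq (Suc m)) = sin_tf (odd_part f) (freq (Suc m))" for m
  proof -
    have i: "qsin_integral q f (Suc m) = of_real (1 - q) * sin_tf (odd_part f) (freq (Suc m))"
      using qsin_integral_eq[of f B "freq (Suc m)", OF Bf] by (simp add: qsin_integral_def freq_def)
    define N where "N = cnorm (freq (Suc m))"
    define S where "S = sin_tf (\<lambda>n. sn (Suc n) (freq (Suc m))) (freq (Suc m))"
    have N: "N \<noteq> 0" "of_real (sqrt q) * S = N" "qmu q (Suc m) = of_real (2 * (1 - q)) * N"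
      using cnorm_freq_nonzero[of "Suc m"] sin_norm_eq[OF qsin_freq freq_Suc_nonzero, of m] qmu_eq[of m]
      by (simp_all add: N_def S_def)
    have "2 * D m * S = 2 * (of_real (sqrt q) * S) / qmu q (Suc m) * qsin_integral q f (Suc m)"
      by (simp add: D_def qfourier_b_def)
    also have "\<dots> = sin_tf (odd_part f) (freq (Suc m))"
    proof -
      have "of_real (1 - q) \<noteq> (0::complex)" using q_less_1 by (simp only: of_real_eq_0_iff)
      thus ?thesis unfolding i N(2,3) using N(1) by (simp only: of_real_mult) (simp add: field_simps)
    qed
    finally show ?thesis by (simp add: S_def)
  qed
  obtain K1 where K1: "K1 \<ge> 0" "eventually (\<lambda>m. norm (qcos_integral q f (Suc m) / qmu q (Suc m)) \<le> K1 * q powr ((real m + (1 + c))\<^sup>2 - real m)) sequentially"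
    using bigo_quotient_bound[OF Ocos] by blast
  hence "eventually (\<lambda>m. norm (A m) \<le> K1 * q powr ((real m + 1 + c)\<^sup>2 - real m)) sequentially"
    by (simp add: A_def qfourier_a_def add.assoc)
  from cos_majorant[OF this K1(1) \<sigma>(2)] obtain M1 where M1: "summable M1"
     "\<And>m z. z \<in> cball 0 r \<Longrightarrow> norm (A m * cs 0 (freq (Suc m) * z)) \<le> M1 m"
    unfolding r_def by blast
  have "qsin_integral q f \<in> O(\<lambda>k. complex_of_real (q powr ((real k + (c - 1 / 2))\<^sup>2)))"
    using Osin by (simp add: add_diff_eq)
  then obtain K2 where K2: "K2 \<ge> 0" "eventually (\<lambda>m. norm (qsin_integral q f (Suc m) / qmu q (Suc m)) \<le> K2 * q powr ((real m + (1 + (c - 1 / 2)))\<^sup>2 - real m)) sequentially"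
    using bigo_quotient_bound by blast
  have "eventually (\<lambda>m. norm (D m) \<le> sqrt q * K2 * q powr ((real m + 1 / 2 + c)\<^sup>2 - real m)) sequentially"
    using K2(2)
  proof eventually_elim
    case (elim m)
    have e: "real m + (1 + (c - 1 / 2)) = real m + 1 / 2 + c" by simp
    have "norm (D m) = sqrt q * norm (qsin_integral q f (Suc m) / qmu q (Suc m))"
      using q_pos by (simp add: D_def qfourier_b_def norm_mult norm_divide)
    also have "\<dots> \<le> sqrt q * (K2 * q powr ((real m + 1 / 2 + c)\<^sup>2 - real m))"
      using elim[unfolded e] q_pos by (intro mult_left_mono) auto
    finally show ?case by simp
  qed
  from sin_majorant[OF this _ \<sigma>(2)] obtain M2 where M2: "summable M2"
     "\<And>m z. z \<in> cball 0 r \<Longrightarrow> norm (D m * sn (Suc 0) (freq (Suc m) * z)) \<le> M2 m"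
    unfolding r_def using K2(1) q_pos by auto
  define F where "F z = qfourier_a0 q f / 2 + (\<Sum>m. qfourier_term q f z (Suc m))" for z
  have term_le: "norm (qfourier_term q f z (Suc m)) \<le> M1 m + M2 m" if "z \<in> cball 0 r" for z m
    unfolding qfourier_term_eq A_def [symmetric] D_def [symmetric]
    using norm_triangle_ineq[of "A m * cs 0 (freq (Suc m) * z)" "D m * sn (Suc 0) (freq (Suc m) * z)"]
      M1(2)[OF that, of m] M2(2)[OF that, of m] by linarith
  have M12: "summable (\<lambda>m. M1 m + M2 m)" by (intro summable_add M1(1) M2(1))
  have term_summable: "summable (\<lambda>m. qfourier_term q f z (Suc m))" if "z \<in> cball 0 r" for z
    by (rule summable_comparison_test'[OF M12, of 0]) (rule term_le[OF that])
  have z_r: "z \<in> cball 0 r" using z \<delta>(2) by (simp add: r_def)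
  show "summable (\<lambda>k. qfourier_term q f z (Suc k))" by (rule term_summable[OF z_r])
  have r1: "1 \<le> r" unfolding r_def using powr_mono'[of "- \<sigma>" 0 q] q_pos q_less_1 \<sigma>(1) by simp
  have grid: "of_real (q ^ n) \<in> cball (0::complex) r" for n
  proof -
    have "q ^ n \<le> 1" using q_pos q_less_1 by (intro power_le_one) auto
    thus ?thesis using r1 q_pos by (simp add: norm_power)
  qed
  have cs_grid: "cs n l = cs 0 (l * of_real (q ^ n))" for n l by (simp add: cs_def mult_ac)
  have sn_grid: "sn (Suc n) l = sn (Suc 0) (l * of_real (q ^ n))" for n l by (simp add: sn_def mult_ac)
  have cnorm0: "cnorm (freq 0) = of_real (1 / (1 - q))"
  proof -
    have "(\<lambda>n. of_real (q ^ n)) sums (of_real (1 / (1 - q)) :: complex)"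
      using q_pos q_less_1 by (intro sums_of_real geometric_sums) auto
    thus ?thesis by (simp add: cos_tf_def freq_def cs_0_right sums_iff)
  qed
  have a0: "qfourier_a0 q f = of_real (1 - q) * cos_tf (even_part f) (freq 0)"
    using qcos_integral_eq[of f B 0, OF Bf] cs_0_right[of 0]
    by (simp add: qfourier_a0_def freq_def cs_def)
  define a where "a k = (case k of 0 \<Rightarrow> qfourier_a0 q f | Suc m \<Rightarrow> 2 * A m)" for k
  define M where "M k = (case k of 0 \<Rightarrow> norm (qfourier_a0 q f) | Suc m \<Rightarrow> 2 * M1 m)" for k
  have M: "norm (a k * cs n (freq k)) \<le> M k" for k n
  proof (cases k)
    case 0
    thus ?thesis by (simp add: a_def M_def freq_def cs_0_right)
  next
    case (Suc m)
    have "norm (a k * cs n (freq k)) = 2 * norm (A m * cs 0 (freq (Suc m) * of_real (q ^ n)))"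
      unfolding Suc cs_grid[of n] by (simp add: a_def norm_mult)
    thus ?thesis using M1(2)[OF grid, of m n] by (simp add: M_def Suc)
  qed
  have "summable (\<lambda>m. M (Suc m))" using M1(1) by (simp add: M_def summable_mult)
  hence sM: "summable M" by (subst (asm) summable_Suc_iff)
  have even: "even_part f n = qfourier_a0 q f + 2 * (\<Sum>m. A m * cs 0 (freq (Suc m) * of_real (q ^ n)))" for n
  proof -
    have "even_part f n = (\<Sum>k. a k * cs n (freq k))"
    proof (rule cos_expansion[OF Be _ M sM])
      fix k
      have "of_real (1 - q) * of_real (1 / (1 - q)) = (1::complex)"
        using q_less_1 by (simp only: of_real_mult [symmetric]) simp
      thus "a k * cnorm (freq k) = cos_tf (even_part f) (freq k)"
        using a_eq cnorm0 a0 by (cases k) (simp_all add: a_def mult_ac del: of_real_diff of_real_divide)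
    qed
    also have "\<dots> = a 0 * cs n (freq 0) + (\<Sum>m. a (Suc m) * cs n (freq (Suc m)))"
      by (subst suminf_split_head) (auto intro!: summable_comparison_test'[OF sM, of 0] M)
    also have "(\<Sum>m. a (Suc m) * cs n (freq (Suc m))) = (\<Sum>m. 2 * (A m * cs 0 (freq (Suc m) * of_real (q ^ n))))"
      unfolding cs_grid[of n] by (simp add: a_def mult.assoc)
    also have "\<dots> = 2 * (\<Sum>m. A m * cs 0 (freq (Suc m) * of_real (q ^ n)))"
      by (intro suminf_mult summable_comparison_test'[OF M1(1), of 0] M1(2) grid)
    finally show ?thesis by (simp add: a_def freq_def cs_0_right)
  qed
  have odd: "odd_part f n = 2 * (\<Sum>m. D m * sn (Suc 0) (freq (Suc m) * of_real (q ^ n)))" for n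
  proof -
    have "odd_part f n = (\<Sum>m. 2 * D m * sn (Suc n) (freq (Suc m)))"
    proof (rule sin_expansion[OF Bo b_eq])
      show "norm (2 * D m * sn (Suc n) (freq (Suc m))) \<le> 2 * M2 m" for m n
        unfolding sn_grid[of n] using M2(2)[OF grid, of m n] by (simp add: norm_mult)
      show "summable (\<lambda>m. 2 * M2 m)" by (intro summable_mult M2(1))
    qed
    also have "\<dots> = (\<Sum>m. 2 * (D m * sn (Suc 0) (freq (Suc m) * of_real (q ^ n))))"
      unfolding sn_grid[of n] by (simp add: mult.assoc)
    also have "\<dots> = 2 * (\<Sum>m. D m * sn (Suc 0) (freq (Suc m) * of_real (q ^ n)))"
      by (intro suminf_mult summable_comparison_test'[OF M2(1), of 0] M2(2) grid)
    finally show ?thesis .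
  qed
  have on_grid: "f (of_real (q ^ n)) = F (of_real (q ^ n))" for n
  proof -
    have sA: "summable (\<lambda>m. A m * cs 0 (freq (Suc m) * of_real (q ^ n)))"
      by (rule summable_comparison_test'[OF M1(1), of 0]) (rule M1(2)[OF grid])
    have sD: "summable (\<lambda>m. D m * sn (Suc 0) (freq (Suc m) * of_real (q ^ n)))"
      by (rule summable_comparison_test'[OF M2(1), of 0]) (rule M2(2)[OF grid])
    have "F (of_real (q ^ n)) = qfourier_a0 q f / 2
        + ((\<Sum>m. A m * cs 0 (freq (Suc m) * of_real (q ^ n))) + (\<Sum>m. D m * sn (Suc 0) (freq (Suc m) * of_real (q ^ n))))"
      unfolding F_def qfourier_term_eq A_def [symmetric] D_def [symmetric] suminf_add[OF sA sD] ..
    also have "\<dots> = (even_part f n + odd_part f n) / 2"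
      unfolding even odd by (simp add: field_simps)
    also have "\<dots> = f (of_real (q ^ n))" by (simp add: even_part_def odd_part_def)
    finally show ?thesis by simp
  qed
  have F: "F holomorphic_on ball 0 r"
  proof -
    have "(\<lambda>z. \<Sum>m. qfourier_term q f z (Suc m)) holomorphic_on ball 0 r"
    proof (rule holomorphic_suminf[OF open_ball _ _ M12])
      show "(\<lambda>z. qfourier_term q f z (Suc m)) holomorphic_on ball 0 r" for m
        unfolding qfourier_term_def by (intro holomorphic_intros)
      show "norm (qfourier_term q f z (Suc m)) \<le> M1 m + M2 m" if "z \<in> ball 0 r" for m z
        using that by (intro term_le) auto
    qed
    thus ?thesis unfolding F_def[abs_def] by (intro holomorphic_intros)
  qed
  have "f z - F z = 0"
  proof (rule analytic_continuation[where f = "\<lambda>z. f z - F z" and w = z and S = "ball 0 \<delta>" and U = "range (\<lambda>n. of_real (q ^ n)) \<inter> ball 0 \<delta>" and \<xi> = 0])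
    show "(\<lambda>z. f z - F z) holomorphic_on ball 0 \<delta>"
    proof (rule holomorphic_on_diff[OF analytic_imp_holomorphic[OF ana] holomorphic_on_subset[OF F]])
      show "ball 0 \<delta> \<subseteq> ball (0::complex) r" using \<delta>(2) unfolding r_def by (rule subset_ball)
    qed
    show "f w - F w = 0" if "w \<in> range (\<lambda>n. of_real (q ^ n)) \<inter> ball 0 \<delta>" for w
      using that on_grid by auto
    show "(0::complex) islimpt range (\<lambda>n. of_real (q ^ n)) \<inter> ball 0 \<delta>"
      unfolding islimpt_def
    proof (intro allI impI)
      fix T :: "complex set" assume T: "0 \<in> T" "open T"
      have "(\<lambda>n. of_real (q ^ n) :: complex) \<longlonglongrightarrow> of_real 0"
        using q_pos q_less_1 by (intro tendsto_of_real LIMSEQ_realpow_zero) auto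
      hence "eventually (\<lambda>n. of_real (q ^ n) \<in> T \<inter> ball (0::complex) \<delta>) sequentially"
        using T \<delta>(1) by (intro topological_tendstoD) auto
      then obtain n where "of_real (q ^ n) \<in> T \<inter> ball (0::complex) \<delta>" by (auto simp: eventually_sequentially)
      thus "\<exists>y\<in>range (\<lambda>n. of_real (q ^ n)) \<inter> ball 0 \<delta>. y \<in> T \<and> y \<noteq> (0::complex)"
        using q_pos by (intro bexI[of _ "of_real (q ^ n)"]) auto
    qed
  qed (use \<delta>(1) z in auto)
  thus "f z = qfourier q f z" by (simp add: F_def qfourier_def)
qed

end

theorem theorem5p1:
  fixes q c \<sigma> \<delta> :: real and f :: "complex \<Rightarrow> complex"
  assumes "0 < q" and "q \<le> (1 / 51) powr (1 / 50)"
    and "f \<in> Lq_infty q"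
    and "c > 0"
    and "qcos_integral q f \<in> O(\<lambda>k. complex_of_real (q powr ((real k + c)\<^sup>2)))"
    and "qsin_integral q f \<in> O(\<lambda>k. complex_of_real (q powr ((real k + c - 1 / 2)\<^sup>2)))"
    and "0 < \<sigma>" and "\<sigma> < c"
    and "0 < \<delta>" and "\<delta> \<le> q powr (- \<sigma>)"
    and "f analytic_on ball 0 \<delta>"
  shows "\<forall>z \<in> ball 0 \<delta>. summable (\<lambda>k. qfourier_term q f z (Suc k)) \<and> f z = qfourier q f z"
proof -
  have "(1 / 51 :: real) powr (1 / 50) < 1"
    using powr_less_mono'[of "1 / 51" 0 "1 / 50"] by simp
  then interpret q_base q using assms(1,2) by unfold_locales auto
  show ?thesis using q_fourier_expansion[OF assms(3,5,6,7,8,9,10,11)] by blast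
qed

end
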